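(* Fix $\varepsilon>0$. If the edge-probability $p=p(n)$ satisfies $n^{-2/5+\varepsilon}\ll p\ll n^{-1/3}$ or $n^{-1/3+\varepsilon}\ll p\ll 1$, then with high probability the clique chromatic number of the binomial random graph $G_{n,p}$ satisfies $$\chi_c(G_{n,p})=\Theta\bigl(\log(n)/p\bigr).$$
   Context: $G_{n,p}$ is the binomial random graph on vertex set $\{1,\dots,n\}$, in which each pair of vertices is an edge independently with probability $p=p(n)\in(0,1)$. The clique chromatic number $\chi_c(G)$ of a graph $G$ is the smallest number of colors in a vertex coloring of $G$ so that no inclusion-maximal clique is monochromatic, where isolated vertices are ignored (i.e., only inclusion-maximal cliques with at least two vertices matter). All asymptotics are as $n\to\infty$; $f\ll g$ means $f/g\to0$; $\log$ is the natural logarithm. "With high probability" means with probability tending to $1$ as $n\to\infty$. The conclusion means that there are constants $c,C>0$ (which may depend on the fixed $\varepsilon$) such that with high probability $c\log(n)/p\le\chi_c(G_{n,p})\le C\log(n)/p$. *)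

theory Defs
  imports "HOL-Probability.Probability" "HOL-Probability.Product_PMF" "HOL-Library.Landau_Symbols"
begin

text \<open>
  A simple graph is given by its vertex set \<open>V\<close> and its set \<open>E\<close> of edges, an edge being a
  two-element subset of \<open>V\<close>.
\<close>

definition vertex_pairs :: "'a set \<Rightarrow> 'a set set" where
  "vertex_pairs V = {e. e \<subseteq> V \<and> card e = 2}"

definition clique :: "'a set \<Rightarrow> 'a set set \<Rightarrow> 'a set \<Rightarrow> bool" where
  "clique V E K \<longleftrightarrow> K \<subseteq> V \<and> (\<forall>u\<in>K. \<forall>v\<in>K. u \<noteq> v \<longrightarrow> {u, v} \<in> E)"

definition maximal_clique :: "'a set \<Rightarrow> 'a set set \<Rightarrow> 'a set \<Rightarrow> bool" where
  "maximal_clique V E K \<longleftrightarrow> clique V E K \<and> (\<forall>L. clique V E L \<and> K \<subseteq> L \<longrightarrow> L = K)"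

definition monochromatic :: "('a \<Rightarrow> 'c) \<Rightarrow> 'a set \<Rightarrow> bool" where
  "monochromatic f K \<longleftrightarrow> (\<exists>a. \<forall>v\<in>K. f v = a)"

text \<open>
  The condition \<open>card K \<ge> 2\<close> is what ignores isolated vertices: these are exactly the maximal
  cliques with a single element.
\<close>

definition clique_coloring :: "'a set \<Rightarrow> 'a set set \<Rightarrow> ('a \<Rightarrow> 'c) \<Rightarrow> bool" where
  "clique_coloring V E f \<longleftrightarrow>
     (\<forall>K. maximal_clique V E K \<and> card K \<ge> 2 \<longrightarrow> \<not> monochromatic f K)"

definition clique_chromatic_number :: "'a set \<Rightarrow> 'a set set \<Rightarrow> nat" where
  "clique_chromatic_number V E =
     (LEAST k. \<exists>f :: 'a \<Rightarrow> nat. f ` V \<subseteq> {..<k} \<and> clique_coloring V E f)"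

text \<open>The set over which the minimum is taken is nonempty for finite graphs.\<close>

lemma ex_clique_coloring:
  assumes "finite V"
  shows "\<exists>k. \<exists>f :: 'a \<Rightarrow> nat. f ` V \<subseteq> {..<k} \<and> clique_coloring V E f"
proof -
  obtain f :: "'a \<Rightarrow> nat" where f: "inj_on f V"
    using finite_imp_inj_to_nat_seg[OF assms] by blast
  have "\<not> monochromatic f K" if "K \<subseteq> V" "card K \<ge> 2" for K
  proof
    assume "monochromatic f K"
    then have "\<forall>u\<in>K. \<forall>v\<in>K. u = v"
      using f that(1) unfolding monochromatic_def inj_on_def by (metis subsetD)
    then have "card K \<le> 1"
      by (metis card_le_Suc0_iff_eq One_nat_def card.infinite le0)
    with that(2) show False by simp
  qed
  then have "clique_coloring V E f"
    by (auto simp: clique_coloring_def maximal_clique_def clique_def)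
  moreover obtain k where "f ` V \<subseteq> {..<k}"
    using finite_nat_iff_bounded[of "f ` V"] assms by auto
  ultimately show ?thesis by blast
qed

text \<open>The random edge set of $G_{n,p}$: independent coin flips, one for each pair of vertices.\<close>

definition binomial_random_graph :: "nat \<Rightarrow> real \<Rightarrow> nat set set pmf" where
  "binomial_random_graph n p =
     map_pmf (\<lambda>b. {e \<in> vertex_pairs {1..n}. b e})
       (Pi_pmf (vertex_pairs {1..n}) False (\<lambda>_. bernoulli_pmf p))"

end

theory Submission
  imports Defs "HOL-Real_Asymp.Real_Asymp"
begin

text \<open>
  Upper bound: any \<open>2 log n / p + 1\<close> vertices are likely to dominate all vertices, and colouring each
  vertex by a neighbour among them is a clique colouring, since a clique of one colour extends by
  that neighbour.

  Lower bound: a set without a maximal clique must be almost contained in few neighbourhoods.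
  Remove from each colour class the neighbourhoods of boundedly many vertices, greedily, as long as
  this shrinks the class by a factor \<open>n powr (- e / 8)\<close>. If there are fewer than \<open>c log n / p\<close> colours,
  all the removed vertices together leave \<open>n powr (1 - o(1))\<close> vertices undominated, so that a large set
  \<open>U\<close> survives in some class, and every outside vertex has many non-neighbours in \<open>U\<close>. A union bound
  over \<open>U\<close> controls the degrees of the outside vertices into \<open>U\<close>, and it follows that a positive fraction
  of the \<open>r\<close>-tuples of a suitable product of subsets of \<open>U\<close> has no common neighbour outside \<open>U\<close>. This
  depends only on the edges that leave \<open>U\<close>, so these tuples form a fixed family with respect to the
  edges inside \<open>U\<close>, and by Janson's inequality one of them is a clique, with a failure probability
  small enough for the union bound over \<open>U\<close>. A maximal clique containing it lies inside \<open>U\<close>.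
\<close>

section \<open>Random subsets\<close>

text \<open>The clique size \<open>r\<close> faces two opposing demands. Typical tuples have no
  common neighbour if \<open>n p^r\<close> is small. Janson's exponent, about
  \<open>u^2 p^(r/2)\<close> with \<open>u\<close> close to \<open>n p\<close>, must beat the cost
  of about \<open>u log n\<close> of the union bound over \<open>U\<close>, so
  \<open>n p^(1 + r/2)\<close> must be a power of \<open>n\<close>. For \<open>r = 3\<close> this
  means \<open>p\<close> between n^(-2/5) and n^(-1/3). For \<open>r = 4\<close> the second demand
  reads \<open>n p^3\<close> large, so around n^(-1/3) the size 3 is already too small and 4 still
  too large; above n^(-1/3 + e) some \<open>r\<close> always fits.

  The union bound also rules out degree estimates for single vertices: some outside vertices may be
  joined to almost all of an atypical \<open>U\<close>. Only the total degree of all dense vertices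
  together can be controlled, and the few extreme ones are harmless merely because the greedy
  removal guarantees them non-neighbours in \<open>U\<close>. As each removal gains a fixed power of
  \<open>n\<close>, boundedly many per class suffice, and this bound enters the constant
  \<open>c\<close>.

  All estimates are for fixed \<open>n\<close>; the limit is taken only at the end, so the constants
  do not depend on the function \<open>p\<close>.\<close>

definition random_subset :: "'a set \<Rightarrow> real \<Rightarrow> 'a set pmf" where
  "random_subset X p = map_pmf (\<lambda>b. {x \<in> X. b x}) (Pi_pmf X False (\<lambda>_. bernoulli_pmf p))"

abbreviation rsprob :: "'a set \<Rightarrow> real \<Rightarrow> 'a set set \<Rightarrow> real" where
  "rsprob X p S \<equiv> measure_pmf.prob (random_subset X p) S"

lemma random_subset_empty: "random_subset {} p = return_pmf {}"
  by (simp add: random_subset_def)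

lemma random_subset_insert:
  assumes "finite X" "x \<notin> X"
  shows "random_subset (insert x X) p =
    bernoulli_pmf p \<bind> (\<lambda>c. map_pmf (if c then insert x else id) (random_subset X p))"
proof -
  have *: "{z \<in> insert x X. (b(x := c)) z} = (if c then insert x else id) {z \<in> X. b z}" for b c
    using assms(2) by auto
  show ?thesis
    unfolding random_subset_def Pi_pmf_insert'[OF assms] map_bind_pmf map_return_pmf * map_pmf_comp
    by (simp add: map_pmf_def bind_assoc_pmf bind_return_pmf)
qed

lemma rsprob_empty: "rsprob {} p S = indicator S {}"
  by (simp add: random_subset_empty)

text \<open>Conditioning on a single coin. The exact formulas and the correlation and independence
  facts below come from this recursion, by induction over the ground set.\<close>

lemma rsprob_insert:
  assumes "finite X" "x \<notin> X" "0 \<le> p" "p \<le> 1"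
  shows "rsprob (insert x X) p S = p * rsprob X p {E. insert x E \<in> S} + (1 - p) * rsprob X p S"
proof -
  have "rsprob (insert x X) p S =
      measure_pmf.expectation (bernoulli_pmf p)
        (\<lambda>c. rsprob X p ((if c then insert x else id) -` S))"
    unfolding random_subset_insert[OF assms(1,2)] measure_pmf_bind
    by (subst measure_pmf.measure_bind[where N = "count_space UNIV"])
       (auto simp: measure_pmf_in_subprob_algebra space_subprob_algebra subprob_space_measure_pmf)
  also have "\<dots> = p * rsprob X p {E. insert x E \<in> S} + (1 - p) * rsprob X p S"
    using assms(3,4) by (simp add: vimage_def)
  finally show ?thesis .
qed

lemma set_random_subset:
  assumes "finite X"
  shows "set_pmf (random_subset X p) \<subseteq> Pow X"
  by (auto simp: random_subset_def)

lemma rsprob_mono: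
  assumes "finite X" "\<And>E. E \<subseteq> X \<Longrightarrow> E \<in> S \<Longrightarrow> E \<in> S'"
  shows "rsprob X p S \<le> rsprob X p S'"
  by (rule measure_pmf.finite_measure_mono_AE)
     (use assms set_random_subset[OF assms(1), of p] in \<open>auto simp: AE_measure_pmf_iff\<close>)

lemma rsprob_UN_le:
  assumes "finite I"
  shows "rsprob X p (\<Union>i\<in>I. S i) \<le> (\<Sum>i\<in>I. rsprob X p (S i))"
  by (rule measure_pmf.finite_measure_subadditive_finite) (use assms in auto)

section \<open>Monotone events, correlation and independence\<close>

definition up_event :: "'a set set \<Rightarrow> bool" where
  "up_event S \<longleftrightarrow> (\<forall>E F. E \<in> S \<and> E \<subseteq> F \<longrightarrow> F \<in> S)"

definition down_event :: "'a set set \<Rightarrow> bool" where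
  "down_event S \<longleftrightarrow> (\<forall>E F. F \<in> S \<and> E \<subseteq> F \<longrightarrow> E \<in> S)"

text \<open>Induction over the coins. When the exposed coin is switched on, the conditional
  probability of the increasing event goes up and that of the decreasing event goes down.\<close>

lemma harris_inequality:
  assumes "finite X" "0 \<le> p" "p \<le> 1" "up_event S" "down_event S'"
  shows "rsprob X p (S \<inter> S') \<le> rsprob X p S * rsprob X p S'"
  using assms(1,4,5)
proof (induction X arbitrary: S S' rule: finite_induct)
  case empty
  then show ?case by (simp add: rsprob_empty indicator_def)
next
  case (insert x X)
  define T where "T = {E. insert x E \<in> S}"
  define T' where "T' = {E. insert x E \<in> S'}"
  have up: "up_event T"
    unfolding up_event_def
  proof (intro allI impI)
    fix E F assume "E \<in> T \<and> E \<subseteq> F"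
    then have "insert x E \<in> S" "insert x E \<subseteq> insert x F" by (auto simp: T_def)
    with insert.prems(1) have "insert x F \<in> S" unfolding up_event_def by blast
    then show "F \<in> T" by (simp add: T_def)
  qed
  have dn: "down_event T'"
    unfolding down_event_def
  proof (intro allI impI)
    fix E F assume "F \<in> T' \<and> E \<subseteq> F"
    then have "insert x F \<in> S'" "insert x E \<subseteq> insert x F" by (auto simp: T'_def)
    with insert.prems(2) have "insert x E \<in> S'" unfolding down_event_def by blast
    then show "E \<in> T'" by (simp add: T'_def)
  qed
  have eq: "{E. insert x E \<in> S \<inter> S'} = T \<inter> T'" by (auto simp: T_def T'_def)
  have le: "rsprob X p S \<le> rsprob X p T"
    by (intro rsprob_mono insert.hyps) (use insert.prems(1) in \<open>unfold up_event_def T_def, blast\<close>)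
  have le': "rsprob X p T' \<le> rsprob X p S'"
    by (intro rsprob_mono insert.hyps) (use insert.prems(2) in \<open>unfold down_event_def T'_def, blast\<close>)
  let ?a = "rsprob X p S" and ?a' = "rsprob X p S'" and ?b = "rsprob X p T" and ?b' = "rsprob X p T'"
  \<comment> \<open>The two-point case of Chebyshev's sum inequality: this product is the difference
    between the product of the means and the mean of the products.\<close>
  have "0 \<le> p * (1 - p) * ((?b - ?a) * (?a' - ?b'))"
    using assms le le' by (intro mult_nonneg_nonneg) auto
  then have "p * (?b * ?b') + (1 - p) * (?a * ?a') \<le> (p * ?b + (1 - p) * ?a) * (p * ?b' + (1 - p) * ?a')"
    by (simp add: algebra_simps)
  moreover have "p * rsprob X p (T \<inter> T') + (1 - p) * rsprob X p (S \<inter> S')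
      \<le> p * (?b * ?b') + (1 - p) * (?a * ?a')"
    by (intro add_mono mult_left_mono insert.IH up dn insert.prems) (use assms in auto)
  ultimately show ?case
    unfolding rsprob_insert[OF insert.hyps(1,2) assms(2,3)] eq T_def[symmetric] T'_def[symmetric]
    by (rule order_trans[rotated])
qed

text \<open>Independence is expressed by insensitivity: \<open>S\<close> ignores the coins of
  \<open>Y\<close>, and \<open>S'\<close> those of \<open>X\<close>. Exposing the coins of
  \<open>Y\<close> one by one changes only \<open>S'\<close>, which in the end is constant on the
  subsets of \<open>X\<close>.\<close>

lemma rsprob_independent:
  assumes "finite X" "finite Y" "0 \<le> p" "p \<le> 1"
    "\<And>y E. y \<in> Y \<Longrightarrow> insert y E \<in> S \<longleftrightarrow> E \<in> S"
    "\<And>y E. y \<in> X \<Longrightarrow> insert y E \<in> S' \<longleftrightarrow> E \<in> S'"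
  shows "rsprob (X \<union> Y) p (S \<inter> S') = rsprob (X \<union> Y) p S * rsprob (X \<union> Y) p S'"
  using assms(2,5,6)
proof (induction Y arbitrary: S' rule: finite_induct)
  case empty
  have *: "E \<in> S' \<longleftrightarrow> {} \<in> S'" if "E \<subseteq> X" for E
    using finite_subset[OF that assms(1)] that
    by (induction E rule: finite_induct) (auto simp: empty.prems)
  show ?case
  proof (cases "{} \<in> S'")
    case True
    have "rsprob X p (S \<inter> S') = rsprob X p S"
      by (intro antisym rsprob_mono assms) (use * True in auto)
    moreover have "rsprob X p S' = rsprob X p UNIV"
      by (intro antisym rsprob_mono assms) (use * True in auto)
    ultimately show ?thesis by simp
  next
    case False
    have "rsprob X p (S \<inter> S') = rsprob X p {}"
      by (intro antisym rsprob_mono assms) (use * False in auto)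
    moreover have "rsprob X p S' = rsprob X p {}"
      by (intro antisym rsprob_mono assms) (use * False in auto)
    ultimately show ?thesis by simp
  qed
next
  case (insert y Y)
  show ?case
  proof (cases "y \<in> X")
    case True
    then have "X \<union> insert y Y = X \<union> Y" by auto
    with insert show ?thesis by auto
  next
    case False
    have yn: "y \<notin> X \<union> Y" using False insert.hyps by auto
    have fin: "finite (X \<union> Y)" using assms(1) insert.hyps by simp
    define T' where "T' = {E. insert y E \<in> S'}"
    have eq: "{E. insert y E \<in> S \<inter> S'} = S \<inter> T'" "{E. insert y E \<in> S} = S"
      using insert.prems(1) by (auto simp: T'_def)
    have 1: "rsprob (X \<union> Y) p (S \<inter> T') = rsprob (X \<union> Y) p S * rsprob (X \<union> Y) p T'"
      by (rule insert.IH) (use insert.prems in \<open>auto simp: T'_def insert_commute\<close>)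
    have 2: "rsprob (X \<union> Y) p (S \<inter> S') = rsprob (X \<union> Y) p S * rsprob (X \<union> Y) p S'"
      by (rule insert.IH) (use insert.prems in auto)
    show ?thesis
      unfolding Un_insert_right rsprob_insert[OF fin yn assms(3,4)] eq 1 2 T'_def[symmetric]
      by (simp add: algebra_simps)
  qed
qed

text \<open>Law of total probability over the coins of \<open>Y\<close>. It allows a family
  determined by the outcome \<open>C\<close> to be treated as fixed while the coins of
  \<open>X\<close> are still random.\<close>

lemma rsprob_fiber_le:
  assumes "finite X" "finite Y" "X \<inter> Y = {}" "0 \<le> p" "p \<le> 1"
    "\<And>C. C \<subseteq> Y \<Longrightarrow> rsprob X p {E. E \<union> C \<in> S} \<le> q"
  shows "rsprob (X \<union> Y) p S \<le> q"
  using assms(2,3,6)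
proof (induction Y arbitrary: S rule: finite_induct)
  case empty
  show ?case using empty(2)[of "{}"] by simp
next
  case (insert y Y)
  have yn: "y \<notin> X \<union> Y" and fin: "finite (X \<union> Y)" using insert assms(1) by auto
  have 1: "rsprob (X \<union> Y) p {E. insert y E \<in> S} \<le> q"
  proof (rule insert.IH)
    fix C assume "C \<subseteq> Y"
    then show "rsprob X p {E. E \<union> C \<in> {E. insert y E \<in> S}} \<le> q"
      using insert.prems(2)[of "insert y C"] by auto
  qed (use insert.prems in auto)
  have 2: "rsprob (X \<union> Y) p S \<le> q"
    by (rule insert.IH) (use insert.prems in auto)
  have "p * rsprob (X \<union> Y) p {E. insert y E \<in> S} + (1 - p) * rsprob (X \<union> Y) p S \<le> p * q + (1 - p) * q"
    by (intro add_mono mult_left_mono 1 2) (use assms in auto)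
  then show ?case by (simp add: rsprob_insert[OF fin yn assms(4,5)] algebra_simps)
qed

section \<open>Containing, avoiding and hitting given sets\<close>

lemma rsprob_superset:
  assumes "finite X" "0 \<le> p" "p \<le> 1" "T \<subseteq> X"
  shows "rsprob X p {E. T \<subseteq> E} = p ^ card T"
  using assms(1,4)
proof (induction X arbitrary: T rule: finite_induct)
  case empty
  then show ?case by (simp add: rsprob_empty)
next
  case (insert x X)
  show ?case
  proof (cases "x \<in> T")
    case False
    then have "{E. T \<subseteq> insert x E} = {E. T \<subseteq> E}" "T \<subseteq> X" using insert by auto
    then show ?thesis using insert.IH[of T] insert.hyps assms(2,3)
      by (simp add: rsprob_insert algebra_simps)
  next
    case True
    have f: "finite T" using insert.prems insert.hyps by (meson finite.insertI finite_subset)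
    have "{E. T \<subseteq> insert x E} = {E. T - {x} \<subseteq> E}" by auto
    moreover have "rsprob X p {E. T \<subseteq> E} = rsprob X p {}"
      by (intro antisym rsprob_mono insert.hyps) (use True insert.hyps in auto)
    moreover have "rsprob X p {E. T - {x} \<subseteq> E} = p ^ card (T - {x})"
      by (rule insert.IH) (use insert.prems in auto)
    moreover have "card T = Suc (card (T - {x}))" using card.remove[OF f True] .
    ultimately show ?thesis
      by (simp add: rsprob_insert[OF insert.hyps(1,2) assms(2,3)])
  qed
qed

lemma rsprob_disjoint:
  assumes "finite X" "0 \<le> p" "p \<le> 1" "T \<subseteq> X"
  shows "rsprob X p {E. T \<inter> E = {}} = (1 - p) ^ card T"
  using assms(1,4)
proof (induction X arbitrary: T rule: finite_induct)
  case empty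
  then show ?case by (simp add: rsprob_empty)
next
  case (insert x X)
  show ?case
  proof (cases "x \<in> T")
    case False
    then have "{E. T \<inter> insert x E = {}} = {E. T \<inter> E = {}}" "T \<subseteq> X" using insert by auto
    then show ?thesis using insert.IH[of T] insert.hyps assms(2,3)
      by (simp add: rsprob_insert algebra_simps)
  next
    case True
    have f: "finite T" using insert.prems insert.hyps by (meson finite.insertI finite_subset)
    have e: "{E. T \<inter> insert x E = {}} = {}" using True by auto
    moreover have "rsprob X p {E. T \<inter> E = {}} = rsprob X p {E. (T - {x}) \<inter> E = {}}"
      by (intro antisym rsprob_mono insert.hyps) (use True insert.hyps in auto)
    moreover have "rsprob X p {E. (T - {x}) \<inter> E = {}} = (1 - p) ^ card (T - {x})"
      by (rule insert.IH) (use insert.prems in auto)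
    moreover have "card T = Suc (card (T - {x}))" using card.remove[OF f True] .
    ultimately show ?thesis
      unfolding rsprob_insert[OF insert.hyps(1,2) assms(2,3)] mem_Collect_eq e by simp
  qed
qed

text \<open>The blocks \<open>B z\<close> use different coins, so hitting them is a sequence of
  independent events.\<close>

lemma rsprob_hits_all:
  assumes "finite X" "0 \<le> p" "p \<le> 1" "finite Z" "\<And>z. z \<in> Z \<Longrightarrow> B z \<subseteq> X"
    "disjoint_family_on B Z"
  shows "rsprob X p {E. \<forall>z\<in>Z. B z \<inter> E \<noteq> {}} = (\<Prod>z\<in>Z. 1 - (1 - p) ^ card (B z))"
  using assms(4-)
proof (induction Z rule: finite_induct)
  case (insert z Z)
  define S where "S = {E. B z \<inter> E \<noteq> {}}"
  define S' where "S' = {E. \<forall>z\<in>Z. B z \<inter> E \<noteq> {}}"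
  have disj: "B z \<inter> B y = {}" if "y \<in> Z" for y
    using insert that by (auto simp: disjoint_family_on_def)
  have X: "X = B z \<union> (X - B z)" using insert.prems(1)[of z] by auto
  have S': "insert y E \<in> S' \<longleftrightarrow> E \<in> S'" if "y \<in> B z" for y E
    using disj that by (auto simp: S'_def)
  have ind: "rsprob (B z \<union> (X - B z)) p (S \<inter> S') = rsprob (B z \<union> (X - B z)) p S * rsprob (B z \<union> (X - B z)) p S'"
    by (rule rsprob_independent)
       (use assms insert.prems S' finite_subset[of "B z" X] in \<open>auto simp: S_def\<close>)
  have "{E. \<forall>z\<in>insert z Z. B z \<inter> E \<noteq> {}} = S \<inter> S'" by (auto simp: S_def S'_def)
  moreover have "rsprob X p S = 1 - rsprob X p {E. B z \<inter> E = {}}"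
    using measure_pmf.prob_compl[of "{E. B z \<inter> E = {}}" "random_subset X p"]
    by (simp add: S_def Compl_eq_Diff_UNIV[symmetric] Collect_neg_eq[symmetric])
  moreover have "rsprob X p S' = (\<Prod>z\<in>Z. 1 - (1 - p) ^ card (B z))"
    unfolding S'_def by (rule insert.IH) (use insert.prems in \<open>auto simp: disjoint_family_on_def\<close>)
  ultimately show ?case
    using ind X[symmetric] insert.hyps rsprob_disjoint[OF assms(1-3), of "B z"] insert.prems by simp
qed simp

section \<open>Janson's inequality\<close>

text \<open>The argument of Boppana and Spencer: the sets are added one at a time, and avoiding
  \<open>T i\<close> as well gains a factor \<open>exp (- c)\<close>, where \<open>c\<close> is the
  probability of \<open>T i \<subseteq> E\<close> minus the weights of the pairs of \<open>i\<close>
  with earlier sets. The double sum counts ordered pairs, hence each weight twice, which only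
  weakens the bound.\<close>

lemma boppana_spencer:
  fixes T :: "'i \<Rightarrow> 'a set"
  assumes "finite X" "0 \<le> p" "p \<le> 1" "finite I" "\<And>i. i \<in> I \<Longrightarrow> T i \<subseteq> X"
  shows "rsprob X p {E. \<forall>i\<in>I. \<not> T i \<subseteq> E} \<le>
    exp (- ((\<Sum>i\<in>I. p ^ card (T i)) -
      (\<Sum>i\<in>I. \<Sum>j\<in>I. if i \<noteq> j \<and> T i \<inter> T j \<noteq> {} then p ^ card (T i \<union> T j) else 0)))"
  using assms(4,5)
proof (induction I rule: finite_induct)
  case empty
  then show ?case by simp
next
  case (insert i I)
  define w where "w = (\<lambda>i j. if i \<noteq> j \<and> T i \<inter> T j \<noteq> {} then p ^ card (T i \<union> T j) else 0)"
  define N where "N = {E. \<forall>j\<in>I. \<not> T j \<subseteq> E}"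
  \<comment> \<open>Only the sets disjoint from \<open>T i\<close> are kept: avoiding these is
    independent of \<open>B\<close>.\<close>
  define N' where "N' = {E. \<forall>j\<in>I. T i \<inter> T j = {} \<longrightarrow> \<not> T j \<subseteq> E}"
  define B where "B = {E. T i \<subseteq> E}"
  define J where "J = {j \<in> I. T i \<inter> T j \<noteq> {}}"
  define P where "P = rsprob X p"
  have finJ: "finite J" using insert.hyps by (simp add: J_def)
  have TX: "T j \<subseteq> X" if "j \<in> insert i I" for j using insert.prems that by blast
  have w0: "w i j \<ge> 0" for i j using assms(2) by (simp add: w_def)
  have P0: "P S \<ge> 0" for S by (simp add: P_def)
  have PB: "P B = p ^ card (T i)"
    unfolding P_def B_def by (rule rsprob_superset) (use assms TX in auto)
  have eqX: "T i \<union> (X - T i) = X" using TX[of i] by auto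
  have "rsprob (T i \<union> (X - T i)) p (B \<inter> N') = rsprob (T i \<union> (X - T i)) p B * rsprob (T i \<union> (X - T i)) p N'"
  proof (rule rsprob_independent)
    show "finite (T i)" using TX[of i] assms(1) finite_subset by auto
    show "insert y E \<in> N' \<longleftrightarrow> E \<in> N'" if "y \<in> T i" for y E
      using that unfolding N'_def by blast
    show "insert y E \<in> B \<longleftrightarrow> E \<in> B" if "y \<in> X - T i" for y E
      using that unfolding B_def by blast
  qed (use assms in auto)
  then have ind: "P (B \<inter> N') = P B * P N'" unfolding eqX P_def .
  \<comment> \<open>If \<open>B\<close> and \<open>N'\<close> hold but \<open>N\<close> fails, then
    \<open>E\<close> contains \<open>T i\<close> together with some overlapping \<open>T j\<close>.
    By Harris, this increasing event is negatively correlated with the decreasing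
    \<open>N'\<close>.\<close>
  have ub: "P (B \<inter> N') \<le> P (B \<inter> N) + (\<Sum>j\<in>J. w i j) * P N'"
  proof -
    have "P (B \<inter> N') \<le> P (B \<inter> N \<union> (\<Union>j\<in>J. {E. T i \<union> T j \<subseteq> E} \<inter> N'))"
      unfolding P_def by (rule rsprob_mono[OF assms(1)]) (auto simp: B_def N'_def N_def J_def)
    also have "\<dots> \<le> P (B \<inter> N) + P (\<Union>j\<in>J. {E. T i \<union> T j \<subseteq> E} \<inter> N')"
      unfolding P_def by (rule measure_Un_le) auto
    also have "P (\<Union>j\<in>J. {E. T i \<union> T j \<subseteq> E} \<inter> N') \<le> (\<Sum>j\<in>J. P ({E. T i \<union> T j \<subseteq> E} \<inter> N'))"
      unfolding P_def by (rule rsprob_UN_le[OF finJ])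
    also have "\<dots> \<le> (\<Sum>j\<in>J. w i j * P N')"
    proof (rule sum_mono)
      fix j assume j: "j \<in> J"
      have "P ({E. T i \<union> T j \<subseteq> E} \<inter> N') \<le> P {E. T i \<union> T j \<subseteq> E} * P N'"
        unfolding P_def
        by (rule harris_inequality[OF assms(1-3)])
           (unfold up_event_def down_event_def N'_def, blast+)
      also have "P {E. T i \<union> T j \<subseteq> E} = p ^ card (T i \<union> T j)"
        unfolding P_def by (rule rsprob_superset[OF assms(1-3)]) (use TX j in \<open>auto simp: J_def\<close>)
      also have "\<dots> = w i j" using j insert.hyps by (auto simp: w_def J_def)
      finally show "P ({E. T i \<union> T j \<subseteq> E} \<inter> N') \<le> w i j * P N'" .
    qed
    finally show ?thesis by (simp add: sum_distrib_right)
  qed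
  have wJ: "(\<Sum>j\<in>J. w i j) = (\<Sum>j\<in>I. w i j)"
    by (rule sum.mono_neutral_left) (use insert.hyps in \<open>auto simp: J_def w_def\<close>)
  define c where "c = P B - (\<Sum>j\<in>I. w i j)"
  have NN': "P N \<le> P N'"
    unfolding P_def by (rule rsprob_mono[OF assms(1)]) (auto simp: N_def N'_def)
  have c1: "c * P N' \<le> P (B \<inter> N)" using ub ind by (simp add: c_def wJ algebra_simps)
  have split: "P {E. \<forall>j\<in>insert i I. \<not> T j \<subseteq> E} = P N - P (B \<inter> N)"
  proof -
    have "{E. \<forall>j\<in>insert i I. \<not> T j \<subseteq> E} = N - (B \<inter> N)" by (auto simp: N_def B_def)
    then show ?thesis unfolding P_def by (simp add: measure_pmf.finite_measure_Diff)
  qed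
  \<comment> \<open>For \<open>c \<le> 0\<close> the factor is at least 1; otherwise
    \<open>P N \<le> P N'\<close> may be multiplied by \<open>c\<close>.\<close>
  have step: "P N - P (B \<inter> N) \<le> P N * exp (- c)"
  proof (cases "c \<le> 0")
    case True
    have "P N * 1 \<le> P N * exp (- c)" by (rule mult_left_mono) (use True P0 in auto)
    with P0[of "B \<inter> N"] show ?thesis by simp
  next
    case False
    have "c * P N \<le> c * P N'" by (rule mult_left_mono) (use False NN' in auto)
    with c1 have "P N - P (B \<inter> N) \<le> P N * (1 - c)" by (simp add: algebra_simps)
    also have "\<dots> \<le> P N * exp (- c)"
      by (rule mult_left_mono) (use exp_ge_add_one_self[of "- c"] P0 in auto)
    finally show ?thesis .
  qed
  have IH: "P N \<le> exp (- ((\<Sum>i\<in>I. p ^ card (T i)) - (\<Sum>i\<in>I. \<Sum>j\<in>I. w i j)))"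
    unfolding P_def N_def w_def by (rule insert.IH) (use insert.prems in auto)
  have "P {E. \<forall>j\<in>insert i I. \<not> T j \<subseteq> E} \<le> exp (- ((\<Sum>i\<in>I. p ^ card (T i)) - (\<Sum>i\<in>I. \<Sum>j\<in>I. w i j))) * exp (- c)"
    unfolding split by (rule order_trans[OF step mult_right_mono[OF IH]]) simp
  also have "\<dots> = exp (- ((\<Sum>i\<in>I. p ^ card (T i)) - (\<Sum>i\<in>I. \<Sum>j\<in>I. w i j) + c))"
    by (simp add: exp_add[symmetric] algebra_simps)
  also have "\<dots> \<le> exp (- ((\<Sum>j\<in>insert i I. p ^ card (T j)) - (\<Sum>k\<in>insert i I. \<Sum>j\<in>insert i I. w k j)))"
  proof -
    have "(\<Sum>k\<in>insert i I. \<Sum>j\<in>insert i I. w k j) =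
       w i i + (\<Sum>j\<in>I. w i j) + ((\<Sum>k\<in>I. w k i) + (\<Sum>k\<in>I. \<Sum>j\<in>I. w k j))"
      using insert.hyps by (simp add: sum.distrib)
    moreover have "w i i \<ge> 0" "(\<Sum>k\<in>I. w k i) \<ge> 0" using w0 by (auto intro: sum_nonneg)
    ultimately show ?thesis using insert.hyps by (simp add: c_def PB)
  qed
  finally show ?case unfolding P_def w_def .
qed

text \<open>A random subset of density \<open>q\<close> keeps an index with probability
  \<open>q\<close> and a pair of distinct indices with probability \<open>q\<^sup>2\<close>; a
  diagonal pair would survive with probability \<open>q\<close>, so its weight has to vanish. Some
  outcome is at least as good as the mean.\<close>

lemma ex_good_subset:
  fixes a :: "'i \<Rightarrow> real" and w :: "'i \<Rightarrow> 'i \<Rightarrow> real"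
  assumes "finite I" "0 \<le> q" "q \<le> 1" "\<And>i. i \<in> I \<Longrightarrow> w i i = 0"
  shows "\<exists>S\<subseteq>I. q * (\<Sum>i\<in>I. a i) - q\<^sup>2 * (\<Sum>i\<in>I. \<Sum>j\<in>I. w i j)
    \<le> (\<Sum>i\<in>S. a i) - (\<Sum>i\<in>S. \<Sum>j\<in>S. w i j)"
proof -
  define B where "B T = {E. T \<subseteq> E}" for T :: "'i set"
  define g where "g S = (\<Sum>i\<in>I. a i * indicator (B {i}) S) -
     (\<Sum>i\<in>I. \<Sum>j\<in>I. w i j * indicator (B {i, j}) S)" for S
  have g: "g S = (\<Sum>i\<in>S. a i) - (\<Sum>i\<in>S. \<Sum>j\<in>S. w i j)" if "S \<subseteq> I" for S
  proof -
    have "(\<Sum>i\<in>I. a i * indicator (B {i}) S) = (\<Sum>i\<in>S. a i)"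
      by (rule sum.mono_neutral_cong_right) (use assms(1) that in \<open>auto simp: indicator_def B_def\<close>)
    moreover have "(\<Sum>i\<in>I. \<Sum>j\<in>I. w i j * indicator (B {i, j}) S) = (\<Sum>i\<in>S. \<Sum>j\<in>S. w i j)"
      by (intro sum.mono_neutral_cong_right ballI) (use assms(1) that in \<open>auto simp: indicator_def B_def\<close>)
    ultimately show ?thesis by (simp add: g_def)
  qed
  let ?M = "random_subset I q"
  have int: "integrable ?M (f :: _ \<Rightarrow> real)" for f
    by (rule integrable_measure_pmf_finite)
       (use set_random_subset[OF assms(1)] assms(1) in \<open>auto intro: finite_subset\<close>)
  have "measure_pmf.expectation ?M g =
     (\<Sum>i\<in>I. a i * rsprob I q (B {i})) - (\<Sum>i\<in>I. \<Sum>j\<in>I. w i j * rsprob I q (B {i, j}))"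
    unfolding g_def by (simp add: int)
  also have "\<dots> = (\<Sum>i\<in>I. a i * q) - (\<Sum>i\<in>I. \<Sum>j\<in>I. w i j * q\<^sup>2)"
  proof -
    have "w i j * rsprob I q (B {i, j}) = w i j * q\<^sup>2" if "i \<in> I" "j \<in> I" for i j
      using that assms rsprob_superset[OF assms(1-3), of "{i, j}"] by (cases "i = j") (auto simp: B_def power2_eq_square)
    moreover have "rsprob I q (B {i}) = q" if "i \<in> I" for i
      using that rsprob_superset[OF assms(1-3), of "{i}"] by (auto simp: B_def)
    ultimately show ?thesis
      by (intro arg_cong2[where f = "(-)"] sum.cong refl) auto
  qed
  finally have E: "measure_pmf.expectation ?M g = q * (\<Sum>i\<in>I. a i) - q\<^sup>2 * (\<Sum>i\<in>I. \<Sum>j\<in>I. w i j)"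
    by (simp add: sum_distrib_left sum_distrib_right mult.commute)
  have fin: "finite (g ` Pow I)" using assms(1) by simp
  have "measure_pmf.expectation ?M g \<le> Max (g ` Pow I)"
    by (rule measure_pmf.integral_le_const[OF int])
       (use set_random_subset[OF assms(1), of q] fin in \<open>auto simp: AE_measure_pmf_iff\<close>)
  moreover have "Max (g ` Pow I) \<in> g ` Pow I" by (rule Max_in[OF fin]) auto
  then obtain S where S: "S \<subseteq> I" "Max (g ` Pow I) = g S" by (elim imageE) simp
  ultimately show ?thesis unfolding E S(2) g[OF S(1)] using S(1) by blast
qed

text \<open>
  The previous bound is useless when \<open>\<Delta>\<close> exceeds \<open>\<mu>\<close>; it is therefore applied to a random
  subfamily of density \<open>\<mu> / (2 \<Delta>)\<close>.
\<close>

lemma janson_inequality: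
  fixes T :: "'i \<Rightarrow> 'a set"
  assumes "finite X" "0 < p" "p \<le> 1" "finite I" "I \<noteq> {}" "\<And>i. i \<in> I \<Longrightarrow> T i \<subseteq> X \<and> T i \<noteq> {}"
    and \<Delta>: "(\<Sum>i\<in>I. \<Sum>j\<in>I. if T i \<inter> T j \<noteq> {} then p ^ card (T i \<union> T j) else 0) \<le> \<Delta>"
  shows "rsprob X p {E. \<forall>i\<in>I. \<not> T i \<subseteq> E} \<le> exp (- ((\<Sum>i\<in>I. p ^ card (T i))\<^sup>2 / (4 * \<Delta>)))"
proof -
  define \<mu> where "\<mu> = (\<Sum>i\<in>I. p ^ card (T i))"
  define w where "w = (\<lambda>i j. if i \<noteq> j \<and> T i \<inter> T j \<noteq> {} then p ^ card (T i \<union> T j) else 0)"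
  define W where "W = (\<Sum>i\<in>I. \<Sum>j\<in>I. w i j)"
  have \<mu>0: "\<mu> > 0" unfolding \<mu>_def by (rule sum_pos) (use assms in auto)
  have W\<Delta>: "W \<le> \<Delta>"
    unfolding W_def by (rule order_trans[OF _ \<Delta>]) (use assms(2) in \<open>intro sum_mono, simp add: w_def\<close>)
  \<comment> \<open>Here \<Delta> bounds a sum that includes the diagonal, whose terms add up to
    \<mu>. This keeps the density \<open>q\<close> below 1.\<close>
  have \<mu>\<Delta>: "\<mu> \<le> \<Delta>"
  proof -
    have "\<mu> \<le> (\<Sum>i\<in>I. \<Sum>j\<in>I. if T i \<inter> T j \<noteq> {} then p ^ card (T i \<union> T j) else 0)"
      unfolding \<mu>_def
    proof (rule sum_mono)
      fix i assume i: "i \<in> I"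
      have "(\<Sum>j\<in>{i}. if T i \<inter> T j \<noteq> {} then p ^ card (T i \<union> T j) else 0)
         \<le> (\<Sum>j\<in>I. if T i \<inter> T j \<noteq> {} then p ^ card (T i \<union> T j) else 0)"
        by (rule sum_mono2) (use assms i in auto)
      then show "p ^ card (T i) \<le> (\<Sum>j\<in>I. if T i \<inter> T j \<noteq> {} then p ^ card (T i \<union> T j) else 0)"
        using assms(6)[OF i] by simp
    qed
    with \<Delta> show ?thesis by linarith
  qed
  \<comment> \<open>The maximiser of \<open>q * \<mu> - q\<^sup>2 * \<Delta>\<close>, with maximum
    \<open>\<mu>\<^sup>2 / (4 * \<Delta>)\<close>.\<close>
  define q where "q = \<mu> / (2 * \<Delta>)"
  have q: "0 \<le> q" "q \<le> 1" using \<mu>0 \<mu>\<Delta> by (auto simp: q_def divide_simps)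
  obtain S where S: "S \<subseteq> I" "q * \<mu> - q\<^sup>2 * W \<le> (\<Sum>i\<in>S. p ^ card (T i)) - (\<Sum>i\<in>S. \<Sum>j\<in>S. w i j)"
    using ex_good_subset[OF assms(4) q, of w "\<lambda>i. p ^ card (T i)"] unfolding \<mu>_def W_def w_def by auto
  have "q\<^sup>2 * W \<le> q\<^sup>2 * \<Delta>" using W\<Delta> by (intro mult_left_mono) auto
  moreover have "q * \<mu> - q\<^sup>2 * \<Delta> = \<mu>\<^sup>2 / (4 * \<Delta>)"
    using \<mu>0 \<mu>\<Delta> by (simp add: q_def power2_eq_square field_simps)
  ultimately have le: "\<mu>\<^sup>2 / (4 * \<Delta>) \<le> (\<Sum>i\<in>S. p ^ card (T i)) - (\<Sum>i\<in>S. \<Sum>j\<in>S. w i j)"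
    using S(2) by linarith
  have "rsprob X p {E. \<forall>i\<in>I. \<not> T i \<subseteq> E} \<le> rsprob X p {E. \<forall>i\<in>S. \<not> T i \<subseteq> E}"
    by (rule rsprob_mono) (use assms S in auto)
  also have "\<dots> \<le> exp (- ((\<Sum>i\<in>S. p ^ card (T i)) - (\<Sum>i\<in>S. \<Sum>j\<in>S. w i j)))"
    unfolding w_def by (rule boppana_spencer) (use assms S finite_subset[OF S(1)] in auto)
  also have "\<dots> \<le> exp (- (\<mu>\<^sup>2 / (4 * \<Delta>)))" using le by simp
  finally show ?thesis unfolding \<mu>_def .
qed

section \<open>Cliques in a product of vertex sets\<close>

lemma finite_vertex_pairs: "finite A \<Longrightarrow> finite (vertex_pairs A)"
  by (simp add: vertex_pairs_def)

lemma card_vertex_pairs: "finite A \<Longrightarrow> card (vertex_pairs A) = card A choose 2"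
  unfolding vertex_pairs_def by (rule n_subsets)

lemma vertex_pairs_Int: "vertex_pairs A \<inter> vertex_pairs B = vertex_pairs (A \<inter> B)"
  by (auto simp: vertex_pairs_def)

lemma vertex_pairs_mono: "A \<subseteq> B \<Longrightarrow> vertex_pairs A \<subseteq> vertex_pairs B"
  by (auto simp: vertex_pairs_def)

lemma doubleton_in_vertex_pairs: "{u, v} \<in> vertex_pairs A \<longleftrightarrow> u \<in> A \<and> v \<in> A \<and> u \<noteq> v"
  by (auto simp: vertex_pairs_def card_2_iff doubleton_eq_iff)

lemma vertex_pairs_eq_empty_iff:
  assumes "finite A"
  shows "vertex_pairs A = {} \<longleftrightarrow> card A < 2"
proof -
  have "vertex_pairs A = {} \<longleftrightarrow> card (vertex_pairs A) = 0"
    using finite_vertex_pairs[OF assms] by simp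
  then show ?thesis using card_vertex_pairs[OF assms] by simp
qed

text \<open>Each coordinate in \<open>J\<close> retains at most \<open>card A \<le> r\<close> of its
  at least \<open>u\<close> choices.\<close>

lemma card_PiE_hitting_le:
  fixes Us :: "nat \<Rightarrow> 'a set"
  assumes "\<And>i. i < r \<Longrightarrow> finite (Us i)" "\<And>i. i < r \<Longrightarrow> u \<le> real (card (Us i))" "u > 0"
    "finite A" "card A \<le> r" "J \<subseteq> {..<r}"
  shows "real (card {b \<in> PiE {..<r} Us. \<forall>i\<in>J. b i \<in> A})
    \<le> (real r / u) ^ card J * (\<Prod>i<r. real (card (Us i)))"
proof -
  have "{b \<in> PiE {..<r} Us. \<forall>i\<in>J. b i \<in> A} \<subseteq> PiE {..<r} (\<lambda>i. if i \<in> J then A else Us i)"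
    using assms(6) by (auto simp: PiE_iff extensional_def)
  then have "real (card {b \<in> PiE {..<r} Us. \<forall>i\<in>J. b i \<in> A})
      \<le> real (card (PiE {..<r} (\<lambda>i. if i \<in> J then A else Us i)))"
    by (intro of_nat_mono card_mono finite_PiE) (use assms in auto)
  also have "\<dots> = (\<Prod>i<r. real (if i \<in> J then card A else card (Us i)))"
    by (simp add: card_PiE if_distrib[of card] cong: if_cong)
  also have "\<dots> \<le> (\<Prod>i<r. (if i \<in> J then real r / u else 1) * real (card (Us i)))"
  proof (rule prod_mono)
    fix i assume i: "i \<in> {..<r}"
    have "real (card A) * u \<le> real r * real (card (Us i))"
      using assms i by (intro mult_mono) auto
    then have "real (card A) \<le> real r / u * real (card (Us i))"
      using assms(3) by (simp add: field_simps)
    then show "0 \<le> real (if i \<in> J then card A else card (Us i)) \<and>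
      real (if i \<in> J then card A else card (Us i)) \<le> (if i \<in> J then real r / u else 1) * real (card (Us i))"
      by simp
  qed
  also have "\<dots> = (\<Prod>i<r. if i \<in> J then real r / u else 1) * (\<Prod>i<r. real (card (Us i)))"
    by (rule prod.distrib)
  also have "(\<Prod>i<r. if i \<in> J then real r / u else 1) = (\<Prod>i\<in>J. real r / u)"
    using assms(6) by (intro prod.mono_neutral_cong_right) auto
  finally show ?thesis by simp
qed

lemma sum_Pow_power_card:
  fixes x :: real
  assumes "finite A"
  shows "(\<Sum>J\<in>Pow A. x ^ card J) = (1 + x) ^ card A"
  using prod_add[OF assms, of "\<lambda>_. x" "\<lambda>_. 1"] by (simp add: add.commute)

text \<open>\<open>j (j - 1) / 2 \<le> (r / 2) (j - 1)\<close>: making the exponent linear in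
  \<open>j - 1\<close> turns the sum over overlap sizes into a geometric one. This is the source of
  the power \<open>r / 2\<close> of \<open>1 / p\<close>.\<close>

lemma power_choose_two_le:
  fixes z :: real
  assumes "z \<ge> 1" "j \<le> r" "j \<ge> 1"
  shows "z ^ (j choose 2) \<le> (z powr (real r / 2)) ^ (j - 1)"
proof -
  have "real (j choose 2) = real j * (real j - 1) / 2"
  proof -
    have "even (j * (j - 1))" by (cases "even j") auto
    then have "2 * (j choose 2) = j * (j - 1)" unfolding choose_two by (rule dvd_mult_div_cancel)
    then have "2 * real (j choose 2) = real j * real (j - 1)"
      by (metis of_nat_mult of_nat_numeral)
    then show ?thesis using assms by (simp add: of_nat_diff)
  qed
  also have "\<dots> \<le> real r / 2 * real (j - 1)"
    using assms by (auto simp: of_nat_diff intro!: mult_right_mono)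
  finally have "z powr real (j choose 2) \<le> z powr (real r / 2 * real (j - 1))"
    by (intro powr_mono) (use assms in auto)
  also have "\<dots> = (z powr (real r / 2)) ^ (j - 1)"
    unfolding powr_powr[symmetric] by (rule powr_realpow) (use assms in auto)
  finally show ?thesis using assms by (simp add: powr_realpow)
qed

text \<open>The inner sum of Janson's \<Delta>, up to a fixed power of \<open>p\<close>;
  \<open>A\<close> is the vertex set of one tuple. A set \<open>J\<close> of \<open>j\<close>
  coordinates that fall into \<open>A\<close> contributes about \<open>(r / u)^j * Z^(j - 1)\<close>
  times the number of all tuples. Under \<open>small\<close> these terms decrease in
  \<open>j\<close>, so \<open>j = 2\<close> dominates.\<close>

lemma overlap_weight_sum_le:
  fixes Us :: "nat \<Rightarrow> 'a set" and r :: nat and p u :: real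
  defines "Z \<equiv> (1 / p) powr (real r / 2)"
  assumes fin: "\<And>i. i < r \<Longrightarrow> finite (Us i)" and u: "\<And>i. i < r \<Longrightarrow> u \<le> real (card (Us i))" "u > 0"
    and p: "0 < p" "p \<le> 1" and r: "r \<ge> 2"
    and A: "finite A" "card A \<le> r"
    and F: "F \<subseteq> PiE {..<r} Us" "\<And>b. b \<in> F \<Longrightarrow> inj_on b {..<r}"
    and small: "(real r)\<^sup>2 / u * Z \<le> 1"
  shows "(\<Sum>b\<in>F. if card (A \<inter> b ` {..<r}) \<ge> 2 then (1 / p) ^ (card (A \<inter> b ` {..<r}) choose 2) else 0)
    \<le> 3 * (real r)^4 / u\<^sup>2 * Z * (\<Prod>i<r. real (card (Us i)))"
proof -
  define z where "z = 1 / p"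
  have z: "z \<ge> 1" using p by (simp add: z_def)
  have Z: "Z > 0" unfolding Z_def using p by simp
  define Q where "Q = (\<Prod>i<r. real (card (Us i)))"
  have Q0: "Q \<ge> 0" unfolding Q_def by (rule prod_nonneg) auto
  define \<J> where "\<J> = {J \<in> Pow {..<r}. card J \<ge> 2}"
  have finJ: "finite \<J>" by (simp add: \<J>_def)
  have finF: "finite F" using F(1) fin by (rule_tac finite_subset[OF F(1)]) (auto intro: finite_PiE)
  \<comment> \<open>The exact set of coordinates that fall into \<open>A\<close> is one of the
    indices on the right, and all other summands are nonnegative.\<close>
  have "(\<Sum>b\<in>F. if card (A \<inter> b ` {..<r}) \<ge> 2 then z ^ (card (A \<inter> b ` {..<r}) choose 2) else 0)
    \<le> (\<Sum>b\<in>F. \<Sum>J\<in>\<J>. if \<forall>i\<in>J. b i \<in> A then z ^ (card J choose 2) else 0)"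
  proof (rule sum_mono)
    fix b assume b: "b \<in> F"
    let ?J = "{i \<in> {..<r}. b i \<in> A}"
    have "A \<inter> b ` {..<r} = b ` ?J" by auto
    moreover have "card (b ` ?J) = card ?J"
      by (rule card_image, rule inj_on_subset[OF F(2)[OF b]]) auto
    ultimately have c: "card (A \<inter> b ` {..<r}) = card ?J" by simp
    show "(if card (A \<inter> b ` {..<r}) \<ge> 2 then z ^ (card (A \<inter> b ` {..<r}) choose 2) else 0)
      \<le> (\<Sum>J\<in>\<J>. if \<forall>i\<in>J. b i \<in> A then z ^ (card J choose 2) else 0)"
    proof (cases "card ?J \<ge> 2")
      case True
      then have "?J \<in> \<J>" by (auto simp: \<J>_def)
      then have "(\<lambda>J. if \<forall>i\<in>J. b i \<in> A then z ^ (card J choose 2) else 0) ?J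
         \<le> (\<Sum>J\<in>\<J>. if \<forall>i\<in>J. b i \<in> A then z ^ (card J choose 2) else 0)"
        by (rule member_le_sum) (use finJ z in auto)
      then show ?thesis using True by (simp add: c)
    next
      case False
      then show ?thesis using z by (auto simp: c intro!: sum_nonneg)
    qed
  qed
  also have "\<dots> = (\<Sum>J\<in>\<J>. \<Sum>b\<in>F. if \<forall>i\<in>J. b i \<in> A then z ^ (card J choose 2) else 0)"
    by (rule sum.swap)
  also have "\<dots> \<le> (\<Sum>J\<in>\<J>. (real r)^4 / u\<^sup>2 * Z * Q * (1 / real r) ^ card J)"
  proof (rule sum_mono)
    fix J assume "J \<in> \<J>"
    then have J: "J \<subseteq> {..<r}" "card J \<ge> 2" by (auto simp: \<J>_def)
    have Jr: "card J \<le> r" using card_mono[OF _ J(1)] by simp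
    have "real (card {b \<in> F. \<forall>i\<in>J. b i \<in> A}) \<le> real (card {b \<in> PiE {..<r} Us. \<forall>i\<in>J. b i \<in> A})"
      by (intro of_nat_mono card_mono finite_subset[OF _ finite_PiE[of "{..<r}" Us]])
         (use F(1) fin in auto)
    also have "\<dots> \<le> (real r / u) ^ card J * Q"
      unfolding Q_def by (rule card_PiE_hitting_le) (use fin u A J in auto)
    finally have cnt: "real (card {b \<in> F. \<forall>i\<in>J. b i \<in> A}) \<le> (real r / u) ^ card J * Q" .
    have "(\<Sum>b\<in>F. if \<forall>i\<in>J. b i \<in> A then z ^ (card J choose 2) else 0)
      = z ^ (card J choose 2) * real (card {b \<in> F. \<forall>i\<in>J. b i \<in> A})"
      using finF by (simp add: sum.inter_filter[symmetric])
    also have "\<dots> \<le> z ^ (card J choose 2) * ((real r / u) ^ card J * Q)"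
      by (rule mult_left_mono[OF cnt]) (use z in auto)
    also have "z ^ (card J choose 2) * ((real r / u) ^ card J * Q)
        \<le> Z ^ (card J - 1) * ((real r / u) ^ card J * Q)"
      using power_choose_two_le[OF z Jr] J u Q0 unfolding Z_def z_def[symmetric]
      by (intro mult_right_mono) auto
    \<comment> \<open>\<open>r / u\<close> is split as \<open>(1 / r) * (r\<^sup>2 / u)\<close>. The
      powers of \<open>1 / r\<close> are saved for the sum over all \<open>J\<close>, which becomes
      \<open>(1 + 1 / r)^r \<le> 3\<close>.\<close>
    also have "\<dots> = (1 / real r) ^ card J * Q * (((real r)\<^sup>2 / u) * ((real r)\<^sup>2 / u * Z) ^ (card J - 1))"
    proof -
      have "(real r / u) ^ card J = (1 / real r) ^ card J * ((real r)\<^sup>2 / u) ^ card J"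
        using r by (simp add: power_mult_distrib[symmetric] power2_eq_square)
      moreover have "((real r)\<^sup>2 / u) ^ card J = ((real r)\<^sup>2 / u) * ((real r)\<^sup>2 / u) ^ (card J - 1)"
        using J by (simp add: power_Suc[symmetric] del: power_Suc)
      ultimately show ?thesis by (simp only: power_mult_distrib mult_ac)
    qed
    \<comment> \<open>Of the \<open>card J - 1 \<ge> 1\<close> equal factors, each at most 1 by
      \<open>small\<close>, a single one is kept.\<close>
    also have "\<dots> \<le> (1 / real r) ^ card J * Q * (((real r)\<^sup>2 / u) * ((real r)\<^sup>2 / u * Z))"
    proof -
      have "((real r)\<^sup>2 / u * Z) ^ (card J - 1) \<le> ((real r)\<^sup>2 / u * Z) ^ 1"
        by (rule power_decreasing) (use small J u Z in auto)
      then show ?thesis using u Q0 by (intro mult_left_mono) auto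
    qed
    also have "\<dots> = (real r)^4 / u\<^sup>2 * Z * Q * (1 / real r) ^ card J"
      by (simp add: power2_eq_square power4_eq_xxxx field_simps)
    finally show "(\<Sum>b\<in>F. if \<forall>i\<in>J. b i \<in> A then z ^ (card J choose 2) else 0)
      \<le> (real r)^4 / u\<^sup>2 * Z * Q * (1 / real r) ^ card J" .
  qed
  also have "\<dots> \<le> (\<Sum>J\<in>Pow {..<r}. (real r)^4 / u\<^sup>2 * Z * Q * (1 / real r) ^ card J)"
    by (rule sum_mono2) (use Z Q0 u in \<open>auto simp: \<J>_def\<close>)
  also have "\<dots> = (real r)^4 / u\<^sup>2 * Z * Q * (1 + 1 / real r) ^ r"
    unfolding sum_distrib_left[symmetric] using sum_Pow_power_card[of "{..<r}" "1 / real r"] by simp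
  also have "\<dots> \<le> (real r)^4 / u\<^sup>2 * Z * Q * 3"
  proof -
    have "(1 + 1 / real r) ^ r \<le> exp (1 / real r) ^ r"
      by (intro power_mono) (use exp_ge_add_one_self[of "1 / real r"] in auto)
    also have "\<dots> = exp 1" using r by (simp add: exp_of_nat_mult[symmetric])
    also have "\<dots> \<le> 3" by (rule exp_le)
    finally show ?thesis using Z Q0 u by (intro mult_left_mono) auto
  qed
  finally show ?thesis unfolding Q_def z_def by (simp add: field_simps)
qed

text \<open>\<eta> is a lower bound for the density of \<open>F\<close> in the product. In Janson's
  exponent, the powers of \<open>p\<close> from the mean cancel against those of \<Delta>; what
  remains as the price of dependence is \<open>(1 / p) powr (r / 2)\<close>.\<close>

lemma janson_clique_tuples:
  fixes Us :: "nat \<Rightarrow> 'a set" and r :: nat and p u \<eta> :: real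
  assumes U: "finite U" "\<And>i. i < r \<Longrightarrow> Us i \<subseteq> U"
    and u: "\<And>i. i < r \<Longrightarrow> u \<le> real (card (Us i))" "u > 0"
    and p: "0 < p" "p \<le> 1" and r: "r \<ge> 2"
    and F: "F \<subseteq> PiE {..<r} Us" "\<And>b. b \<in> F \<Longrightarrow> inj_on b {..<r}"
    and \<eta>: "\<eta> > 0" "\<eta> * (\<Prod>i<r. real (card (Us i))) \<le> real (card F)"
    and small: "(real r)\<^sup>2 / u * (1 / p) powr (real r / 2) \<le> 1"
  shows "rsprob (vertex_pairs U) p {E. \<forall>b\<in>F. \<not> vertex_pairs (b ` {..<r}) \<subseteq> E}
    \<le> exp (- (\<eta> * u\<^sup>2 / (12 * (real r)^4 * (1 / p) powr (real r / 2))))"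
proof -
  define Z where "Z = (1 / p) powr (real r / 2)"
  have Z: "Z > 0" unfolding Z_def using p by simp
  define Q where "Q = (\<Prod>i<r. real (card (Us i)))"
  have Q0: "Q > 0" unfolding Q_def using u by (intro prod_pos) force
  define m where "m = r choose 2"
  define T where "T b = vertex_pairs (b ` {..<r})" for b :: "nat \<Rightarrow> 'a"
  have fin: "finite (Us i)" if "i < r" for i using U that finite_subset by blast
  have finF: "finite F" using F(1) fin by (rule_tac finite_subset[OF F(1)]) (auto intro: finite_PiE)
  have cF: "real (card F) > 0" using \<eta> Q0 unfolding Q_def[symmetric]
    by (smt (verit) mult_pos_pos)
  have cT: "card (T b) = m" if "b \<in> F" for b
    unfolding T_def using F(2)[OF that] by (simp add: card_vertex_pairs m_def card_image)
  define \<Delta> where "\<Delta> = real (card F) * (p ^ (2 * m) * (3 * (real r)^4 / u\<^sup>2 * Z * Q))"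
  have "rsprob (vertex_pairs U) p {E. \<forall>b\<in>F. \<not> T b \<subseteq> E} \<le> exp (- ((\<Sum>b\<in>F. p ^ card (T b))\<^sup>2 / (4 * \<Delta>)))"
  proof (rule janson_inequality)
    show "finite (vertex_pairs U)" using U by (simp add: finite_vertex_pairs)
    show "F \<noteq> {}" using cF by auto
    fix b assume b: "b \<in> F"
    have "b ` {..<r} \<subseteq> U" using F(1) b U(2) by (fastforce simp: PiE_iff)
    moreover have "card (T b) > 0" using cT[OF b] r by (simp add: m_def)
    ultimately show "T b \<subseteq> vertex_pairs U \<and> T b \<noteq> {}"
      by (auto simp: T_def vertex_pairs_mono[THEN subsetD])
  next
    show "(\<Sum>a\<in>F. \<Sum>b\<in>F. if T a \<inter> T b \<noteq> {} then p ^ card (T a \<union> T b) else 0) \<le> \<Delta>"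
    proof -
      have "(\<Sum>b\<in>F. if T a \<inter> T b \<noteq> {} then p ^ card (T a \<union> T b) else 0)
        \<le> p ^ (2 * m) * (3 * (real r)^4 / u\<^sup>2 * Z * Q)" if a: "a \<in> F" for a
      proof -
        let ?A = "a ` {..<r}"
        have "(if T a \<inter> T b \<noteq> {} then p ^ card (T a \<union> T b) else 0) =
          p ^ (2 * m) * (if card (?A \<inter> b ` {..<r}) \<ge> 2 then (1 / p) ^ (card (?A \<inter> b ` {..<r}) choose 2) else 0)"
          if b: "b \<in> F" for b
        proof -
          let ?c = "card (?A \<inter> b ` {..<r}) choose 2"
          have int: "T a \<inter> T b = vertex_pairs (?A \<inter> b ` {..<r})" by (simp add: T_def vertex_pairs_Int)
          then have ci: "card (T a \<inter> T b) = ?c" by (simp add: card_vertex_pairs)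
          have fT: "finite (T a)" "finite (T b)" by (auto simp: T_def finite_vertex_pairs)
          have "card (T a \<union> T b) + ?c = 2 * m"
            using card_Un_Int[OF fT] cT[OF a] cT[OF b] ci by simp
          then have "p ^ card (T a \<union> T b) * p ^ ?c = p ^ (2 * m)" by (metis power_add)
          then have "p ^ card (T a \<union> T b) = p ^ (2 * m) * (1 / p) ^ ?c"
            using p by (simp add: field_simps power_one_over)
          moreover have "T a \<inter> T b \<noteq> {} \<longleftrightarrow> card (?A \<inter> b ` {..<r}) \<ge> 2"
            unfolding int by (subst vertex_pairs_eq_empty_iff) auto
          ultimately show ?thesis by simp
        qed
        then have "(\<Sum>b\<in>F. if T a \<inter> T b \<noteq> {} then p ^ card (T a \<union> T b) else 0) =
          p ^ (2 * m) * (\<Sum>b\<in>F. if card (?A \<inter> b ` {..<r}) \<ge> 2 then (1 / p) ^ (card (?A \<inter> b ` {..<r}) choose 2) else 0)"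
          unfolding sum_distrib_left by (intro sum.cong refl) auto
        also have "\<dots> \<le> p ^ (2 * m) * (3 * (real r)^4 / u\<^sup>2 * Z * Q)"
          unfolding Z_def Q_def
          by (intro mult_left_mono overlap_weight_sum_le)
             (use fin u p r F small card_image_le[of "{..<r}" a] in auto)
        finally show ?thesis .
      qed
      then have "(\<Sum>a\<in>F. \<Sum>b\<in>F. if T a \<inter> T b \<noteq> {} then p ^ card (T a \<union> T b) else 0)
        \<le> (\<Sum>a\<in>F. p ^ (2 * m) * (3 * (real r)^4 / u\<^sup>2 * Z * Q))" by (rule sum_mono)
      then show ?thesis by (simp add: \<Delta>_def)
    qed
  qed (use p finF in auto)
  also have "(\<Sum>b\<in>F. p ^ card (T b)) = real (card F) * p ^ m" using cT by simp
  also have "(real (card F) * p ^ m)\<^sup>2 / (4 * \<Delta>) = real (card F) * u\<^sup>2 / (12 * (real r)^4 * Z * Q)"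
  proof -
    have "p ^ (2 * m) = (p ^ m)\<^sup>2" by (simp add: power_mult[symmetric] mult.commute)
    moreover have "p ^ m > 0" using p by simp
    ultimately show ?thesis using cF r u(2) Z Q0 p unfolding \<Delta>_def
      by (simp add: field_simps power2_eq_square power4_eq_xxxx)
  qed
  also have "exp (- (real (card F) * u\<^sup>2 / (12 * (real r)^4 * Z * Q))) \<le> exp (- (\<eta> * u\<^sup>2 / (12 * (real r)^4 * Z)))"
  proof -
    have "\<eta> \<le> real (card F) / Q" using \<eta>(2) Q0 by (simp add: Q_def[symmetric] field_simps)
    then have "\<eta> * (u\<^sup>2 / (12 * (real r)^4 * Z)) \<le> real (card F) / Q * (u\<^sup>2 / (12 * (real r)^4 * Z))"
      using Z by (intro mult_right_mono) auto
    then show ?thesis by (simp add: field_simps)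
  qed
  finally show ?thesis unfolding T_def Z_def .
qed

section \<open>Degrees into large sets\<close>

definition nbrs :: "'a set set \<Rightarrow> 'a \<Rightarrow> 'a set" where
  "nbrs E v = {u. {v, u} \<in> E}"

section \<open>Binomial coefficients and union bounds over large sets\<close>

lemma fact_ge_power_div_exp: "real s ^ s \<le> exp (real s) * fact s"
proof -
  let ?f = "\<lambda>k. real s ^ k /\<^sub>R fact k"
  \<comment> \<open>A single term of the exponential series at \<open>s\<close>.\<close>
  have "sum ?f {s} \<le> suminf ?f"
    by (rule sum_le_suminf[OF summable_exp_generic]) auto
  then show ?thesis by (simp add: exp_def divide_simps mult.commute)
qed

lemma choose_le_exp:
  assumes "s > 0" "s \<le> n"
  shows "real (n choose s) \<le> exp (real s * (1 + ln (real n / real s)))"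
proof -
  have "real (n choose s) * fact s \<le> real n ^ s"
    using binomial_fact_pow[of n s] by (metis of_nat_fact of_nat_le_iff of_nat_mult of_nat_power)
  then have "real (n choose s) * fact s * real s ^ s \<le> real n ^ s * (exp (real s) * fact s)"
    by (intro mult_mono fact_ge_power_div_exp) auto
  then have "real (n choose s) * real s ^ s \<le> real n ^ s * exp (real s)"
    by (simp add: mult_ac)
  then have "real (n choose s) \<le> (real n / real s) ^ s * exp (real s)"
    using assms by (simp add: power_divide field_simps)
  also have "(real n / real s) ^ s = exp (real s * ln (real n / real s))"
    using assms by (simp add: exp_of_nat_mult)
  finally show ?thesis by (simp add: exp_add[symmetric] algebra_simps)
qed

text \<open>\<beta> is the cost per element of the union bound: there are at most
  \<open>exp (s * \<beta>)\<close> sets of size \<open>s\<close>, for all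
  \<open>s \<ge> slow\<close> alike. So each size contributes at most \<open>q\<close>, and there
  are at most \<open>card V\<close> sizes.\<close>

lemma rsprob_union_large_sets:
  assumes "finite V" "slow > 0" "q \<ge> 0" "1 + ln (real (card V) / slow) \<le> \<beta>"
    "\<And>U. U \<subseteq> V \<Longrightarrow> slow \<le> real (card U) \<Longrightarrow> rsprob X p (S U) \<le> q * exp (- (real (card U) * \<beta>))"
  shows "rsprob X p {E. \<exists>U\<subseteq>V. slow \<le> real (card U) \<and> E \<in> S U} \<le> real (card V) * q"
proof -
  define n where "n = card V"
  define I where "I s = {U. U \<subseteq> V \<and> card U = s}" for s
  define A where "A = {s. s \<le> n \<and> slow \<le> real s}"
  have finI: "finite (I s)" for s using assms(1) by (simp add: I_def)
  have A: "finite A" "A \<subseteq> {1..n}" using assms(2) by (auto simp: A_def)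
  have "{E. \<exists>U\<subseteq>V. slow \<le> real (card U) \<and> E \<in> S U} = (\<Union>s\<in>A. \<Union>U\<in>I s. S U)"
    using card_mono[OF assms(1)] by (auto simp: I_def A_def n_def)
  also have "rsprob X p \<dots> \<le> (\<Sum>s\<in>A. rsprob X p (\<Union>U\<in>I s. S U))"
    by (rule rsprob_UN_le[OF A(1)])
  also have "\<dots> \<le> (\<Sum>s\<in>A. q)"
  proof (rule sum_mono)
    fix s assume s: "s \<in> A"
    then have s1: "1 \<le> s" "s \<le> n" "slow \<le> real s" using A(2) by (auto simp: A_def)
    have "rsprob X p (\<Union>U\<in>I s. S U) \<le> (\<Sum>U\<in>I s. rsprob X p (S U))"
      by (rule rsprob_UN_le[OF finI])
    also have "\<dots> \<le> (\<Sum>U\<in>I s. q * exp (- (real s * \<beta>)))"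
      by (rule sum_mono) (use assms(5) s1 in \<open>force simp: I_def\<close>)
    also have "\<dots> = real (n choose s) * (q * exp (- (real s * \<beta>)))"
      unfolding I_def n_def using n_subsets[OF assms(1)] by simp
    also have "\<dots> \<le> exp (real s * \<beta>) * (q * exp (- (real s * \<beta>)))"
    proof (rule mult_right_mono)
      have "ln (real n / real s) \<le> ln (real n / slow)"
        using s1 assms(2) by (intro ln_mono divide_left_mono) (auto simp: field_simps)
      then have "real s * (1 + ln (real n / real s)) \<le> real s * \<beta>"
        using assms(4) by (intro mult_left_mono) (auto simp: n_def)
      then show "real (n choose s) \<le> exp (real s * \<beta>)"
        using choose_le_exp[of s n] s1 by (meson exp_le_cancel_iff le_trans less_le_trans order_trans zero_less_one)
    qed (use assms(3) in auto)
    also have "\<dots> = q" by (simp add: exp_minus)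
    finally show "rsprob X p (\<Union>U\<in>I s. S U) \<le> q" .
  qed
  also have "\<dots> \<le> real n * q"
    using card_mono[OF _ A(2)] assms(3) by (auto intro: mult_right_mono)
  finally show ?thesis unfolding n_def .
qed

text \<open>For a fixed \<open>D\<close>, the vertices outside \<open>D\<close> find neighbours in
  \<open>D\<close> through disjoint sets of pairs, hence independently. The factor in front counts
  the choices of \<open>D\<close> and of the set \<open>Y\<close> of exceptions.\<close>

lemma prob_few_undominated_le:
  assumes "finite V" "0 < p" "p < 1" "l \<le> card V" "y \<le> card V"
  shows "rsprob (vertex_pairs V) p {E. \<exists>D\<subseteq>V. card D \<le> l \<and> card {v \<in> V. nbrs E v \<inter> D = {}} \<le> y}
    \<le> real (card V) ^ (l + y) * exp (- ((1 - p) ^ l * (real (card V) - real l - real y)))"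
proof -
  define n where "n = card V"
  define I where "I = {D. D \<subseteq> V \<and> card D = l} \<times> {Y. Y \<subseteq> V \<and> card Y = y}"
  define S where "S = (\<lambda>(D, Y). {E. \<forall>v\<in>V - D - Y. (\<lambda>d. {v, d}) ` D \<inter> E \<noteq> {}})"
  have finI: "finite I" using assms(1) by (simp add: I_def)
  have "{E. \<exists>D\<subseteq>V. card D \<le> l \<and> card {v \<in> V. nbrs E v \<inter> D = {}} \<le> y} \<subseteq> (\<Union>i\<in>I. S i)"
  proof clarify
    fix E D assume D: "D \<subseteq> V" "card D \<le> l" "card {v \<in> V. nbrs E v \<inter> D = {}} \<le> y"
    \<comment> \<open>Padding to exact sizes is harmless: a larger \<open>D\<close> dominates more,
      and a larger \<open>Y\<close> leaves fewer vertices to be dominated.\<close>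
    have ext: "\<exists>B. A \<subseteq> B \<and> B \<subseteq> V \<and> card B = k" if "A \<subseteq> V" "card A \<le> k" "k \<le> card V" for A k
      using exists_subset_between[of A k V] that assms(1) by auto
    obtain D' where D': "D \<subseteq> D'" "D' \<subseteq> V" "card D' = l" using ext[OF D(1,2) assms(4)] by blast
    obtain Y where Y: "{v \<in> V. nbrs E v \<inter> D = {}} \<subseteq> Y" "Y \<subseteq> V" "card Y = y"
      using ext[OF _ D(3) assms(5)] by blast
    have "(\<lambda>d. {v, d}) ` D' \<inter> E \<noteq> {}" if v: "v \<in> V - D' - Y" for v
    proof -
      from v Y(1) have "nbrs E v \<inter> D \<noteq> {}" by blast
      then obtain d where "d \<in> D" "{v, d} \<in> E" by (auto simp: nbrs_def)
      with D'(1) show ?thesis by blast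
    qed
    then have "E \<in> S (D', Y)" by (simp add: S_def)
    then show "E \<in> (\<Union>i\<in>I. S i)" using D' Y by (auto simp: I_def)
  qed
  then have "rsprob (vertex_pairs V) p {E. \<exists>D\<subseteq>V. card D \<le> l \<and> card {v \<in> V. nbrs E v \<inter> D = {}} \<le> y}
     \<le> rsprob (vertex_pairs V) p (\<Union>i\<in>I. S i)"
    by (rule_tac measure_pmf.finite_measure_mono) auto
  also have "\<dots> \<le> (\<Sum>i\<in>I. rsprob (vertex_pairs V) p (S i))" by (rule rsprob_UN_le[OF finI])
  also have "\<dots> \<le> (\<Sum>i\<in>I. exp (- ((1 - p) ^ l * (real n - real l - real y))))"
  proof (rule sum_mono)
    fix i assume "i \<in> I"
    then obtain D Y where i: "i = (D, Y)" and D: "D \<subseteq> V" "card D = l" and Y: "Y \<subseteq> V" "card Y = y"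
      by (auto simp: I_def)
    let ?Z = "V - D - Y"
    let ?B = "\<lambda>v. (\<lambda>d. {v, d}) ` D"
    have cB: "card (?B v) = l" for v
      using D by (subst card_image) (auto simp: inj_on_def doubleton_eq_iff)
    have "rsprob (vertex_pairs V) p (S i) = (\<Prod>v\<in>?Z. 1 - (1 - p) ^ card (?B v))"
      unfolding i S_def prod.case
    proof (rule rsprob_hits_all)
      show "disjoint_family_on ?B ?Z"
        by (auto simp: disjoint_family_on_def doubleton_eq_iff)
      show "?B v \<subseteq> vertex_pairs V" if "v \<in> ?Z" for v
        using that D by (auto simp: doubleton_in_vertex_pairs)
    qed (use assms in \<open>auto simp: finite_vertex_pairs\<close>)
    also have "\<dots> = (1 - (1 - p) ^ l) ^ card ?Z" by (simp add: cB)
    also have "\<dots> \<le> exp (- ((1 - p) ^ l)) ^ card ?Z"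
      using exp_ge_add_one_self[of "- ((1 - p) ^ l)"] assms
      by (intro power_mono) (auto simp: power_le_one)
    also have "\<dots> = exp (- ((1 - p) ^ l * real (card ?Z)))"
      by (simp add: exp_of_nat_mult[symmetric] mult.commute)
    also have "\<dots> \<le> exp (- ((1 - p) ^ l * (real n - real l - real y)))"
    proof -
      have "n \<le> card ?Z + l + y"
        using diff_card_le_card_Diff[of Y "V - D"] diff_card_le_card_Diff[of D V] D Y assms(1)
          finite_subset[of D V] finite_subset[of Y V] by (simp add: n_def)
      then have "real n - real l - real y \<le> real (card ?Z)" by linarith
      then show ?thesis using assms by (simp add: mult_left_mono)
    qed
    finally show "rsprob (vertex_pairs V) p (S i) \<le> exp (- ((1 - p) ^ l * (real n - real l - real y)))" .
  qed
  also have "\<dots> = real (card I) * exp (- ((1 - p) ^ l * (real n - real l - real y)))" by simp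
  also have "\<dots> \<le> real n ^ (l + y) * exp (- ((1 - p) ^ l * (real n - real l - real y)))"
  proof (rule mult_right_mono)
    have "card I = (n choose l) * (n choose y)"
      using assms(1) by (simp add: I_def card_cartesian_product n_subsets n_def)
    also have "\<dots> \<le> n ^ l * n ^ y"
      using assms by (intro mult_le_mono binomial_le_pow) (auto simp: n_def)
    finally show "real (card I) \<le> real n ^ (l + y)"
      by (metis of_nat_le_iff of_nat_power power_add)
  qed simp
  finally show ?thesis unfolding n_def .
qed

text \<open>The first moment bound \<open>(N choose k) * p^k \<le> (exp 1 * N * p / k)^k\<close> for
  the \<open>N\<close> pairs between \<open>D\<close> and \<open>U\<close>. As
  \<open>k \<ge> y \<ge> \<theta> * N\<close>, each factor is at most
  \<open>exp 1 * p / \<theta> \<le> 1\<close>, so the exponent \<open>k\<close> may be lowered to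
  \<open>y\<close>.\<close>

lemma prob_many_cross_edges_le:
  assumes V: "finite V" "U \<subseteq> V" "D \<subseteq> V" "U \<inter> D = {}" and p: "0 < p" "p \<le> 1"
    and y: "y > 0" "\<theta> * real (card D) * real (card U) \<le> y" and \<theta>: "\<theta> \<ge> exp 1 * p"
  shows "rsprob (vertex_pairs V) p {E. y \<le> (\<Sum>v\<in>D. real (card (nbrs E v \<inter> U)))}
    \<le> exp (- (y * ln (\<theta> / (exp 1 * p))))"
proof -
  define k where "k = nat \<lceil>y\<rceil>"
  have k: "k > 0" "y \<le> real k" using y by (auto simp: k_def)
  define X where "X = (\<lambda>(v, u). {v, u}) ` (D \<times> U)"
  define N where "N = card D * card U"
  have fin: "finite D" "finite U" using V(1-3) by (auto intro: finite_subset)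
  have inj: "inj_on (\<lambda>(v, u). {v, u}) (D \<times> U)"
    using V(4) by (auto simp: inj_on_def doubleton_eq_iff)
  have finX: "finite X" using fin by (simp add: X_def)
  have cX: "card X = N" unfolding X_def N_def by (simp add: card_image[OF inj] card_cartesian_product)
  have XV: "X \<subseteq> vertex_pairs V" using V by (auto simp: X_def doubleton_in_vertex_pairs)
  define I where "I = {T. T \<subseteq> X \<and> card T = k}"
  have finI: "finite I" using finX by (simp add: I_def)
  have "{E. y \<le> (\<Sum>v\<in>D. real (card (nbrs E v \<inter> U)))} \<subseteq> (\<Union>T\<in>I. {E. T \<subseteq> E})"
  proof clarify
    fix E assume E: "y \<le> (\<Sum>v\<in>D. real (card (nbrs E v \<inter> U)))"
    have "(\<Sum>v\<in>D. card (nbrs E v \<inter> U)) = card (SIGMA v:D. nbrs E v \<inter> U)"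
      using fin by simp
    also have "\<dots> = card ((\<lambda>(v, u). {v, u}) ` (SIGMA v:D. nbrs E v \<inter> U))"
      by (rule card_image[symmetric], rule inj_on_subset[OF inj]) auto
    also have "(\<lambda>(v, u). {v, u}) ` (SIGMA v:D. nbrs E v \<inter> U) = X \<inter> E"
      by (auto simp: X_def nbrs_def)
    finally have "y \<le> real (card (X \<inter> E))" using E by (metis of_nat_sum)
    then have "k \<le> card (X \<inter> E)" by (simp add: k_def ceiling_le_iff nat_le_iff)
    then obtain T where "T \<subseteq> X \<inter> E" "card T = k" by (meson obtain_subset_with_card_n)
    then show "E \<in> (\<Union>T\<in>I. {E. T \<subseteq> E})" by (auto simp: I_def)
  qed
  then have "rsprob (vertex_pairs V) p {E. y \<le> (\<Sum>v\<in>D. real (card (nbrs E v \<inter> U)))}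
      \<le> rsprob (vertex_pairs V) p (\<Union>T\<in>I. {E. T \<subseteq> E})"
    by (rule_tac measure_pmf.finite_measure_mono) auto
  also have "\<dots> \<le> (\<Sum>T\<in>I. rsprob (vertex_pairs V) p {E. T \<subseteq> E})" by (rule rsprob_UN_le[OF finI])
  also have "\<dots> = (\<Sum>T\<in>I. p ^ k)"
  proof (rule sum.cong)
    fix T assume "T \<in> I"
    then have "T \<subseteq> vertex_pairs V" "card T = k" using XV by (auto simp: I_def)
    then show "rsprob (vertex_pairs V) p {E. T \<subseteq> E} = p ^ k"
      using rsprob_superset[of "vertex_pairs V" p T] V p by (simp add: finite_vertex_pairs)
  qed simp
  also have "\<dots> = real (N choose k) * p ^ k" by (simp add: I_def n_subsets[OF finX] cX)
  also have "\<dots> \<le> exp (- (y * ln (\<theta> / (exp 1 * p))))"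
  proof (cases "k \<le> N")
    case False
    then have "N choose k = 0" by (intro binomial_eq_0) simp
    then have "real (N choose k) * p ^ k = 0" by (simp only: of_nat_0 mult_zero_left)
    then show ?thesis by (simp only: exp_ge_zero)
  next
    case True
    then have N: "N > 0" using k by simp
    have \<theta>0: "\<theta> > 0" using \<theta> p by (smt (verit) exp_gt_zero mult_pos_pos)
    have "real N / real k \<le> 1 / \<theta>"
      using y(2) k \<theta>0 by (simp add: N_def field_simps)
    then have "ln (real N / real k) \<le> ln (1 / \<theta>)"
      using N k \<theta>0 by (intro ln_mono) auto
    then have "real k * (1 + ln (real N / real k)) \<le> real k * (1 - ln \<theta>)"
      using \<theta>0 by (intro mult_left_mono) (auto simp: ln_div)
    then have "real (N choose k) \<le> exp (real k * (1 - ln \<theta>))"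
      using choose_le_exp[OF k(1) True] by (smt (verit) exp_le_cancel_iff)
    then have "real (N choose k) * p ^ k \<le> exp (real k * (1 - ln \<theta>)) * p ^ k"
      using p by (intro mult_right_mono) auto
    also have "exp (real k * (1 - ln \<theta>)) * p ^ k = exp (- (real k * ln (\<theta> / (exp 1 * p))))"
    proof -
      have "p ^ k = exp (real k * ln p)" using p exp_of_nat_mult[of k "ln p"] by simp
      then show ?thesis using p \<theta>0 by (simp add: exp_add[symmetric] ln_div ln_mult algebra_simps)
    qed
    also have "\<dots> \<le> exp (- (y * ln (\<theta> / (exp 1 * p))))"
      using k(2) \<theta> p by (simp add: mult_right_mono)
    finally show ?thesis .
  qed
  finally show ?thesis .
qed

text \<open>
  The second summand in the exponent \<open>max (K s) (\<theta> h s)\<close> pays for the choice of \<open>D\<close>, the first one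
  for the choice of \<open>U\<close>.
\<close>

lemma prob_dense_to_set_le:
  fixes V :: "'a set" and K \<theta> \<beta> a p slow :: real
  defines "n \<equiv> card V" and "L' \<equiv> ln (\<theta> / (exp 1 * p))"
  assumes V: "finite V" "n \<ge> 2" and p: "0 < p" "p \<le> 1" and slow: "slow > 0" and K: "K \<ge> 0"
    and \<theta>: "\<theta> \<ge> exp 1 * p" and \<beta>: "1 + ln (real n / slow) \<le> \<beta>" and a: "0 \<le> a" "a \<le> 1"
    and KL: "\<beta> \<le> (1 - a) * K * L'" and aL: "4 * ln (real n) \<le> a * \<theta> * slow * L'"
  shows "rsprob (vertex_pairs V) p
    {E. \<exists>U\<subseteq>V. slow \<le> real (card U) \<and> (\<exists>D\<subseteq>V - U. (\<forall>v\<in>D. \<theta> * real (card U) \<le> real (card (nbrs E v \<inter> U))) \<and>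
        K * real (card U) < (\<Sum>v\<in>D. real (card (nbrs E v \<inter> U))))} \<le> 1 / real n"
proof -
  have \<theta>0: "\<theta> > 0" using \<theta> p by (smt (verit) exp_gt_zero mult_pos_pos)
  have L'0: "L' \<ge> 0" using \<theta> p unfolding L'_def by (intro ln_ge_zero) (auto simp: field_simps)
  \<comment> \<open>Anticipates the sum of \<open>(1 / n^4) ^ card D\<close> over nonempty
    \<open>D\<close>, which is at most \<open>(1 + 1 / n^4)^n - 1\<close>.\<close>
  define q where "q = 2 / real n ^ 3"
  define S where "S U = {E. \<exists>D\<subseteq>V - U. (\<forall>v\<in>D. \<theta> * real (card U) \<le> real (card (nbrs E v \<inter> U))) \<and>
        K * real (card U) < (\<Sum>v\<in>D. real (card (nbrs E v \<inter> U)))}" for U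
  have "rsprob (vertex_pairs V) p {E. \<exists>U\<subseteq>V. slow \<le> real (card U) \<and> E \<in> S U} \<le> real (card V) * q"
  proof (rule rsprob_union_large_sets[where \<beta> = \<beta>])
    fix U assume U: "U \<subseteq> V" "slow \<le> real (card U)"
    define s where "s = real (card U)"
    have s: "s > 0" using U slow by (simp add: s_def)
    define y where "y D = max (K * s) (\<theta> * real (card D) * s)" for D :: "'a set"
    define I where "I = {D. D \<subseteq> V - U} - {{}}"
    have finI: "finite I" using V by (simp add: I_def)
    have "S U \<subseteq> (\<Union>D\<in>I. {E. y D \<le> (\<Sum>v\<in>D. real (card (nbrs E v \<inter> U)))})"
    proof
      fix E assume "E \<in> S U"
      then obtain D where D: "D \<subseteq> V - U" "\<And>v. v \<in> D \<Longrightarrow> \<theta> * s \<le> real (card (nbrs E v \<inter> U))"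
         "K * s < (\<Sum>v\<in>D. real (card (nbrs E v \<inter> U)))" by (auto simp: S_def s_def)
      have "D \<noteq> {}" using D(3) mult_nonneg_nonneg[OF K, of s] s by auto
      moreover have "\<theta> * real (card D) * s \<le> (\<Sum>v\<in>D. real (card (nbrs E v \<inter> U)))"
        using sum_mono[OF D(2), of D "\<lambda>v. v"] by (simp add: mult_ac)
      ultimately have "D \<in> I" "y D \<le> (\<Sum>v\<in>D. real (card (nbrs E v \<inter> U)))"
        using D(1,3) by (simp_all add: I_def y_def)
      then show "E \<in> (\<Union>D\<in>I. {E. y D \<le> (\<Sum>v\<in>D. real (card (nbrs E v \<inter> U)))})" by blast
    qed
    then have "rsprob (vertex_pairs V) p (S U)
       \<le> rsprob (vertex_pairs V) p (\<Union>D\<in>I. {E. y D \<le> (\<Sum>v\<in>D. real (card (nbrs E v \<inter> U)))})"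
      by (rule measure_pmf.finite_measure_mono) auto
    also have "\<dots> \<le> (\<Sum>D\<in>I. rsprob (vertex_pairs V) p {E. y D \<le> (\<Sum>v\<in>D. real (card (nbrs E v \<inter> U)))})"
      by (rule rsprob_UN_le[OF finI])
    also have "\<dots> \<le> (\<Sum>D\<in>I. exp (- (s * \<beta>)) * (1 / real n ^ 4) ^ card D)"
    proof (rule sum_mono)
      fix D assume D: "D \<in> I"
      have cD: "card D > 0" using D V finite_subset by (fastforce simp: I_def card_gt_0_iff)
      have yp: "y D > 0" using cD s \<theta>0 by (auto simp: y_def less_max_iff_disj)
      have "rsprob (vertex_pairs V) p {E. y D \<le> (\<Sum>v\<in>D. real (card (nbrs E v \<inter> U)))}
         \<le> exp (- (y D * L'))" unfolding L'_def
        by (rule prob_many_cross_edges_le) (use V U D p yp \<theta> in \<open>auto simp: I_def y_def s_def\<close>)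
      also have "\<dots> \<le> exp (- (s * \<beta> + real (card D) * (4 * ln (real n))))"
      proof -
        \<comment> \<open>A maximum is at least every convex combination; the weight
          \<open>1 - a\<close> goes to \<open>U\<close>, the weight \<open>a\<close> to
          \<open>D\<close>.\<close>
        have "(1 - a) * (K * s) + a * (\<theta> * real (card D) * s) \<le> (1 - a) * y D + a * y D"
          using a by (intro add_mono mult_left_mono) (auto simp: y_def)
        then have "((1 - a) * (K * s) + a * (\<theta> * real (card D) * s)) * L' \<le> y D * L'"
          using L'0 by (intro mult_right_mono) (auto simp: algebra_simps)
        moreover have "s * \<beta> \<le> s * ((1 - a) * K * L')" using KL s by simp
        moreover have "real (card D) * (4 * ln (real n)) \<le> real (card D) * (a * \<theta> * s * L')"
        proof -
          have "a * \<theta> * slow * L' \<le> a * \<theta> * s * L'"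
            using a \<theta>0 L'0 U by (intro mult_right_mono mult_left_mono) (auto simp: s_def)
          with aL show ?thesis by (intro mult_left_mono) auto
        qed
        ultimately show ?thesis by (simp add: algebra_simps)
      qed
      also have "\<dots> = exp (- (s * \<beta>)) * exp (- (real (card D) * (4 * ln (real n))))"
        by (simp add: exp_add[symmetric])
      also have "exp (- (real (card D) * (4 * ln (real n)))) = (1 / real n ^ 4) ^ card D"
      proof -
        have "1 / real n ^ 4 = exp (- (4 * ln (real n)))"
          using exp_of_nat_mult[of 4 "ln (real n)"] V by (simp add: exp_minus field_simps)
        then show ?thesis by (simp add: exp_of_nat_mult[symmetric])
      qed
      finally show "rsprob (vertex_pairs V) p {E. y D \<le> (\<Sum>v\<in>D. real (card (nbrs E v \<inter> U)))}
        \<le> exp (- (s * \<beta>)) * (1 / real n ^ 4) ^ card D" .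
    qed
    also have "\<dots> = exp (- (s * \<beta>)) * (\<Sum>D\<in>I. (1 / real n ^ 4) ^ card D)"
      by (simp add: sum_distrib_left)
    also have "\<dots> \<le> exp (- (s * \<beta>)) * q"
    proof (rule mult_left_mono)
      have "(\<Sum>D\<in>I. (1 / real n ^ 4) ^ card D) \<le> (\<Sum>D\<in>Pow V - {{}}. (1 / real n ^ 4) ^ card D)"
        by (rule sum_mono2) (use V in \<open>auto simp: I_def\<close>)
      also have "\<dots> = (1 + 1 / real n ^ 4) ^ n - 1"
        using sum_Pow_power_card[OF V(1), of "1 / real n ^ 4"] V
        by (simp add: sum_diff1 n_def)
      also have "(1 + 1 / real n ^ 4) ^ n \<le> exp (1 / real n ^ 4) ^ n"
        by (intro power_mono) (use exp_ge_add_one_self[of "1 / real n ^ 4"] in auto)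
      also have "\<dots> = exp (1 / real n ^ 3)"
        using V by (simp add: exp_of_nat_mult[symmetric] power_numeral_reduce)
      also have "\<dots> \<le> 1 + 2 * (1 / real n ^ 3)"
      proof -
        define x where "x = 1 / real n ^ 3"
        have x: "0 \<le> x" "x \<le> 1" using V by (auto simp: x_def)
        then have "x\<^sup>2 \<le> x" by (simp add: power2_eq_square mult_left_le)
        with exp_bound[OF x] show ?thesis unfolding x_def[symmetric] by linarith
      qed
      finally show "(\<Sum>D\<in>I. (1 / real n ^ 4) ^ card D) \<le> q" by (simp add: q_def)
    qed simp
    finally show "rsprob (vertex_pairs V) p (S U) \<le> q * exp (- (real (card U) * \<beta>))"
      by (simp add: s_def mult.commute)
  qed (use V slow \<beta> in \<open>auto simp: q_def n_def\<close>)
  also have "real (card V) * q \<le> 1 / real n"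
    using V by (simp add: q_def n_def[symmetric] power_numeral_reduce field_simps)
  finally show ?thesis by (simp add: S_def)
qed

section \<open>Tuples without a common neighbour outside a set\<close>

definition unextended :: "'a set \<Rightarrow> 'a set set \<Rightarrow> 'a set \<Rightarrow> 'a set \<Rightarrow> bool" where
  "unextended V E U Q \<longleftrightarrow> (\<forall>v\<in>V - U. \<not> Q \<subseteq> nbrs E v)"

text \<open>The coordinates have sets of their own so that some of them can be confined to the
  non-neighbours of a chosen outside vertex.\<close>

definition rich :: "'a set \<Rightarrow> 'a set set \<Rightarrow> nat \<Rightarrow> real \<Rightarrow> real \<Rightarrow> 'a set \<Rightarrow> bool" where
  "rich V E r u \<eta> U \<longleftrightarrow> (\<exists>Us. (\<forall>i<r. Us i \<subseteq> U \<and> u \<le> real (card (Us i))) \<and>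
     \<eta> * (\<Prod>i<r. real (card (Us i))) \<le>
       real (card {b \<in> PiE {..<r} Us. inj_on b {..<r} \<and> unextended V E U (b ` {..<r})}))"

text \<open>
  Richness of \<open>U\<close> only depends on the pairs that are not contained in \<open>U\<close>. Conditionally on these,
  the edges inside \<open>U\<close> are still independent, and Janson's inequality applies to a fixed family.
\<close>

lemma prob_rich_no_clique_le:
  fixes V U :: "'a set" and r :: nat and p u \<eta> :: real
  assumes V: "finite V" "U \<subseteq> V" and u: "u > 0" and p: "0 < p" "p \<le> 1" and r: "r \<ge> 2" and \<eta>: "\<eta> > 0"
    and small: "(real r)\<^sup>2 / u * (1 / p) powr (real r / 2) \<le> 1"
  shows "rsprob (vertex_pairs V) p {E. rich V E r u \<eta> U \<and>
      \<not> (\<exists>Q\<subseteq>U. card Q = r \<and> vertex_pairs Q \<subseteq> E \<and> unextended V E U Q)}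
    \<le> exp (- (\<eta> * u\<^sup>2 / (12 * (real r)^4 * (1 / p) powr (real r / 2))))" (is "rsprob _ p ?S \<le> ?q")
proof -
  have fU: "finite U" using V finite_subset by auto
  define Y where "Y = vertex_pairs V - vertex_pairs U"
  have eq: "vertex_pairs V = vertex_pairs U \<union> Y"
    using vertex_pairs_mono[OF V(2)] by (auto simp: Y_def)
  have "rsprob (vertex_pairs U \<union> Y) p ?S \<le> ?q"
  proof (rule rsprob_fiber_le)
    fix C assume C: "C \<subseteq> Y"
    \<comment> \<open>A pair with an end outside \<open>U\<close> is never in \<open>E\<close>, so
      \<open>C\<close> alone decides.\<close>
    have unext: "unextended V (E \<union> C) U Q \<longleftrightarrow> unextended V C U Q"
      if E: "E \<subseteq> vertex_pairs U" for E Q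
    proof -
      have "nbrs (E \<union> C) v = nbrs C v" if v: "v \<in> V - U" for v
      proof -
        have "{v, x} \<notin> E" for x
          using subsetD[OF E, of "{v, x}"] v doubleton_in_vertex_pairs[of v x U] by auto
        then show ?thesis by (simp add: nbrs_def)
      qed
      then show ?thesis by (simp add: unextended_def)
    qed
    have rich: "rich V (E \<union> C) r u \<eta> U \<longleftrightarrow> rich V C r u \<eta> U" if "E \<subseteq> vertex_pairs U" for E
      by (simp add: rich_def unext[OF that])
    show "rsprob (vertex_pairs U) p {E. E \<union> C \<in> ?S} \<le> ?q"
    proof (cases "rich V C r u \<eta> U")
      case False
      have "rsprob (vertex_pairs U) p {E. E \<union> C \<in> ?S} \<le> rsprob (vertex_pairs U) p {}"
      proof (rule rsprob_mono)
        fix E assume "E \<subseteq> vertex_pairs U" "E \<in> {E. E \<union> C \<in> ?S}"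
        then have "rich V C r u \<eta> U" using rich by blast
        with False show "E \<in> {}" by contradiction
      qed (use fU in \<open>simp add: finite_vertex_pairs\<close>)
      also have "\<dots> \<le> ?q" by simp
      finally show ?thesis .
    next
      case True
      then obtain Us where Us: "\<And>i. i < r \<Longrightarrow> Us i \<subseteq> U" "\<And>i. i < r \<Longrightarrow> u \<le> real (card (Us i))"
        and cF: "\<eta> * (\<Prod>i<r. real (card (Us i))) \<le>
          real (card {b \<in> PiE {..<r} Us. inj_on b {..<r} \<and> unextended V C U (b ` {..<r})})"
        by (auto simp: rich_def)
      let ?F = "{b \<in> PiE {..<r} Us. inj_on b {..<r} \<and> unextended V C U (b ` {..<r})}"
      have "rsprob (vertex_pairs U) p {E. E \<union> C \<in> ?S}
         \<le> rsprob (vertex_pairs U) p {E. \<forall>b\<in>?F. \<not> vertex_pairs (b ` {..<r}) \<subseteq> E}"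
      proof (rule rsprob_mono)
        fix E assume E: "E \<subseteq> vertex_pairs U" "E \<in> {E. E \<union> C \<in> ?S}"
        show "E \<in> {E. \<forall>b\<in>?F. \<not> vertex_pairs (b ` {..<r}) \<subseteq> E}"
        proof (rule CollectI, intro ballI notI)
          fix b assume b: "b \<in> ?F" "vertex_pairs (b ` {..<r}) \<subseteq> E"
          have "b ` {..<r} \<subseteq> U" using b(1) Us(1) by (fastforce simp: PiE_iff)
          moreover have "card (b ` {..<r}) = r" using b(1) by (simp add: card_image)
          moreover have "unextended V (E \<union> C) U (b ` {..<r})" using b(1) unext[OF E(1)] by simp
          ultimately show False using E(2) b(2) by blast
        qed
      qed (use fU in \<open>simp add: finite_vertex_pairs\<close>)
      also have "\<dots> \<le> ?q"
        by (rule janson_clique_tuples[OF fU Us u p r _ _ \<eta> cF small]) auto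
      finally show ?thesis .
    qed
  qed (use V fU p in \<open>auto simp: Y_def finite_vertex_pairs\<close>)
  then show ?thesis unfolding eq .
qed

section \<open>Colour classes and unextended cliques\<close>

lemma nbrs_sym: "u \<in> nbrs E v \<longleftrightarrow> v \<in> nbrs E u"
  by (simp add: nbrs_def insert_commute)

text \<open>
  Each step of the greedy choice of \<open>D\<close> shrinks the undominated part of \<open>A\<close> by a factor \<open>\<kappa>\<close>.
\<close>

lemma ex_dominating_or_expanding:
  fixes \<kappa> :: real
  assumes "finite V" "A \<subseteq> V" "0 \<le> \<kappa>"
  shows "\<exists>D\<subseteq>V. card D \<le> t \<and>
    ((\<forall>v\<in>V. \<kappa> * real (card {a \<in> A. nbrs E a \<inter> D = {}}) \<le> real (card ({a \<in> A. nbrs E a \<inter> D = {}} - nbrs E v))) \<or>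
     real (card {a \<in> A. nbrs E a \<inter> D = {}}) \<le> \<kappa> ^ t * real (card A))"
proof (induction t)
  case 0
  have "A \<inter> {a. nbrs E a \<inter> {} = {}} = A" by auto
  then show ?case by (intro exI[of _ "{}"]) simp
next
  case (Suc t)
  let ?U = "\<lambda>D. {a \<in> A. nbrs E a \<inter> D = {}}"
  from Suc obtain D where D: "D \<subseteq> V" "card D \<le> t"
    "(\<forall>v\<in>V. \<kappa> * real (card (?U D)) \<le> real (card (?U D - nbrs E v))) \<or> real (card (?U D)) \<le> \<kappa> ^ t * real (card A)"
    by blast
  show ?case
  proof (cases "\<forall>v\<in>V. \<kappa> * real (card (?U D)) \<le> real (card (?U D - nbrs E v))")
    case True
    with D show ?thesis by (intro exI[of _ D]) auto
  next
    case False
    then obtain v where v: "v \<in> V" "real (card (?U D - nbrs E v)) < \<kappa> * real (card (?U D))" by force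
    have "?U (insert v D) = ?U D - nbrs E v" using nbrs_sym[of _ E v] by auto
    then have "real (card (?U (insert v D))) \<le> \<kappa> * real (card (?U D))" using v by simp
    also have "\<dots> \<le> \<kappa> * (\<kappa> ^ t * real (card A))"
      using D(3) False assms(3) by (intro mult_left_mono) auto
    finally have "real (card (?U (insert v D))) \<le> \<kappa> ^ Suc t * real (card A)" by simp
    moreover have "card (insert v D) \<le> Suc t"
      using D(2) card_insert_if[OF finite_subset[OF D(1) assms(1)], of v] by (simp split: if_splits)
    ultimately show ?thesis using D(1) v(1) by (intro exI[of _ "insert v D"]) auto
  qed
qed

lemma ex_maximal_clique_superset:
  assumes "finite V" "clique V E Q"
  shows "\<exists>K. maximal_clique V E K \<and> Q \<subseteq> K"
proof -
  have "finite {K. clique V E K}"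
    using assms(1) by (rule_tac finite_subset[of _ "Pow V"]) (auto simp: clique_def)
  then obtain K where "K \<in> {K. clique V E K}" "Q \<subseteq> K" "\<forall>L\<in>{K. clique V E K}. K \<subseteq> L \<longrightarrow> K = L"
    using finite_has_maximal2[of "{K. clique V E K}" Q] assms(2) by auto
  then show ?thesis unfolding maximal_clique_def by auto
qed

text \<open>Pigeonhole: the dominating sets of all colours together have at most
  \<open>t * k\<close> vertices, so by \<open>undom\<close> the vertices left over cannot be spread
  over \<open>k\<close> classes in portions of size at most \<open>s\<^sub>0\<close>.\<close>

lemma no_clique_coloring_if_sets_contain_unextended_cliques:
  fixes \<kappa> s\<^sub>0 :: real and f :: "'a \<Rightarrow> nat"
  assumes V: "finite V" and r: "r \<ge> 2" and \<kappa>: "0 \<le> \<kappa>" "\<kappa> ^ t * real (card V) < 1" and s0: "s\<^sub>0 > 0"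
    and undom: "\<And>D. D \<subseteq> V \<Longrightarrow> card D \<le> t * k \<Longrightarrow> real k * s\<^sub>0 < real (card {v \<in> V. nbrs E v \<inter> D = {}})"
    and cliques: "\<And>U. U \<subseteq> V \<Longrightarrow> s\<^sub>0 \<le> real (card U) \<Longrightarrow>
        (\<And>v. v \<in> V - U \<Longrightarrow> \<kappa> * real (card U) \<le> real (card (U - nbrs E v))) \<Longrightarrow>
        \<exists>Q\<subseteq>U. card Q = r \<and> vertex_pairs Q \<subseteq> E \<and> unextended V E U Q"
    and f: "f ` V \<subseteq> {..<k}"
  shows "\<not> clique_coloring V E f"
proof
  assume col: "clique_coloring V E f"
  define A where "A i = {v \<in> V. f v = i}" for i
  define W where "W i D = {a \<in> A i. nbrs E a \<inter> D = {}}" for i D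
  have "\<exists>D\<subseteq>V. card D \<le> t \<and>
    ((\<forall>v\<in>V. \<kappa> * real (card (W i D)) \<le> real (card (W i D - nbrs E v))) \<or>
     real (card (W i D)) \<le> \<kappa> ^ t * real (card (A i)))" for i
    unfolding W_def by (rule ex_dominating_or_expanding) (use V \<kappa> in \<open>auto simp: A_def\<close>)
  then obtain D where D: "\<And>i. D i \<subseteq> V" "\<And>i. card (D i) \<le> t"
    "\<And>i. (\<forall>v\<in>V. \<kappa> * real (card (W i (D i))) \<le> real (card (W i (D i) - nbrs E v))) \<or>
     real (card (W i (D i))) \<le> \<kappa> ^ t * real (card (A i))" by metis
  define DD where "DD = (\<Union>i<k. D i)"
  have "card DD \<le> (\<Sum>i<k. card (D i))" unfolding DD_def by (rule card_UN_le) simp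
  also have "\<dots> \<le> (\<Sum>i<k. t)" by (rule sum_mono) (use D in auto)
  finally have "card DD \<le> t * k" by (simp add: mult.commute)
  moreover have "DD \<subseteq> V" using D by (auto simp: DD_def)
  ultimately have "real k * s\<^sub>0 < real (card {v \<in> V. nbrs E v \<inter> DD = {}})" by (intro undom)
  also have "card {v \<in> V. nbrs E v \<inter> DD = {}} \<le> card (\<Union>i<k. W i (D i))"
    by (rule card_mono) (use V f in \<open>auto simp: W_def A_def DD_def\<close>)
  also have "\<dots> \<le> (\<Sum>i<k. card (W i (D i)))" by (rule card_UN_le) simp
  finally have sum: "real k * s\<^sub>0 < (\<Sum>i<k. real (card (W i (D i))))" by simp
  have "\<exists>i<k. s\<^sub>0 < real (card (W i (D i)))"
  proof (rule ccontr)
    assume "\<not> ?thesis"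
    then have "real (card (W i (D i))) \<le> s\<^sub>0" if "i < k" for i using that not_less by blast
    then have "(\<Sum>i<k. real (card (W i (D i)))) \<le> (\<Sum>i<k. s\<^sub>0)" by (intro sum_mono) simp
    with sum show False by simp
  qed
  then obtain i where i: "s\<^sub>0 < real (card (W i (D i)))" by blast
  define U where "U = W i (D i)"
  have UA: "U \<subseteq> A i" "U \<subseteq> V" by (auto simp: U_def W_def A_def)
  \<comment> \<open>After \<open>t\<close> shrinkings fewer than one vertex would be left, so the
    other alternative holds and \<open>U\<close> is expanding.\<close>
  have "\<not> real (card U) \<le> \<kappa> ^ t * real (card (A i))"
  proof
    assume "real (card U) \<le> \<kappa> ^ t * real (card (A i))"
    also have "\<dots> \<le> \<kappa> ^ t * real (card V)"
      using V \<kappa> by (intro mult_left_mono of_nat_mono card_mono) (auto simp: A_def)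
    finally have "card U = 0" using \<kappa> by simp
    then show False using i s0 by (simp add: U_def)
  qed
  then have "\<And>v. v \<in> V - U \<Longrightarrow> \<kappa> * real (card U) \<le> real (card (U - nbrs E v))"
    using D(3)[of i] by (auto simp: U_def)
  then obtain Q where Q: "Q \<subseteq> U" "card Q = r" "vertex_pairs Q \<subseteq> E" "unextended V E U Q"
    using cliques[OF UA(2)] i by (auto simp: U_def)
  have "clique V E Q"
    unfolding clique_def
  proof (intro conjI ballI impI)
    show "Q \<subseteq> V" using Q UA by auto
    fix u v assume "u \<in> Q" "v \<in> Q" "u \<noteq> v"
    then have "{u, v} \<in> vertex_pairs Q" by (simp add: doubleton_in_vertex_pairs)
    then show "{u, v} \<in> E" using Q by auto
  qed
  then obtain K where K: "maximal_clique V E K" "Q \<subseteq> K" using ex_maximal_clique_superset V by blast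
  have KV: "K \<subseteq> V" using K by (auto simp: maximal_clique_def clique_def)
  \<comment> \<open>A vertex of \<open>K\<close> outside \<open>U\<close> would be a common
    neighbour of \<open>Q\<close>.\<close>
  have "K \<subseteq> U"
  proof
    fix v assume v: "v \<in> K"
    show "v \<in> U"
    proof (rule ccontr)
      assume "v \<notin> U"
      have "Q \<subseteq> nbrs E v"
      proof
        fix x assume x: "x \<in> Q"
        then have "x \<noteq> v" "x \<in> K" using \<open>v \<notin> U\<close> Q K by auto
        then show "x \<in> nbrs E v" using K(1) v by (auto simp: maximal_clique_def clique_def nbrs_def)
      qed
      then show False using Q(4) \<open>v \<notin> U\<close> KV v by (auto simp: unextended_def)
    qed
  qed
  then have "\<forall>v\<in>K. f v = i" using UA by (auto simp: A_def)
  then have "monochromatic f K" unfolding monochromatic_def by blast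
  moreover have "card K \<ge> 2"
    using card_mono[OF finite_subset[OF KV V] K(2)] Q(2) r by simp
  ultimately show False using col K(1) by (auto simp: clique_coloring_def)
qed

text \<open>If \<open>b i = b j\<close>, then coordinate \<open>i\<close> can be recovered from the
  others, so the coincidence costs a factor \<open>card (Us i) \<ge> u\<close>. There are at most
  \<open>r\<^sup>2\<close> ordered pairs of coordinates.\<close>

lemma card_PiE_not_inj_le:
  fixes Us :: "nat \<Rightarrow> 'a set"
  assumes "\<And>i. i < r \<Longrightarrow> finite (Us i)" "\<And>i. i < r \<Longrightarrow> u \<le> real (card (Us i))" "u > 0"
  shows "real (card {b \<in> PiE {..<r} Us. \<not> inj_on b {..<r}})
    \<le> (real r)\<^sup>2 / u * (\<Prod>i<r. real (card (Us i)))"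
proof -
  define Q where "Q = (\<Prod>i<r. real (card (Us i)))"
  define N where "N = (\<lambda>(i, j). {b \<in> PiE {..<r} Us. b i = b j})"
  define I where "I = {(i, j). i < r \<and> j < r \<and> i \<noteq> j}"
  have I: "I \<subseteq> {..<r} \<times> {..<r}" by (auto simp: I_def)
  have finI: "finite I" using I finite_subset by blast
  have finP: "finite (PiE {..<r} Us)" using assms by (auto intro: finite_PiE)
  have Q0: "Q \<ge> 0" unfolding Q_def by (rule prod_nonneg) auto
  have "{b \<in> PiE {..<r} Us. \<not> inj_on b {..<r}} \<subseteq> (\<Union>x\<in>I. N x)"
    by (auto simp: inj_on_def N_def I_def)
  moreover have "finite (\<Union>x\<in>I. N x)" using finI finP by (auto simp: N_def)
  ultimately have "card {b \<in> PiE {..<r} Us. \<not> inj_on b {..<r}} \<le> card (\<Union>x\<in>I. N x)"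
    by (rule card_mono[rotated])
  also have "\<dots> \<le> (\<Sum>x\<in>I. card (N x))" by (rule card_UN_le[OF finI])
  finally have "real (card {b \<in> PiE {..<r} Us. \<not> inj_on b {..<r}}) \<le> (\<Sum>x\<in>I. real (card (N x)))"
    by (simp flip: of_nat_sum)
  also have "\<dots> \<le> (\<Sum>x\<in>I. Q / u)"
  proof (rule sum_mono, clarify)
    fix i j assume "(i, j) \<in> I"
    then have ij: "i < r" "j < r" "i \<noteq> j" by (auto simp: I_def)
    define g where "g b = restrict b ({..<r} - {i})" for b :: "nat \<Rightarrow> 'a"
    have "inj_on g (N (i, j))"
    proof (rule inj_onI)
      fix b b' assume b: "b \<in> N (i, j)" "b' \<in> N (i, j)" "g b = g b'"
      have eq: "b x = b' x" if "x < r" "x \<noteq> i" for x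
        using fun_cong[OF b(3), of x] that by (simp add: g_def)
      show "b = b'"
      proof
        fix x
        show "b x = b' x"
          using b(1,2) eq[of x] eq[of j] ij by (cases "x < r"; cases "x = i") (auto simp: N_def PiE_def extensional_def)
      qed
    qed
    moreover have "g ` N (i, j) \<subseteq> PiE ({..<r} - {i}) Us"
      by (intro image_subsetI) (simp add: g_def N_def PiE_iff)
    ultimately have "card (N (i, j)) \<le> card (PiE ({..<r} - {i}) Us)"
      using assms by (intro card_inj_on_le) (auto intro: finite_PiE)
    also have "\<dots> = (\<Prod>l\<in>{..<r} - {i}. card (Us l))" by (simp add: card_PiE)
    finally have "real (card (N (i, j))) \<le> (\<Prod>l\<in>{..<r} - {i}. real (card (Us l)))"
      by (metis of_nat_le_iff of_nat_prod)
    also have "\<dots> = Q / real (card (Us i))"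
      unfolding Q_def using ij assms(2)[of i] assms(3) by (subst prod.remove[of "{..<r}" i]) auto
    also have "\<dots> \<le> Q / u"
      using assms(2)[of i] assms(3) ij Q0 by (intro divide_left_mono) auto
    finally show "real (card (N (i, j))) \<le> Q / u" .
  qed
  also have "\<dots> = real (card I) * (Q / u)" by simp
  also have "\<dots> \<le> (real r)\<^sup>2 * (Q / u)"
  proof (rule mult_right_mono)
    have "card I \<le> card ({..<r} \<times> {..<r})" by (rule card_mono[OF _ I]) simp
    then show "real (card I) \<le> (real r)\<^sup>2"
      by (simp add: card_cartesian_product power2_eq_square flip: of_nat_mult)
  qed (use Q0 assms in auto)
  finally show ?thesis unfolding Q_def by simp
qed

text \<open>
  The at most \<open>M\<close> outside vertices adjacent to more than three fifths of \<open>U\<close> are neutralised by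
  reserving for each of them a coordinate that ranges over its non-neighbours only. All the other
  outside vertices together extend less than three quarters of the tuples.
\<close>

lemma rich_if_expanding:
  fixes E :: "'a set set" and r :: nat and \<kappa> \<theta>\<^sub>1 \<theta>\<^sub>2 K\<^sub>1 K\<^sub>2 :: real
  defines "q\<^sub>0 \<equiv> (r + 2) div 3"
  assumes V: "finite V" "U \<subseteq> V" and s: "card U > 0" and \<kappa>: "0 < \<kappa>" "\<kappa> \<le> 1"
    and expanding: "\<And>v. v \<in> V - U \<Longrightarrow> \<kappa> * real (card U) \<le> real (card (U - nbrs E v))"
    and h1: "\<And>W D. W \<subseteq> U \<Longrightarrow> \<kappa> * real (card U) \<le> real (card W) \<Longrightarrow> D \<subseteq> V - W \<Longrightarrow>
        (\<And>v. v \<in> D \<Longrightarrow> \<theta>\<^sub>1 * real (card W) \<le> real (card (nbrs E v \<inter> W))) \<Longrightarrow>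
        (\<Sum>v\<in>D. real (card (nbrs E v \<inter> W))) \<le> K\<^sub>1 * real (card W)"
    and h2: "\<And>D. D \<subseteq> V - U \<Longrightarrow> (\<And>v. v \<in> D \<Longrightarrow> \<theta>\<^sub>2 * real (card U) \<le> real (card (nbrs E v \<inter> U))) \<Longrightarrow>
        (\<Sum>v\<in>D. real (card (nbrs E v \<inter> U))) \<le> K\<^sub>2 * real (card U)"
    and \<theta>: "0 < \<theta>\<^sub>1" "\<theta>\<^sub>1 \<le> 1" "0 < \<theta>\<^sub>2" "\<theta>\<^sub>2 \<le> 3/5" and K: "0 \<le> K\<^sub>1" "0 \<le> K\<^sub>2"
    and KM: "\<And>m :: nat. 3/5 * real m \<le> K\<^sub>2 \<Longrightarrow> real m + 1 \<le> 2/3 * real r"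
    and c1: "(real r)\<^sup>2 / (\<kappa> * real (card U)) \<le> 1/50"
    and c2: "real (card V) * \<theta>\<^sub>1 ^ r \<le> 1/50"
    and c3: "real r * K\<^sub>1 * \<theta>\<^sub>1 ^ q\<^sub>0 \<le> 1/50"
    and c4: "K\<^sub>1 * \<theta>\<^sub>2 ^ q\<^sub>0 \<le> 1/50"
    and c5: "K\<^sub>2 * (3/5) ^ q\<^sub>0 \<le> 13/20"
  shows "rich V E r (\<kappa> * real (card U)) (1/4) U"
proof -
  define sz where "sz = real (card U)"
  have sz: "sz > 0" using s by (simp add: sz_def)
  define u where "u = \<kappa> * sz"
  have u: "u > 0" using \<kappa> sz by (simp add: u_def)
  have fU: "finite U" using V finite_subset by auto
  define \<rho> where "\<rho> v = real (card (nbrs E v \<inter> U)) / sz" for v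
  define X where "X = {v \<in> V - U. 3/5 < \<rho> v}"
  define M where "M = card X"
  have finX: "finite X" using V by (simp add: X_def)
  have sum2: "(\<Sum>v\<in>D. \<rho> v) \<le> K\<^sub>2" if "D \<subseteq> V - U" "\<And>v. v \<in> D \<Longrightarrow> \<theta>\<^sub>2 \<le> \<rho> v" for D
  proof -
    have "(\<Sum>v\<in>D. real (card (nbrs E v \<inter> U))) \<le> K\<^sub>2 * sz"
      unfolding sz_def by (rule h2[OF that(1)]) (use that(2) sz in \<open>auto simp: \<rho>_def sz_def field_simps\<close>)
    then show ?thesis using sz by (simp add: \<rho>_def sum_divide_distrib[symmetric] field_simps)
  qed
  have "3/5 * real M \<le> K\<^sub>2"
  proof -
    have "(\<Sum>v\<in>X. 3/5) \<le> (\<Sum>v\<in>X. \<rho> v)" by (rule sum_mono) (auto simp: X_def)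
    also have "\<dots> \<le> K\<^sub>2" by (rule sum2) (use \<theta> in \<open>auto simp: X_def\<close>)
    finally show ?thesis by (simp add: M_def)
  qed
  then have M: "real M + 1 \<le> 2/3 * real r" by (rule KM)
  \<comment> \<open>The \<open>M\<close> reserved coordinates leave \<open>q + 1\<close> free ones.
    Of these, one factor \<open>\<rho> v\<close> stays linear, to be summed by \<open>h1\<close> or
    \<open>h2\<close>, and \<open>q\<close> are bounded by a constant. \<open>q\<^sub>0\<close> is
    \<open>r / 3\<close> rounded up.\<close>
  define q where "q = r - M - 1"
  have q: "q + 1 + M = r" "q\<^sub>0 \<le> q" using M by (auto simp: q_def q\<^sub>0_def)
  obtain w where w: "bij_betw w {..<M} X"
    using ex_bij_betw_nat_finite[OF finX] by (auto simp: M_def atLeast0LessThan)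
  define Us where "Us i = (if i < M then U - nbrs E (w i) else U)" for i
  have UsU: "Us i \<subseteq> U" for i by (auto simp: Us_def)
  have finUs: "finite (Us i)" for i using UsU fU finite_subset by blast
  have Usu: "u \<le> real (card (Us i))" for i
  proof (cases "i < M")
    case True
    then have "w i \<in> V - U" using w by (auto simp: bij_betw_def X_def)
    then show ?thesis using expanding[of "w i"] True by (simp add: Us_def u_def sz_def)
  next
    case False
    have "\<kappa> * sz \<le> 1 * sz" using \<kappa> sz by (intro mult_right_mono) auto
    with False show ?thesis by (simp add: Us_def u_def sz_def)
  qed
  have Uspos: "real (card (Us i)) > 0" for i using Usu[of i] u by linarith
  define \<rho>' where "\<rho>' i v = real (card (nbrs E v \<inter> Us i)) / real (card (Us i))" for i v
  have \<rho>'01: "0 \<le> \<rho>' i v" "\<rho>' i v \<le> 1" for i v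
    using card_mono[OF finUs, of "nbrs E v \<inter> Us i" i] Uspos[of i] by (auto simp: \<rho>'_def)
  have \<rho>0: "0 \<le> \<rho> v" for v using sz by (simp add: \<rho>_def)
  have \<rho>'\<rho>: "\<rho>' i v = \<rho> v" if "\<not> i < M" for i v using that by (simp add: \<rho>'_def \<rho>_def Us_def sz_def)
  have sum1: "(\<Sum>v\<in>D. \<rho>' i v) \<le> K\<^sub>1" if "D \<subseteq> V - U" "\<And>v. v \<in> D \<Longrightarrow> \<theta>\<^sub>1 \<le> \<rho>' i v" for D i
  proof -
    have "(\<Sum>v\<in>D. real (card (nbrs E v \<inter> Us i))) \<le> K\<^sub>1 * real (card (Us i))"
      by (rule h1[OF UsU]) (use that UsU[of i] Uspos[of i] Usu[of i] in \<open>auto simp: \<rho>'_def u_def sz_def field_simps\<close>)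
    then show ?thesis using Uspos[of i] by (simp add: \<rho>'_def sum_divide_distrib[symmetric] field_simps)
  qed
  define \<pi> where "\<pi> v = (\<Prod>i<r. \<rho>' i v)" for v
  have \<pi>le: "\<pi> v \<le> \<rho> v ^ (q + 1)" for v
  proof -
    have "\<pi> v \<le> (\<Prod>i<r. if i < M then 1 else \<rho> v)"
      unfolding \<pi>_def by (rule prod_mono) (use \<rho>'01 \<rho>'\<rho> in auto)
    also have "\<dots> = (\<Prod>i\<in>{M..<r}. \<rho> v)"
      by (intro prod.mono_neutral_cong_right) auto
    also have "\<dots> = \<rho> v ^ (q + 1)"
    proof -
      have "r - M = q + 1" using q(1) by simp
      then show ?thesis by (simp only: prod_constant card_atLeastLessThan)
    qed
    finally show ?thesis .
  qed
  \<comment> \<open>Outside vertices that are dense into a reserved set, moderately dense into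
    \<open>U\<close>, or very dense into \<open>U\<close>; these classes may overlap. All others
    have density below \<open>\<theta>\<^sub>1\<close> in every coordinate.\<close>
  define Y2 where "Y2 = {v \<in> V - U. \<exists>i<M. \<theta>\<^sub>1 \<le> \<rho>' i v}"
  define Y3 where "Y3 = {v \<in> V - U. \<theta>\<^sub>1 \<le> \<rho> v \<and> \<rho> v < \<theta>\<^sub>2}"
  define Y4 where "Y4 = {v \<in> V - U. \<theta>\<^sub>2 \<le> \<rho> v}"
  have "(\<Sum>v\<in>V - U. \<pi> v) \<le> (\<Sum>v\<in>V - U. \<theta>\<^sub>1 ^ r + (if v \<in> Y2 then \<theta>\<^sub>1 ^ (q + 1) else 0) +
      (if v \<in> Y3 then \<theta>\<^sub>2 ^ q * \<rho> v else 0) + (if v \<in> Y4 then (3/5) ^ q * \<rho> v else 0))"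
  proof (rule sum_mono)
    fix v assume v: "v \<in> V - U"
    let ?a = "\<theta>\<^sub>1 ^ r" and ?b = "if v \<in> Y2 then \<theta>\<^sub>1 ^ (q + 1) else 0"
      and ?c = "if v \<in> Y3 then \<theta>\<^sub>2 ^ q * \<rho> v else 0" and ?d = "if v \<in> Y4 then (3/5) ^ q * \<rho> v else 0"
    have nn: "?a \<ge> 0" "?b \<ge> 0" "?c \<ge> 0" "?d \<ge> 0" using \<theta> \<rho>0 by auto
    have pw: "\<pi> v \<le> z ^ q * \<rho> v" if "\<rho> v \<le> z" for z
    proof -
      have "\<pi> v \<le> \<rho> v ^ q * \<rho> v" using \<pi>le[of v] by (simp add: mult.commute)
      also have "\<dots> \<le> z ^ q * \<rho> v" using that \<rho>0 by (intro mult_right_mono power_mono) auto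
      finally show ?thesis .
    qed
    consider "v \<in> X" | "v \<in> Y4" "\<rho> v \<le> 3/5" | "v \<in> Y3" | "\<rho> v < \<theta>\<^sub>1" "v \<in> Y2" | "\<rho> v < \<theta>\<^sub>1" "v \<notin> Y2"
      using v by (force simp: X_def Y4_def Y3_def)
    then show "\<pi> v \<le> ?a + ?b + ?c + ?d"
    proof cases
      case 1
      \<comment> \<open>The coordinate reserved for \<open>v\<close> avoids its neighbours, so
        \<open>v\<close> extends no tuple at all.\<close>
      then obtain i where i: "i < M" "w i = v" using w by (auto simp: bij_betw_def)
      have "nbrs E v \<inter> Us i = {}" using i by (auto simp: Us_def)
      then have "\<rho>' i v = 0" by (simp add: \<rho>'_def)
      then have "\<pi> v = 0" unfolding \<pi>_def using i q by (intro prod_zero bexI[of _ i]) auto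
      with nn show ?thesis by linarith
    next
      case 2
      then show ?thesis using pw[of "3/5"] nn by simp
    next
      case 3
      then have "\<pi> v \<le> ?c" using pw[of \<theta>\<^sub>2] by (simp add: Y3_def)
      then show ?thesis using nn by linarith
    next
      case 4
      have "\<pi> v \<le> \<rho> v ^ (q + 1)" by (rule \<pi>le)
      also have "\<dots> \<le> \<theta>\<^sub>1 ^ (q + 1)" using 4 \<rho>0 by (intro power_mono) auto
      finally have "\<pi> v \<le> ?b" using 4 by simp
      then show ?thesis using nn by linarith
    next
      case 5
      have "\<rho>' i v \<le> \<theta>\<^sub>1" for i
        using 5 v \<rho>'\<rho>[of i v] by (cases "i < M") (force simp: Y2_def)+
      then have "\<pi> v \<le> (\<Prod>i<r. \<theta>\<^sub>1)" unfolding \<pi>_def by (intro prod_mono) (use \<rho>'01 in auto)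
      then have "\<pi> v \<le> ?a" by simp
      then show ?thesis using nn by linarith
    qed
  qed
  also have "\<dots> = real (card (V - U)) * \<theta>\<^sub>1 ^ r + real (card Y2) * \<theta>\<^sub>1 ^ (q + 1) +
      \<theta>\<^sub>2 ^ q * (\<Sum>v\<in>Y3. \<rho> v) + (3/5) ^ q * (\<Sum>v\<in>Y4. \<rho> v)"
  proof -
    have "(\<Sum>v\<in>V - U. if v \<in> Y then g v else 0) = (\<Sum>v\<in>Y. g v)" if "Y \<subseteq> V - U" for Y and g :: "'a \<Rightarrow> real"
      by (rule sum.mono_neutral_cong_right) (use V that in auto)
    note * = this
    have Y: "Y2 \<subseteq> V - U" "Y3 \<subseteq> V - U" "Y4 \<subseteq> V - U" by (auto simp: Y2_def Y3_def Y4_def)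
    show ?thesis
      unfolding sum.distrib *[OF Y(1)] *[OF Y(2)] *[OF Y(3)] by (simp add: sum_distrib_left)
  qed
  also have "\<dots> \<le> 1/50 + 1/50 + 1/50 + 13/20"
  proof (intro add_mono)
    have "real (card (V - U)) * \<theta>\<^sub>1 ^ r \<le> real (card V) * \<theta>\<^sub>1 ^ r"
      using V \<theta> by (intro mult_right_mono of_nat_mono card_mono) auto
    with c2 show "real (card (V - U)) * \<theta>\<^sub>1 ^ r \<le> 1/50" by linarith
  next
    \<comment> \<open>The total density bound limits the number of these vertices to
      \<open>K\<^sub>1 / \<theta>\<^sub>1\<close> per coordinate, which uses up the spare factor of
      \<open>\<theta>\<^sub>1 ^ (q + 1)\<close>.\<close>
    have c: "real (card {v \<in> V - U. \<theta>\<^sub>1 \<le> \<rho>' i v}) * \<theta>\<^sub>1 \<le> K\<^sub>1" for i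
    proof -
      have "(\<Sum>v\<in>{v \<in> V - U. \<theta>\<^sub>1 \<le> \<rho>' i v}. \<theta>\<^sub>1) \<le> (\<Sum>v\<in>{v \<in> V - U. \<theta>\<^sub>1 \<le> \<rho>' i v}. \<rho>' i v)"
        by (rule sum_mono) auto
      also have "\<dots> \<le> K\<^sub>1" by (rule sum1) auto
      finally show ?thesis by simp
    qed
    have "Y2 = (\<Union>i<M. {v \<in> V - U. \<theta>\<^sub>1 \<le> \<rho>' i v})" by (auto simp: Y2_def)
    then have "card Y2 \<le> (\<Sum>i<M. card {v \<in> V - U. \<theta>\<^sub>1 \<le> \<rho>' i v})" by (simp add: card_UN_le)
    then have "real (card Y2) * \<theta>\<^sub>1 \<le> (\<Sum>i<M. real (card {v \<in> V - U. \<theta>\<^sub>1 \<le> \<rho>' i v})) * \<theta>\<^sub>1"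
      using \<theta> by (intro mult_right_mono) (auto simp flip: of_nat_sum)
    also have "\<dots> \<le> (\<Sum>i<M. K\<^sub>1)" unfolding sum_distrib_right by (rule sum_mono) (use c in auto)
    also have "\<dots> \<le> real r * K\<^sub>1" using q K by (auto intro!: mult_right_mono)
    finally have *: "real (card Y2) * \<theta>\<^sub>1 \<le> real r * K\<^sub>1" .
    have "real (card Y2) * \<theta>\<^sub>1 * \<theta>\<^sub>1 ^ q \<le> real r * K\<^sub>1 * \<theta>\<^sub>1 ^ q\<^sub>0"
      by (rule mult_mono[OF *]) (use \<theta> q(2) K in \<open>auto intro: power_decreasing\<close>)
    with c3 show "real (card Y2) * \<theta>\<^sub>1 ^ (q + 1) \<le> 1/50" by simp
  next
    \<comment> \<open>Coordinate \<open>M\<close> is not reserved, so \<open>\<rho>' M\<close> is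
      \<rho> and the bound for single coordinates applies to \<open>U\<close>.\<close>
    have "(\<Sum>v\<in>Y3. \<rho> v) \<le> K\<^sub>1"
      using sum1[of Y3 M] \<rho>'\<rho>[of M] by (auto simp: Y3_def)
    then have "\<theta>\<^sub>2 ^ q * (\<Sum>v\<in>Y3. \<rho> v) \<le> \<theta>\<^sub>2 ^ q\<^sub>0 * K\<^sub>1"
      using \<theta> q K \<rho>0 by (intro mult_mono power_decreasing sum_nonneg) auto
    with c4 show "\<theta>\<^sub>2 ^ q * (\<Sum>v\<in>Y3. \<rho> v) \<le> 1/50" by (simp add: mult.commute)
  next
    have "(\<Sum>v\<in>Y4. \<rho> v) \<le> K\<^sub>2" by (rule sum2) (auto simp: Y4_def)
    then have "(3/5) ^ q * (\<Sum>v\<in>Y4. \<rho> v) \<le> (3/5) ^ q\<^sub>0 * K\<^sub>2"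
      using q K \<rho>0 by (intro mult_mono power_decreasing sum_nonneg) auto
    with c5 show "(3/5) ^ q * (\<Sum>v\<in>Y4. \<rho> v) \<le> 13/20" by (simp add: mult.commute)
  qed
  finally have ext: "(\<Sum>v\<in>V - U. \<pi> v) \<le> 71/100" by simp

  define Q where "Q = (\<Prod>i<r. real (card (Us i)))"
  have Q0: "Q > 0" unfolding Q_def by (rule prod_pos) (use Uspos in auto)
  define F where "F = {b \<in> PiE {..<r} Us. inj_on b {..<r} \<and> unextended V E U (b ` {..<r})}"
  define N where "N = {b \<in> PiE {..<r} Us. \<not> inj_on b {..<r}}"
  define B where "B v = PiE {..<r} (\<lambda>i. nbrs E v \<inter> Us i)" for v
  have finP: "finite (PiE {..<r} Us)" using finUs by (auto intro: finite_PiE)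
  have finB: "finite (B v)" for v unfolding B_def using finUs by (auto intro: finite_PiE)
  have "PiE {..<r} Us \<subseteq> F \<union> (N \<union> (\<Union>v\<in>V - U. B v))"
  proof
    fix b assume b: "b \<in> PiE {..<r} Us"
    show "b \<in> F \<union> (N \<union> (\<Union>v\<in>V - U. B v))"
    proof (rule ccontr)
      assume not: "\<not> ?thesis"
      then have "\<not> unextended V E U (b ` {..<r})" using b by (auto simp: F_def N_def)
      then obtain v where "v \<in> V - U" "b ` {..<r} \<subseteq> nbrs E v" by (auto simp: unextended_def)
      then have "b \<in> B v" using b by (auto simp: B_def PiE_def Pi_def)
      with not \<open>v \<in> V - U\<close> show False by blast
    qed
  qed
  then have "card (PiE {..<r} Us) \<le> card (F \<union> (N \<union> (\<Union>v\<in>V - U. B v)))"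
    using finP finB V by (intro card_mono) (auto simp: F_def N_def)
  also have "\<dots> \<le> card F + card (N \<union> (\<Union>v\<in>V - U. B v))" by (rule card_Un_le)
  also have "\<dots> \<le> card F + (card N + card (\<Union>v\<in>V - U. B v))" by (intro add_left_mono card_Un_le)
  also have "\<dots> \<le> card F + (card N + (\<Sum>v\<in>V - U. card (B v)))"
    using V by (intro add_left_mono card_UN_le) auto
  finally have "real (card (PiE {..<r} Us)) \<le> real (card F) + (real (card N) + (\<Sum>v\<in>V - U. real (card (B v))))"
    by (simp flip: of_nat_sum of_nat_add)
  moreover have "real (card (PiE {..<r} Us)) = Q" by (simp add: card_PiE Q_def)
  moreover have "real (card N) \<le> 1/50 * Q"
  proof -
    have "real (card N) \<le> (real r)\<^sup>2 / u * Q"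
      unfolding N_def Q_def by (rule card_PiE_not_inj_le) (use finUs Usu u in auto)
    also have "\<dots> \<le> 1/50 * Q" using c1 Q0 by (intro mult_right_mono) (auto simp: u_def sz_def)
    finally show ?thesis .
  qed
  moreover have "(\<Sum>v\<in>V - U. real (card (B v))) \<le> 71/100 * Q"
  proof -
    have "real (card (B v)) = \<pi> v * Q" for v
    proof -
      have "real (card (B v)) = (\<Prod>i<r. real (card (nbrs E v \<inter> Us i)))" by (simp add: B_def card_PiE)
      also have "\<dots> = (\<Prod>i<r. \<rho>' i v * real (card (Us i)))"
        using Uspos by (intro prod.cong refl) (simp add: \<rho>'_def less_imp_neq[symmetric])
      finally show ?thesis by (simp add: \<pi>_def Q_def prod.distrib)
    qed
    then have "(\<Sum>v\<in>V - U. real (card (B v))) = (\<Sum>v\<in>V - U. \<pi> v) * Q" by (simp add: sum_distrib_right)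
    then show ?thesis using ext Q0 by (simp add: mult_right_mono)
  qed
  \<comment> \<open>\<open>1 - 71/100 - 1/50 = 27/100\<close>, which exceeds
    \<open>1/4\<close>.\<close>
  ultimately have "1/4 * Q \<le> real (card F)" using Q0 by linarith
  then show ?thesis
    unfolding rich_def F_def Q_def using UsU Usu by (intro exI[of _ Us]) (auto simp: u_def sz_def)
qed

section \<open>The colouring bounds for fixed parameters\<close>

text \<open>The degree estimate enters twice. A crude version with threshold
  \<open>\<theta>\<^sub>1\<close> covers all sets of size at least
  \<open>\<kappa> * s\<^sub>0\<close>, hence also the sets of non-neighbours of single vertices. A
  sharp version with \<open>\<theta>\<^sub>2\<close> and \<open>K\<^sub>2\<close> is needed for
  \<open>U\<close> itself, since \<open>K\<^sub>2\<close> limits how many coordinates have to be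
  reserved. Together with domination and Janson this makes four bad events, each of probability at
  most \<open>1 / n\<close>.\<close>

lemma prob_clique_colorable_le:
  fixes V :: "'a set" and p \<kappa> s\<^sub>0 \<theta>\<^sub>2 K\<^sub>2 \<beta>\<^sub>2 :: real and r t k :: nat
  defines "n \<equiv> card V"
  defines "L \<equiv> ln (real n)" and "Z \<equiv> (1 / p) powr (real r / 2)" and "q\<^sub>0 \<equiv> (r + 2) div 3"
    and "\<theta>\<^sub>1 \<equiv> exp 2 * p" and "l \<equiv> t * k" and "y \<equiv> nat \<lfloor>real k * s\<^sub>0\<rfloor>"
  assumes V: "finite V" "n \<ge> 2" and p: "0 < p" "p < 1" and r: "r \<ge> 3" and L: "L \<ge> 1"
    and \<kappa>: "0 < \<kappa>" "\<kappa> \<le> 1" "\<kappa> ^ t * real n < 1" and s0: "s\<^sub>0 \<ge> 1"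
    and ly: "l \<le> n" "y \<le> n" "real n ^ (l + y) * exp (- ((1 - p) ^ l * (real n - real l - real y))) \<le> 1 / real n"
    and \<beta>1: "1 + ln (real n / (\<kappa> * s\<^sub>0)) \<le> 2 * L" and e1: "2 * L \<le> p * (\<kappa> * s\<^sub>0)"
    and \<theta>2: "exp 1 * p \<le> \<theta>\<^sub>2" "\<theta>\<^sub>2 \<le> 3/5" and K2: "0 \<le> K\<^sub>2"
    and \<beta>2: "1 + ln (real n / s\<^sub>0) \<le> \<beta>\<^sub>2" "\<beta>\<^sub>2 \<le> 2 * L" "\<beta>\<^sub>2 \<le> 99/100 * K\<^sub>2 * ln (\<theta>\<^sub>2 / (exp 1 * p))"
    and e2: "4 * L \<le> 1/100 * \<theta>\<^sub>2 * s\<^sub>0 * ln (\<theta>\<^sub>2 / (exp 1 * p))"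
    and e3: "192 * real r ^ 4 * Z * L \<le> \<kappa>\<^sup>2 * s\<^sub>0"
    and \<theta>1: "\<theta>\<^sub>1 \<le> 1"
    and KM: "\<And>m :: nat. 3/5 * real m \<le> K\<^sub>2 \<Longrightarrow> real m + 1 \<le> 2/3 * real r"
    and c2: "real n * \<theta>\<^sub>1 ^ r \<le> 1/50"
    and c3: "real r * (4 * L) * \<theta>\<^sub>1 ^ q\<^sub>0 \<le> 1/50"
    and c4: "4 * L * \<theta>\<^sub>2 ^ q\<^sub>0 \<le> 1/50"
    and c5: "K\<^sub>2 * (3/5) ^ q\<^sub>0 \<le> 13/20"
  shows "rsprob (vertex_pairs V) p {E. \<exists>f :: 'a \<Rightarrow> nat. f ` V \<subseteq> {..<k} \<and> clique_coloring V E f} \<le> 4 / real n"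
proof -
  let ?P = "rsprob (vertex_pairs V) p"
  define slow where "slow = \<kappa> * s\<^sub>0"
  have slow: "slow > 0" "slow \<le> s\<^sub>0" using \<kappa> s0 by (auto simp: slow_def mult_left_le_one_le)
  define B1 where "B1 = {E. \<exists>D\<subseteq>V. card D \<le> l \<and> card {v \<in> V. nbrs E v \<inter> D = {}} \<le> y}"
  define B2 where "B2 = {E. \<exists>U\<subseteq>V. slow \<le> real (card U) \<and> (\<exists>D\<subseteq>V - U.
      (\<forall>v\<in>D. \<theta>\<^sub>1 * real (card U) \<le> real (card (nbrs E v \<inter> U))) \<and>
      (4 * L) * real (card U) < (\<Sum>v\<in>D. real (card (nbrs E v \<inter> U))))}"
  define B3 where "B3 = {E. \<exists>U\<subseteq>V. s\<^sub>0 \<le> real (card U) \<and> (\<exists>D\<subseteq>V - U.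
      (\<forall>v\<in>D. \<theta>\<^sub>2 * real (card U) \<le> real (card (nbrs E v \<inter> U))) \<and>
      K\<^sub>2 * real (card U) < (\<Sum>v\<in>D. real (card (nbrs E v \<inter> U))))}"
  define S where "S U = {E. rich V E r (\<kappa> * real (card U)) (1/4) U \<and>
      \<not> (\<exists>Q\<subseteq>U. card Q = r \<and> vertex_pairs Q \<subseteq> E \<and> unextended V E U Q)}" for U
  define B4 where "B4 = {E. \<exists>U\<subseteq>V. s\<^sub>0 \<le> real (card U) \<and> E \<in> S U}"
  have Z1: "Z \<ge> 1" unfolding Z_def by (rule ge_one_powr_ge_zero) (use p in auto)
  have r41: "real r ^ 4 \<ge> 1" using r by simp

  have P1: "?P B1 \<le> 1 / real n"
    unfolding B1_def
    by (rule order_trans[OF prob_few_undominated_le]) (use V p ly in \<open>auto simp: n_def\<close>)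
  have P2: "?P B2 \<le> 1 / real n"
  proof -
    \<comment> \<open>So the logarithm in the exponent is 1, and with \<open>a = 1/2\<close> the
      cost \<open>2 * L\<close> per vertex of \<open>U\<close> is met by
      \<open>4 * L\<close>.\<close>
    have eq: "\<theta>\<^sub>1 / (exp 1 * p) = exp 1" using p by (simp add: \<theta>\<^sub>1_def field_simps flip: exp_add)
    have e4: "4 \<le> exp (2::real)" using exp_lower_Taylor_quadratic[of "2::real"] by simp
    show ?thesis
      unfolding B2_def n_def
    proof (rule prob_dense_to_set_le[where \<beta> = "2 * L" and a = "1/2"])
      show "exp 1 * p \<le> \<theta>\<^sub>1" using p by (simp add: \<theta>\<^sub>1_def)
      show "2 * L \<le> (1 - 1/2) * (4 * L) * ln (\<theta>\<^sub>1 / (exp 1 * p))" using L by (simp add: eq)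
      have "4 * L \<le> 1/2 * 4 * (p * slow)" using e1 unfolding slow_def by linarith
      also have "\<dots> \<le> 1/2 * exp 2 * (p * slow)" using e4 p slow by (intro mult_right_mono) auto
      finally show "4 * ln (real (card V)) \<le> 1/2 * \<theta>\<^sub>1 * slow * ln (\<theta>\<^sub>1 / (exp 1 * p))"
        unfolding eq by (simp add: \<theta>\<^sub>1_def L_def n_def mult_ac)
    qed (use V p slow L \<beta>1 in \<open>auto simp: n_def slow_def\<close>)
  qed
  have P3: "?P B3 \<le> 1 / real n"
    unfolding B3_def n_def
    by (rule prob_dense_to_set_le[where \<beta> = \<beta>\<^sub>2 and a = "1/100"])
       (use V p s0 K2 \<theta>2 \<beta>2 e2 in \<open>auto simp: n_def L_def\<close>)
  have P4: "?P B4 \<le> real (card V) * (1 / real n ^ 2)"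
    unfolding B4_def
  proof (rule rsprob_union_large_sets[where \<beta> = "2 * L"])
    fix U assume U: "U \<subseteq> V" "s\<^sub>0 \<le> real (card U)"
    define s where "s = real (card U)"
    have s: "s \<ge> 1" "s\<^sub>0 \<le> s" using U s0 by (auto simp: s_def)
    have big: "192 * real r ^ 4 * Z * L \<le> \<kappa>\<^sup>2 * s"
      using e3 mult_left_mono[OF s(2), of "\<kappa>\<^sup>2"] by simp
    have "?P (S U) \<le> exp (- (1/4 * (\<kappa> * s)\<^sup>2 / (12 * (real r)^4 * (1 / p) powr (real r / 2))))"
      unfolding S_def s_def
    proof (rule prob_rich_no_clique_le)
      have "(real r)\<^sup>2 * Z \<le> 192 * real r ^ 4 * Z * L"
      proof -
        have "real r ^ 2 \<le> real r ^ 4" using r by (intro power_increasing) auto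
        then have "real r ^ 2 * Z * 1 \<le> (192 * real r ^ 4) * Z * L"
          using Z1 L r41 by (intro mult_mono) auto
        then show ?thesis by simp
      qed
      also have "\<dots> \<le> \<kappa>\<^sup>2 * s" by (rule big)
      also have "\<dots> \<le> \<kappa> * s" using \<kappa> s by (simp add: power2_eq_square mult_left_le_one_le)
      finally show "(real r)\<^sup>2 / (\<kappa> * real (card U)) * (1 / p) powr (real r / 2) \<le> 1"
        using \<kappa> s by (simp add: Z_def s_def field_simps)
      show "0 < \<kappa> * real (card U)" using \<kappa> s by (simp add: s_def)
    qed (use V U p r in auto)
    also have "\<dots> \<le> exp (- (2 * L + s * (2 * L)))"
    proof -
      \<comment> \<open>Origin of \<open>192 = 4 * 48\<close> in \<open>e3\<close>: Janson's
        exponent is \<open>(\<kappa> * s)\<^sup>2 / (48 * r^4 * Z)\<close>. It should reach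
        \<open>4 * L * s\<close>, of which half pays for the union bound over \<open>U\<close> and
        half for the factor \<open>1 / n^2\<close>.\<close>
      have "4 * L * s * (48 * (real r)^4 * Z) \<le> (\<kappa> * s)\<^sup>2"
        using mult_right_mono[OF big, of s] s by (simp add: power2_eq_square mult_ac)
      then have "4 * L * s \<le> 1/4 * (\<kappa> * s)\<^sup>2 / (12 * (real r)^4 * Z)"
        using Z1 r by (simp add: pos_le_divide_eq)
      moreover have "2 * L \<le> 2 * L * s" using L s by simp
      ultimately show ?thesis unfolding Z_def by (simp add: algebra_simps)
    qed
    also have "\<dots> = 1 / real n ^ 2 * exp (- (real (card U) * (2 * L)))"
    proof -
      have "exp (2 * L) = real n ^ 2" using V exp_of_nat_mult[of 2 L] by (simp add: L_def)
      then show ?thesis by (simp add: exp_diff exp_minus s_def field_simps flip: exp_add)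
    qed
    finally show "?P (S U) \<le> 1 / real n ^ 2 * exp (- (real (card U) * (2 * L)))" .
  qed (use V s0 \<beta>2 in \<open>auto simp: n_def\<close>)
  also have "real (card V) * (1 / real n ^ 2) = 1 / real n"
    using V by (simp add: n_def power2_eq_square)
  finally have P4: "?P B4 \<le> 1 / real n" .

  have "{E. \<exists>f :: 'a \<Rightarrow> nat. f ` V \<subseteq> {..<k} \<and> clique_coloring V E f} \<subseteq> (B1 \<union> B2) \<union> (B3 \<union> B4)"
  proof (rule subsetI, rule ccontr)
    fix E assume "E \<in> {E. \<exists>f :: 'a \<Rightarrow> nat. f ` V \<subseteq> {..<k} \<and> clique_coloring V E f}"
      and nB: "E \<notin> (B1 \<union> B2) \<union> (B3 \<union> B4)"
    then obtain f :: "'a \<Rightarrow> nat" where f: "f ` V \<subseteq> {..<k}" "clique_coloring V E f" by auto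
    have "\<not> clique_coloring V E f"
    proof (rule no_clique_coloring_if_sets_contain_unextended_cliques)
      fix D assume D: "D \<subseteq> V" "card D \<le> t * k"
      then have "\<not> card {v \<in> V. nbrs E v \<inter> D = {}} \<le> y" using nB by (auto simp: B1_def l_def)
      then have "\<not> real (card {v \<in> V. nbrs E v \<inter> D = {}}) \<le> real k * s\<^sub>0"
        unfolding y_def by (blast dest: le_nat_floor)
      then show "real k * s\<^sub>0 < real (card {v \<in> V. nbrs E v \<inter> D = {}})" by simp
    next
      fix U assume U: "U \<subseteq> V" "s\<^sub>0 \<le> real (card U)"
        and ex: "\<And>v. v \<in> V - U \<Longrightarrow> \<kappa> * real (card U) \<le> real (card (U - nbrs E v))"
      have cU: "card U > 0" using U s0 by (cases "card U = 0") auto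
      have "rich V E r (\<kappa> * real (card U)) (1/4) U"
      proof (rule rich_if_expanding[where \<theta>\<^sub>1 = \<theta>\<^sub>1 and \<theta>\<^sub>2 = \<theta>\<^sub>2 and K\<^sub>1 = "4 * L" and K\<^sub>2 = K\<^sub>2])
        fix W D assume W: "W \<subseteq> U" "\<kappa> * real (card U) \<le> real (card W)" "D \<subseteq> V - W"
          "\<And>v. v \<in> D \<Longrightarrow> \<theta>\<^sub>1 * real (card W) \<le> real (card (nbrs E v \<inter> W))"
        have "slow \<le> real (card W)"
          using order_trans[OF mult_left_mono[OF U(2), of \<kappa>] W(2)] \<kappa>(1) by (simp add: slow_def)
        moreover have "E \<notin> B2" "W \<subseteq> V" using nB W U by auto
        ultimately have "\<not> (4 * L) * real (card W) < (\<Sum>v\<in>D. real (card (nbrs E v \<inter> W)))"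
          using W(3,4) unfolding B2_def by blast
        then show "(\<Sum>v\<in>D. real (card (nbrs E v \<inter> W))) \<le> 4 * L * real (card W)" by simp
      next
        fix D assume D: "D \<subseteq> V - U" "\<And>v. v \<in> D \<Longrightarrow> \<theta>\<^sub>2 * real (card U) \<le> real (card (nbrs E v \<inter> U))"
        have "E \<notin> B3" using nB by auto
        then have "\<not> K\<^sub>2 * real (card U) < (\<Sum>v\<in>D. real (card (nbrs E v \<inter> U)))"
          using D U unfolding B3_def by blast
        then show "(\<Sum>v\<in>D. real (card (nbrs E v \<inter> U))) \<le> K\<^sub>2 * real (card U)" by simp
      next
        have "50 * (real r)\<^sup>2 \<le> 192 * real r ^ 4 * Z * L"
        proof -
          have "real r ^ 2 \<le> real r ^ 4" using r by (intro power_increasing) auto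
          then have "(50 * real r ^ 2) * 1 * 1 \<le> (192 * real r ^ 4) * Z * L"
            using Z1 L r41 by (intro mult_mono) auto
          then show ?thesis by simp
        qed
        also have "\<dots> \<le> \<kappa>\<^sup>2 * s\<^sub>0" by (rule e3)
        also have "\<dots> \<le> \<kappa>\<^sup>2 * real (card U)" using U by (intro mult_left_mono) auto
        also have "\<dots> \<le> \<kappa> * real (card U)" using \<kappa> by (simp add: power2_eq_square mult_left_le_one_le)
        finally show "(real r)\<^sup>2 / (\<kappa> * real (card U)) \<le> 1/50"
          using \<kappa> cU by (simp add: field_simps)
      next
        have "0 < exp 1 * p" using p by simp
        then show "0 < \<theta>\<^sub>2" using \<theta>2 by linarith
      qed (use V U cU \<kappa> ex p \<theta>1 \<theta>2 L K2 KM c2 c3 c4 c5 in \<open>auto simp: n_def \<theta>\<^sub>1_def q\<^sub>0_def\<close>)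
      moreover have "E \<notin> S U" using nB U by (auto simp: B4_def)
      ultimately show "\<exists>Q\<subseteq>U. card Q = r \<and> vertex_pairs Q \<subseteq> E \<and> unextended V E U Q"
        unfolding S_def by blast
    qed (use V r \<kappa> s0 f in \<open>auto simp: n_def\<close>)
    with f show False by simp
  qed
  then have "?P {E. \<exists>f :: 'a \<Rightarrow> nat. f ` V \<subseteq> {..<k} \<and> clique_coloring V E f} \<le> ?P ((B1 \<union> B2) \<union> (B3 \<union> B4))"
    by (rule measure_pmf.finite_measure_mono) auto
  also have "\<dots> \<le> ?P (B1 \<union> B2) + ?P (B3 \<union> B4)" by (rule measure_Un_le) auto
  also have "\<dots> \<le> (?P B1 + ?P B2) + (?P B3 + ?P B4)" by (intro add_mono measure_Un_le) auto
  also have "\<dots> \<le> 4 / real n" using P1 P2 P3 P4 by simp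
  finally show ?thesis .
qed

text \<open>Colouring by the first neighbour in a fixed set of \<open>m\<close> vertices fails only
  if some vertex has no neighbour there. The exponent is \<open>m - 1\<close> because a vertex of
  the set itself has only \<open>m - 1\<close> candidates.\<close>

lemma prob_not_clique_colorable_le:
  assumes V: "finite V" "m \<le> card V" and p: "0 \<le> p" "p \<le> 1"
  shows "rsprob (vertex_pairs V) p {E. \<not> (\<exists>f :: 'a \<Rightarrow> nat. f ` V \<subseteq> {..<m} \<and> clique_coloring V E f)}
    \<le> real (card V) * (1 - p) ^ (m - 1)"
proof -
  obtain D where D: "D \<subseteq> V" "card D = m" using obtain_subset_with_card_n[OF V(2)] by auto
  have finD: "finite D" using D V finite_subset by auto
  obtain g where g: "bij_betw g {..<m} D"
    using ex_bij_betw_nat_finite[OF finD] D by (auto simp: atLeast0LessThan)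
  let ?B = "\<lambda>v. (\<lambda>d. {v, d}) ` (D - {v})"
  let ?S = "{E. \<not> (\<exists>f :: 'a \<Rightarrow> nat. f ` V \<subseteq> {..<m} \<and> clique_coloring V E f)}"
  have "rsprob (vertex_pairs V) p ?S \<le> rsprob (vertex_pairs V) p (\<Union>v\<in>V. {E. ?B v \<inter> E = {}})"
  proof (rule rsprob_mono)
    fix E assume E: "E \<subseteq> vertex_pairs V" and not: "E \<in> ?S"
    show "E \<in> (\<Union>v\<in>V. {E. ?B v \<inter> E = {}})"
    proof (rule ccontr)
      assume "\<not> ?thesis"
      then have "\<exists>d\<in>D. d \<in> nbrs E v" if "v \<in> V" for v using that unfolding nbrs_def by blast
      then have ex: "\<exists>i<m. g i \<in> nbrs E v" if "v \<in> V" for v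
        using that g unfolding bij_betw_def by blast
      define f where "f v = (LEAST i. i < m \<and> g i \<in> nbrs E v)" for v
      have f: "f v < m" "g (f v) \<in> nbrs E v" if "v \<in> V" for v
        using LeastI_ex[OF ex[OF that]] by (auto simp: f_def)
      have "clique_coloring V E f"
        unfolding clique_coloring_def
      proof (intro allI impI notI)
        fix K assume K: "maximal_clique V E K \<and> 2 \<le> card K" and "monochromatic f K"
        then obtain a where a: "\<And>v. v \<in> K \<Longrightarrow> f v = a" by (auto simp: monochromatic_def)
        have KV: "K \<subseteq> V" and cl: "clique V E K" using K by (auto simp: maximal_clique_def clique_def)
        obtain v where v: "v \<in> K" using K by fastforce
        have adj: "g a \<in> nbrs E x" if "x \<in> K" for x using f(2)[of x] a[OF that] KV that by auto
        have "g a \<in> V" using adj[OF v] E doubleton_in_vertex_pairs[of v "g a" V] by (auto simp: nbrs_def)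
        moreover have "{g a, x} \<in> E \<and> {x, g a} \<in> E" if "x \<in> K" for x
          using adj[OF that] by (simp add: nbrs_def insert_commute)
        \<comment> \<open>By maximality the common neighbour \<open>g a\<close> would lie in
          \<open>K\<close> and be adjacent to itself, but there are no loops.\<close>
        ultimately have "clique V E (insert (g a) K)" using cl by (auto simp: clique_def)
        then have "insert (g a) K = K" using K by (auto simp: maximal_clique_def)
        then have "g a \<in> K" by auto
        then have "{g a, g a} \<in> E" using adj[of "g a"] by (simp add: nbrs_def)
        then show False using E doubleton_in_vertex_pairs[of "g a" "g a" V] by auto
      qed
      moreover have "f ` V \<subseteq> {..<m}" using f by auto
      ultimately show False using not by blast
    qed
  qed (use V in \<open>simp add: finite_vertex_pairs\<close>)
  also have "\<dots> \<le> (\<Sum>v\<in>V. rsprob (vertex_pairs V) p {E. ?B v \<inter> E = {}})"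
    by (rule rsprob_UN_le[OF V(1)])
  also have "\<dots> \<le> (\<Sum>v\<in>V. (1 - p) ^ (m - 1))"
  proof (rule sum_mono)
    fix v assume v: "v \<in> V"
    have "?B v \<subseteq> vertex_pairs V" using v D by (auto simp: doubleton_in_vertex_pairs)
    then have "rsprob (vertex_pairs V) p {E. ?B v \<inter> E = {}} = (1 - p) ^ card (?B v)"
      using V p by (intro rsprob_disjoint) (auto simp: finite_vertex_pairs)
    also have "card (?B v) = card (D - {v})"
      by (rule card_image) (auto simp: inj_on_def doubleton_eq_iff)
    also have "(1 - p) ^ card (D - {v}) \<le> (1 - p) ^ (m - 1)"
      using p D finD by (intro power_decreasing) (auto simp: card_Diff_singleton_if)
    finally show "rsprob (vertex_pairs V) p {E. ?B v \<inter> E = {}} \<le> (1 - p) ^ (m - 1)" .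
  qed
  finally show ?thesis by simp
qed

text \<open>Every quantity is written as an exponential in \<open>L\<close> and \<nu>. The bound
  \<open>\<nu> \<ge> 100\<close> lets constants such as \<open>exp 2\<close> be absorbed into small
  powers of \<open>p\<close>, and \<open>e \<le> 1/100\<close> keeps the losses of small powers of
  \<open>n\<close> away from the numerical margins.\<close>

lemma prob_few_colors_le:
  fixes n r t :: nat and p e L \<nu> :: real
  assumes n: "n \<ge> 2" and p: "0 < p" and L_def: "L = ln (real n)" and \<nu>_def: "\<nu> = - ln p"
    and e: "0 < e" "e \<le> 1/100" and t: "8 / e < real t" and r: "r \<ge> 3"
    and F2: "real r * \<nu> \<le> 2 * L" and F3: "L \<le> real r * \<nu>"
    and F4: "(1 + real r / 2) * \<nu> \<le> (1 - e) * L" and F5: "real n * (exp 2 * p) ^ r \<le> 1/50"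
    and F6: "\<nu> \<ge> 100"
    and L: "L \<ge> 1" "exp (L / 10) \<ge> 400 * L" "exp (5/8 * e * L) \<ge> 3072 * L ^ 5" "exp (e / 16 * L) \<ge> 6 * L\<^sup>2"
      "400 * L\<^sup>2 \<le> exp (3/10 * L)" "200 * L \<le> exp (L / 300)"
  shows "rsprob (vertex_pairs {1..n}) p
     {E. \<exists>f :: nat \<Rightarrow> nat. f ` {1..n} \<subseteq> {..<nat \<lfloor>e / (32 * real t) * (L / p)\<rfloor>} \<and> clique_coloring {1..n} E f}
     \<le> 4 / real n"
proof -
  \<comment> \<open>This is \<open>n powr (- e / 8)\<close>; as \<open>t > 8 / e\<close>,
    \<open>t\<close> such factors bring \<open>n\<close> below 1.\<close>
  define \<kappa> where "\<kappa> = exp (- (e / 8 * L))"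
  \<comment> \<open>This is \<open>p * n powr (1 - e / 8)\<close>. Then \<open>k * s\<^sub>0\<close>
    is at most \<open>L * n powr (1 - e / 8)\<close>, which is below the order
    \<open>n powr (1 - e / 16)\<close> of the number of undominated vertices.\<close>
  define s\<^sub>0 where "s\<^sub>0 = exp ((1 - e / 8) * L - \<nu>)"
  \<comment> \<open>This is \<open>p powr (1/100)\<close>: small enough for its powers to beat
    \<open>L\<close>, yet \<open>ln (\<theta>\<^sub>2 / (exp 1 * p))\<close> retains almost all of
    \<nu>.\<close>
  define \<theta>\<^sub>2 where "\<theta>\<^sub>2 = exp (- (\<nu> / 100))"
  \<comment> \<open>About \<open>\<beta>\<^sub>2 / \<nu>\<close>, because
    \<open>L \<le> r * \<nu>\<close>. The factor \<open>21/20\<close> covers all losses, as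
    \<open>99/100 * 21/20 * 98/100 > 101/100\<close>.\<close>
  define K\<^sub>2 where "K\<^sub>2 = 21/20 * (1 + e / 8 * real r)"
  define \<beta>\<^sub>2 where "\<beta>\<^sub>2 = 1 + e / 8 * L + \<nu>"
  define k where "k = nat \<lfloor>e / (32 * real t) * (L / p)\<rfloor>"
  define q\<^sub>0 where "q\<^sub>0 = (r + 2) div 3"
  have nL: "real n = exp L" using n by (simp add: L_def)
  have p\<nu>: "p = exp (- \<nu>)" using p by (simp add: \<nu>_def)
  have p1: "p < 1" using F6 by (simp add: p\<nu>)
  have t0: "t > 0" using t e by (cases "t = 0") auto
  \<comment> \<open>\<open>r \<ge> 3\<close> and \<open>F4\<close> yield
    \<open>p \<ge> n powr (-2/5)\<close>, so that \<open>n p^2\<close> is still a power of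
    \<open>n\<close>.\<close>
  have "(1 + 3 / 2) * \<nu> \<le> (1 + real r / 2) * \<nu>" using r F6 by (intro mult_right_mono) auto
  also have "\<dots> \<le> 1 * L" using F4 mult_right_mono[of "1 - e" 1 L] L e by linarith
  finally have \<nu>L: "\<nu> \<le> 2/5 * L" by simp
  define x where "x = e * L"
  have eL: "0 \<le> x" "x \<le> L / 100"
    using e L mult_right_mono[of e "1/100" L] by (auto simp: x_def)
  have ex: "(1 - e / 4) * L = L - x / 4" "(1 - e / 8) * L = L - x / 8" "(1 - e / 16) * L = L - x / 16"
    "e / 8 * L = x / 8" "e * L = x" by (simp_all add: x_def algebra_simps)
  have "real r * 1 \<le> real r * \<nu>" using F6 by (intro mult_left_mono) auto
  with F2 have rL: "real r \<le> 2 * L" by simp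
  have q0: "real r \<le> 3 * real q\<^sub>0" "q\<^sub>0 \<ge> 1" using r by (auto simp: q\<^sub>0_def)
  have L'eq: "ln (\<theta>\<^sub>2 / (exp 1 * p)) = 99/100 * \<nu> - 1"
    by (simp add: \<theta>\<^sub>2_def p\<nu> ln_div flip: exp_add)
  have L'1: "98/100 * \<nu> \<le> ln (\<theta>\<^sub>2 / (exp 1 * p))" "1 \<le> ln (\<theta>\<^sub>2 / (exp 1 * p))"
    unfolding L'eq using F6 by auto
  have pks: "400 * L \<le> p * (\<kappa> * s\<^sub>0)"
  proof -
    have "400 * L \<le> exp (L / 10)" by (rule L)
    also have "\<dots> \<le> exp ((1 - e / 4) * L - 2 * \<nu>)" using \<nu>L eL L(1) by (simp add: ex)
    also have "\<dots> = p * (\<kappa> * s\<^sub>0)" by (simp add: p\<nu> \<kappa>_def s\<^sub>0_def algebra_simps flip: exp_add)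
    finally show ?thesis .
  qed
  have ps0: "400 * L \<le> p * s\<^sub>0"
  proof -
    have "p * (\<kappa> * s\<^sub>0) \<le> p * (1 * s\<^sub>0)"
      using p e L by (intro mult_left_mono mult_right_mono) (auto simp: \<kappa>_def s\<^sub>0_def)
    with pks show ?thesis by simp
  qed
  have e32: "e / (32 * real t) * (L / p) \<ge> 0" using e L p by auto
  have kle: "real k \<le> e / (32 * real t) * (L / p)" unfolding k_def using of_nat_floor[OF e32] by simp
  have tk: "real (t * k) \<le> e / 32 * (L / p)"
    using mult_left_mono[OF kle, of "real t"] t0 by simp
  have pk: "p * real (t * k) \<le> e / 32 * L"
    using mult_left_mono[OF tk, of p] p by simp
  define y where "y = nat \<lfloor>real k * s\<^sub>0\<rfloor>"
  define a where "a = exp ((1 - e / 8) * L)"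
  have a1: "a \<ge> 1" using e L by (simp add: a_def)
  have yle: "real y \<le> L * a"
  proof -
    have "real y \<le> real k * s\<^sub>0" unfolding y_def using of_nat_floor[of "real k * s\<^sub>0"] by (simp add: s\<^sub>0_def)
    also have "\<dots> \<le> e / (32 * real t) * (L / p) * s\<^sub>0" using kle by (intro mult_right_mono) (auto simp: s\<^sub>0_def)
    also have "s\<^sub>0 = p * a" by (simp add: s\<^sub>0_def a_def p\<nu> algebra_simps flip: exp_add)
    also have "e / (32 * real t) * (L / p) * (p * a) = e / (32 * real t) * (L * a)" using p by simp
    also have "\<dots> \<le> 1 * (L * a)"
      using e t0 L a1 by (intro mult_right_mono) (auto simp: divide_simps)
    finally show ?thesis by simp
  qed
  have lle: "real (t * k) \<le> L * a"
  proof -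
    have "real (t * k) \<le> e / 32 * (L / p)" by (rule tk)
    also have "\<dots> \<le> 1 * (L / p)" using e L p by (intro mult_right_mono) auto
    also have "L / p = L * exp \<nu>" by (simp add: p\<nu> exp_minus field_simps)
    also have "1 * (L * exp \<nu>) \<le> L * a" using \<nu>L eL L(1) by (simp add: a_def ex)
    finally show ?thesis .
  qed
  define N where "N = t * k + y"
  have Nle: "real N \<le> 2 * L * a" using yle lle by (simp add: N_def)
  have NL: "real N * L + L \<le> exp ((1 - e / 16) * L) / 2"
  proof -
    have "real N * L + L \<le> 2 * L * a * L + L * (L * a)"
    proof (rule add_mono)
      show "real N * L \<le> 2 * L * a * L" using Nle L by (intro mult_right_mono) auto
      have "L * 1 \<le> L * (L * a)" using L a1 mult_mono[of 1 L 1 a] by (intro mult_left_mono) auto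
      then show "L \<le> L * (L * a)" by simp
    qed
    also have "\<dots> = 6 * L\<^sup>2 * a / 2" by (simp add: power2_eq_square)
    also have "\<dots> \<le> exp (e / 16 * L) * a / 2" using L a1 by (intro divide_right_mono mult_right_mono) auto
    also have "exp (e / 16 * L) * a = exp ((1 - e / 16) * L)" by (simp add: a_def algebra_simps flip: exp_add)
    finally show ?thesis .
  qed
  have N2: "real N \<le> real n / 2"
  proof -
    have "real N * 1 \<le> real N * L" using L by (intro mult_left_mono) auto
    moreover have "exp ((1 - e / 16) * L) \<le> exp L" using eL by (simp add: ex)
    ultimately show ?thesis using NL L(1) unfolding nL by linarith
  qed
  have "rsprob (vertex_pairs {1..n}) p
     {E. \<exists>f :: nat \<Rightarrow> nat. f ` {1..n} \<subseteq> {..<k} \<and> clique_coloring {1..n} E f}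
     \<le> 4 / real (card {1..n})"
  proof (rule prob_clique_colorable_le[where \<kappa> = \<kappa> and s\<^sub>0 = s\<^sub>0 and \<theta>\<^sub>2 = \<theta>\<^sub>2 and K\<^sub>2 = K\<^sub>2 and
      \<beta>\<^sub>2 = \<beta>\<^sub>2 and r = r and t = t and k = k], unfold card_atLeastAtMost diff_Suc_1 Suc_eq_plus1 diff_add_inverse2
      L_def[symmetric] q\<^sub>0_def[symmetric] y_def[symmetric])
    show "0 < \<kappa>" "\<kappa> \<le> 1" using e L(1) by (auto simp: \<kappa>_def)
    show "\<kappa> ^ t * real n < 1"
    proof -
      have "1 * L < real t * (e / 8) * L"
        using t e L by (intro mult_strict_right_mono) (auto simp: field_simps)
      then show ?thesis unfolding \<kappa>_def nL by (simp add: algebra_simps flip: exp_of_nat_mult exp_add)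
    qed
    show "1 \<le> s\<^sub>0" using \<nu>L eL L(1) by (simp add: s\<^sub>0_def ex)
    have "real N \<le> real n" using N2 by simp
    then have "N \<le> n" by (simp only: of_nat_le_iff)
    then show "t * k \<le> n" "y \<le> n" by (simp_all add: N_def)
    show "real n ^ (t * k + y) * exp (- ((1 - p) ^ (t * k) * (real n - real (t * k) - real y))) \<le> 1 / real n"
    proof -
      \<comment> \<open>From \<open>1 - p \<ge> exp (- 2 * p)\<close> and
        \<open>p * (t * k) \<le> e / 32 * L\<close>; the latter is why the number of colours carries
        the constant \<open>e / (32 * t)\<close>.\<close>
      have "exp (- (e / 16 * L)) \<le> (1 - p) ^ (t * k)"
      proof -
        have ph: "p \<le> 1/2"
        proof -
          have "p \<le> exp (- 1)" using F6 by (simp add: p\<nu>)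
          also have "\<dots> \<le> 1/2" using exp_ge_add_one_self[of 1] by (simp add: exp_minus field_simps)
          finally show ?thesis .
        qed
        have "exp (- (e / 16 * L)) \<le> exp (- (2 * p * real (t * k)))" using pk by simp
        also have "\<dots> = exp (- 2 * p) ^ (t * k)" by (simp add: mult_ac flip: exp_of_nat_mult)
        also have "\<dots> \<le> (1 - p) ^ (t * k)"
        proof (rule power_mono)
          have "- p - 2 * p\<^sup>2 \<le> ln (1 - p)" by (rule ln_one_minus_pos_lower_bound) (use p ph in auto)
          moreover have "2 * p\<^sup>2 \<le> p" using p ph by (simp add: power2_eq_square)
          ultimately have "exp (- 2 * p) \<le> exp (ln (1 - p))" by (simp only: exp_le_cancel_iff)
          then show "exp (- 2 * p) \<le> 1 - p" using p1 by simp
        qed simp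
        finally show ?thesis .
      qed
      then have "exp (- (e / 16 * L)) * (real n / 2) \<le> (1 - p) ^ (t * k) * (real n - real (t * k) - real y)"
        using N2 p1 by (intro mult_mono) (auto simp: N_def)
      moreover have "exp (- (e / 16 * L)) * (real n / 2) = exp ((1 - e / 16) * L) / 2"
        by (simp add: nL algebra_simps flip: exp_add)
      ultimately have "real N * L + L \<le> (1 - p) ^ (t * k) * (real n - real (t * k) - real y)"
        using NL by linarith
      then have "exp (real N * L) * exp (- ((1 - p) ^ (t * k) * (real n - real (t * k) - real y))) \<le> exp (- L)"
        by (simp flip: exp_add)
      then show ?thesis by (simp add: nL N_def exp_minus inverse_eq_divide flip: exp_of_nat_mult)
    qed
    show "1 + ln (real n / (\<kappa> * s\<^sub>0)) \<le> 2 * L"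
      using \<nu>L eL L(1) by (simp add: nL \<kappa>_def s\<^sub>0_def ln_div ln_mult ex)
    show "2 * L \<le> p * (\<kappa> * s\<^sub>0)" using pks L by linarith
    show "exp 1 * p \<le> \<theta>\<^sub>2" using F6 by (simp add: p\<nu> \<theta>\<^sub>2_def flip: exp_add)
    show "\<theta>\<^sub>2 \<le> 3/5"
    proof -
      have "\<theta>\<^sub>2 \<le> exp (- 1)" using F6 by (simp add: \<theta>\<^sub>2_def)
      also have "\<dots> \<le> 1/2" using exp_ge_add_one_self[of 1] by (simp add: exp_minus field_simps)
      finally show ?thesis by simp
    qed
    show "0 \<le> K\<^sub>2" using e by (simp add: K\<^sub>2_def)
    show "1 + ln (real n / s\<^sub>0) \<le> \<beta>\<^sub>2" by (simp add: nL s\<^sub>0_def \<beta>\<^sub>2_def ln_div algebra_simps)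
    show "\<beta>\<^sub>2 \<le> 2 * L" using \<nu>L eL L(1) by (simp add: \<beta>\<^sub>2_def ex)
    show "\<beta>\<^sub>2 \<le> 99/100 * K\<^sub>2 * ln (\<theta>\<^sub>2 / (exp 1 * p))"
    proof -
      have "e / 8 * L \<le> e / 8 * (real r * \<nu>)" using F3 e by (intro mult_left_mono) auto
      then have "\<beta>\<^sub>2 \<le> 1 + (1 + e / 8 * real r) * \<nu>" by (simp add: \<beta>\<^sub>2_def algebra_simps)
      also have "\<dots> \<le> (1 + e / 8 * real r) * \<nu> + 1/100 * ((1 + e / 8 * real r) * \<nu>)"
      proof -
        have "1 * 100 \<le> (1 + e / 8 * real r) * \<nu>" using e F6 by (intro mult_mono) auto
        then show ?thesis by linarith
      qed
      also have "\<dots> \<le> 99/100 * (21/20) * (98/100) * ((1 + e / 8 * real r) * \<nu>)"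
      proof -
        have "0 \<le> (1 + e / 8 * real r) * \<nu>" using e F6 by auto
        then show ?thesis by linarith
      qed
      also have "\<dots> = 99/100 * K\<^sub>2 * (98/100 * \<nu>)" by (simp add: K\<^sub>2_def)
      also have "\<dots> \<le> 99/100 * K\<^sub>2 * ln (\<theta>\<^sub>2 / (exp 1 * p))"
        by (rule mult_left_mono[OF L'1(1)]) (use e in \<open>simp add: K\<^sub>2_def\<close>)
      finally show ?thesis .
    qed
    show "4 * L \<le> 1/100 * \<theta>\<^sub>2 * s\<^sub>0 * ln (\<theta>\<^sub>2 / (exp 1 * p))"
    proof -
      have "p * s\<^sub>0 \<le> \<theta>\<^sub>2 * s\<^sub>0" using F6 by (intro mult_right_mono) (auto simp: p\<nu> \<theta>\<^sub>2_def s\<^sub>0_def)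
      with ps0 have "4 * L * 1 \<le> 1/100 * \<theta>\<^sub>2 * s\<^sub>0 * 1" by simp
      also have "\<dots> \<le> 1/100 * \<theta>\<^sub>2 * s\<^sub>0 * ln (\<theta>\<^sub>2 / (exp 1 * p))"
        by (rule mult_left_mono[OF L'1(2)]) (auto simp: \<theta>\<^sub>2_def s\<^sub>0_def)
      finally show ?thesis by simp
    qed
    show "192 * real r ^ 4 * (1 / p) powr (real r / 2) * L \<le> \<kappa>\<^sup>2 * s\<^sub>0"
    proof -
      \<comment> \<open>\<open>\<kappa>\<^sup>2 * s\<^sub>0\<close> equals
        \<open>p * n powr (1 - 3/8 * e)\<close>, so \<open>F4\<close> leaves a factor
        \<open>n powr (5/8 * e)\<close> to absorb the polynomial in \<open>L\<close>, where
        \<open>3072 = 192 * 2^4\<close>.\<close>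
      have "real r ^ 4 \<le> (2 * L) ^ 4" using rL by (intro power_mono) auto
      then have "192 * real r ^ 4 * L \<le> 192 * (2 * L) ^ 4 * L" using L by (intro mult_right_mono) auto
      also have "\<dots> = 3072 * L ^ 5" by (simp add: power_mult_distrib power_numeral_reduce)
      also have "\<dots> \<le> exp (5/8 * e * L)" by (rule L)
      finally have "192 * real r ^ 4 * L * exp (real r / 2 * \<nu>) \<le> exp (5/8 * e * L) * exp (real r / 2 * \<nu>)"
        by (intro mult_right_mono) auto
      also have "\<dots> \<le> exp ((1 - 3/8 * e) * L - \<nu>)"
        using F4 by (simp add: algebra_simps flip: exp_add)
      also have "\<dots> = \<kappa>\<^sup>2 * s\<^sub>0" by (simp add: \<kappa>_def s\<^sub>0_def power2_eq_square algebra_simps flip: exp_add)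
      finally show ?thesis using p by (simp add: powr_def ln_div \<nu>_def mult_ac)
    qed
    show "exp 2 * p \<le> 1" using F6 by (simp add: p\<nu> flip: exp_add)
    show "real m + 1 \<le> 2/3 * real r" if m: "3/5 * real m \<le> K\<^sub>2" for m :: nat
    proof -
      have "e / 8 * real r \<le> 1/800 * real r" using e by (intro mult_right_mono) auto
      then have *: "real m \<le> 7/4 + 7/4 * (1/800 * real r)" using m by (simp add: K\<^sub>2_def)
      \<comment> \<open>The claim is tight at \<open>r = 3\<close>, \<open>m = 1\<close>. For small
        \<open>r\<close> it relies on \<open>m\<close> being an integer, as \<open>m < 2\<close>
        gives \<open>m \<le> 1\<close>.\<close>
      show ?thesis
      proof (cases "r \<le> 100")
        case True
        then have "real m < 2" using * by (simp add: field_simps)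
        then have "m \<le> 1" by simp
        then show ?thesis using r by simp
      next
        case False
        then show ?thesis using * by (simp add: field_simps)
      qed
    qed
    show "real n * (exp 2 * p) ^ r \<le> 1/50" by (rule F5)
    \<comment> \<open>That is, \<open>p ^ q\<^sub>0\<close> is at most
      \<open>n powr (-1/3)\<close>.\<close>
    have rq: "L / 3 \<le> \<nu> * real q\<^sub>0"
    proof -
      have "real r * \<nu> \<le> 3 * real q\<^sub>0 * \<nu>" using q0(1) F6 by (intro mult_right_mono) auto
      with F3 show ?thesis by (simp add: mult.commute)
    qed
    show "real r * (4 * L) * (exp 2 * p) ^ q\<^sub>0 \<le> 1/50"
    proof -
      have "(exp 2 * p) ^ q\<^sub>0 = exp (real q\<^sub>0 * (2 - \<nu>))" by (simp add: p\<nu> flip: exp_of_nat_mult exp_add)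
      also have "\<dots> \<le> exp (- (3/10 * L))"
      proof -
        have "real q\<^sub>0 * (2 - \<nu>) \<le> real q\<^sub>0 * (- (98/100 * \<nu>))" using F6 by (intro mult_left_mono) auto
        also have "\<dots> = - (98/100) * (\<nu> * real q\<^sub>0)" by simp
        also have "\<dots> \<le> - (3/10 * L)" using rq L(1) by linarith
        finally show ?thesis by simp
      qed
      finally have "real r * (4 * L) * (exp 2 * p) ^ q\<^sub>0 \<le> (2 * L) * (4 * L) * exp (- (3/10 * L))"
        using rL L p by (intro mult_mono) auto
      also have "\<dots> \<le> 1/50" using L(5) by (simp add: exp_minus field_simps power2_eq_square)
      finally show ?thesis .
    qed
    show "4 * L * \<theta>\<^sub>2 ^ q\<^sub>0 \<le> 1/50"
    proof -
      have "\<theta>\<^sub>2 ^ q\<^sub>0 = exp (- (\<nu> * real q\<^sub>0 / 100))" by (simp add: \<theta>\<^sub>2_def mult_ac flip: exp_of_nat_mult)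
      also have "\<dots> \<le> exp (- (L / 300))" using rq by simp
      finally have "4 * L * \<theta>\<^sub>2 ^ q\<^sub>0 \<le> 4 * L * exp (- (L / 300))" using L by (intro mult_left_mono) auto
      also have "\<dots> \<le> 1/50" using L(6) by (simp add: exp_minus field_simps)
      finally show ?thesis .
    qed
    show "K\<^sub>2 * (3/5) ^ q\<^sub>0 \<le> 13/20"
    proof -
      have "e / 8 * real r \<le> 1/800 * (3 * real q\<^sub>0)" using e q0 by (intro mult_mono) auto
      then have "K\<^sub>2 \<le> 21/20 * (1 + real q\<^sub>0 * (1/200))" by (simp add: K\<^sub>2_def)
      \<comment> \<open>The linear growth of \<open>K\<^sub>2\<close> in \<open>r\<close> is
        swallowed by a power barely above 1. The worst case is then \<open>q\<^sub>0 = 1\<close>,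
        with \<open>21/20 * 603/1000 < 13/20\<close>.\<close>
      also have "\<dots> \<le> 21/20 * (1 + 1/200) ^ q\<^sub>0"
        by (intro mult_left_mono Bernoulli_inequality) auto
      finally have "K\<^sub>2 * (3/5) ^ q\<^sub>0 \<le> 21/20 * (1 + 1/200) ^ q\<^sub>0 * (3/5) ^ q\<^sub>0" by (intro mult_right_mono) auto
      also have "\<dots> = 21/20 * (603/1000) ^ q\<^sub>0" by (simp flip: power_mult_distrib)
      also have "\<dots> \<le> 21/20 * (603/1000) ^ 1" using q0 by (intro mult_left_mono power_decreasing) auto
      finally show ?thesis by simp
    qed
  qed (use n p p1 r L in auto)
  then show ?thesis by (simp add: k_def)
qed

section \<open>Asymptotics\<close>

lemma clique_chromatic_number_le_iff:
  assumes "finite V"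
  shows "clique_chromatic_number V E \<le> k \<longleftrightarrow> (\<exists>f :: 'a \<Rightarrow> nat. f ` V \<subseteq> {..<k} \<and> clique_coloring V E f)"
proof
  assume le: "clique_chromatic_number V E \<le> k"
  obtain f :: "'a \<Rightarrow> nat" where f: "f ` V \<subseteq> {..<clique_chromatic_number V E}" "clique_coloring V E f"
    using LeastI_ex[OF ex_clique_coloring[OF assms, of E]] unfolding clique_chromatic_number_def by blast
  then have "f ` V \<subseteq> {..<k}" using le by fastforce
  with f show "\<exists>f :: 'a \<Rightarrow> nat. f ` V \<subseteq> {..<k} \<and> clique_coloring V E f" by blast
next
  assume "\<exists>f :: 'a \<Rightarrow> nat. f ` V \<subseteq> {..<k} \<and> clique_coloring V E f"
  then show "clique_chromatic_number V E \<le> k"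
    unfolding clique_chromatic_number_def by (rule Least_le)
qed

text \<open>
  Cliques of size \<open>r\<close> have the right order: a typical one has no common neighbour since
  \<open>n p^r\<close> is small, while the clique count in a set of \<open>n p\<close> vertices is concentrated since
  \<open>n p powr (1 + r/2)\<close> is a positive power of \<open>n\<close>.
\<close>

definition suitable_clique_size :: "real \<Rightarrow> nat \<Rightarrow> real \<Rightarrow> nat \<Rightarrow> bool" where
  "suitable_clique_size e n p r \<longleftrightarrow> r \<ge> 3 \<and> real r * - ln p \<le> 2 * ln (real n) \<and>
     ln (real n) \<le> real r * - ln p \<and> (1 + real r / 2) * - ln p \<le> (1 - e) * ln (real n) \<and>
     real n * (exp 2 * p) ^ r \<le> 1/50"

text \<open>For \<open>r = 3\<close> the factor \<open>1 + r / 2 = 5/2\<close> matches the exponent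
  \<open>-2/5\<close>, and \<open>n p^3\<close> small matches \<open>-1/3\<close>. The constant
  \<open>1/40\<close> makes room for \<open>exp 2 ^ 3\<close>, since
  \<open>9^3 / 40^3 < 1/50\<close>.\<close>

lemma suitable_clique_size_sparse:
  assumes n: "n \<ge> 2" and p: "p > 0" and lb: "real n powr (-2/5 + e) \<le> p" and ub: "p \<le> 1/40 * real n powr (-1/3)"
    and e: "e > 0"
  shows "suitable_clique_size e n p 3"
proof -
  define L where "L = ln (real n)"
  have L0: "L > 0" using n by (simp add: L_def)
  have "ln (real n powr (-2/5 + e)) \<le> ln p" using lb n p by (intro ln_mono) auto
  then have 1: "(-2/5 + e) * L \<le> ln p" using n by (simp add: L_def ln_powr)
  have "ln p \<le> ln (real n powr (-1/3))" using ub n p by (intro ln_mono) auto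
  then have 2: "ln p \<le> -1/3 * L" using n by (simp add: L_def ln_powr)
  have eL: "e * L > 0" using e L0 by simp
  have "p ^ 3 \<le> (1/40 * real n powr (-1/3)) ^ 3" using ub p by (intro power_mono) auto
  also have "\<dots> = 1/64000 * (real n powr (-1/3)) ^ 3" by (simp add: power_divide)
  also have "(real n powr (-1/3)) ^ 3 = 1 / real n"
  proof -
    have "(real n powr (-1/3)) ^ 3 = (real n powr (-1/3)) powr real 3"
      using n by (intro powr_realpow[symmetric]) auto
    also have "\<dots> = real n powr - 1" by (simp only: powr_powr) simp
    finally show ?thesis using n by (simp add: powr_minus_divide)
  qed
  finally have p3: "p ^ 3 * real n \<le> 1/64000" using n by (simp add: field_simps)
  have "exp (2::real) ^ 3 \<le> 9 ^ 3"
  proof (rule power_mono)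
    have "exp (2::real) = exp 1 ^ 2" by (simp flip: exp_of_nat_mult)
    also have "\<dots> \<le> 3 ^ 2" by (intro power_mono exp_le) auto
    finally show "exp (2::real) \<le> 9" by simp
  qed simp
  then have "exp 2 ^ 3 * (p ^ 3 * real n) \<le> 9 ^ 3 * (1/64000)"
    using p p3 by (intro mult_mono) auto
  then have "real n * (exp 2 * p) ^ 3 \<le> 1/50" by (simp add: power_mult_distrib mult_ac)
  moreover have "3 * - ln p \<le> 2 * L" "L \<le> 3 * - ln p" "(1 + 3 / 2) * - ln p \<le> (1 - e) * L"
    using 1 2 eL L0 by (simp_all add: algebra_simps)
  ultimately show ?thesis by (simp add: suitable_clique_size_def L_def[symmetric])
qed

text \<open>With \<nu> for \<open>- ln p\<close> and \<open>L\<close> for \<open>ln n\<close>,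
  \<open>r\<close> exceeds \<open>(1 + e) * L / \<nu>\<close> by at most 1. Being at least that
  large makes \<open>p^r \<le> n powr (- 1 - e)\<close>. Because of the rounding,
  \<open>(1 + r / 2) * \<nu>\<close> may reach \<open>(1 + e) * L / 2 + 3/2 * \<nu>\<close>, which
  is at most \<open>(1 - e) * L\<close> exactly if \<open>\<nu> \<le> (1/3 - e) * L\<close>: this is
  the assumed lower bound on \<open>p\<close>.\<close>

lemma ex_suitable_clique_size_dense:
  assumes n: "n \<ge> 2" and p: "p > 0" and lb: "real n powr (-1/3 + e) \<le> p" and ub: "ln p \<le> - (8 / e)"
    and e: "0 < e" "e \<le> 1/100" and big: "50 \<le> exp (e / 2 * ln (real n))"
  shows "\<exists>r. suitable_clique_size e n p r"
proof -
  define L where "L = ln (real n)"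
  define \<nu> where "\<nu> = - ln p"
  have L0: "L > 0" using n by (simp add: L_def)
  have "8 / e > 0" using e by simp
  then have \<nu>0: "\<nu> > 0" using ub unfolding \<nu>_def by linarith
  have e\<nu>: "8 \<le> e * \<nu>" using ub e by (simp add: \<nu>_def field_simps)
  have "ln (real n powr (-1/3 + e)) \<le> ln p" using lb n p by (intro ln_mono) auto
  then have \<nu>L: "\<nu> \<le> (1/3 - e) * L" using n by (simp add: L_def \<nu>_def ln_powr algebra_simps)
  define x where "x = (1 + e) * L / \<nu>"
  have x: "x * \<nu> = (1 + e) * L" using \<nu>0 by (simp add: x_def)
  have eL: "0 < e * L" "e * L \<le> L / 100" using e L0 mult_right_mono[of e "1/100" L] by auto
  have "3 * \<nu> \<le> x * \<nu>" unfolding x using \<nu>L eL by (simp add: algebra_simps)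
  then have x3: "x \<ge> 3" using \<nu>0 by simp
  define r where "r = nat \<lfloor>x\<rfloor> + 1"
  have r: "x \<le> real r" "real r \<le> x + 1" using x3 by (auto simp: r_def) linarith+
  have r\<nu>: "(1 + e) * L \<le> real r * \<nu>" "real r * \<nu> \<le> (1 + e) * L + \<nu>"
    using mult_right_mono[OF r(1), of \<nu>] mult_right_mono[OF r(2), of \<nu>] \<nu>0
    unfolding distrib_right[of x 1 \<nu>] x by linarith+
  have F2: "real r * \<nu> \<le> 2 * L" using r\<nu>(2) \<nu>L eL by (simp add: algebra_simps)
  have "real n * (exp 2 * p) ^ r \<le> 1/50"
  proof -
    have "real n * (exp 2 * p) ^ r = exp (L + 2 * real r - real r * \<nu>)"
    proof -
      have "exp 2 * p = exp (2 - \<nu>)" using p by (simp add: \<nu>_def exp_add)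
      then show ?thesis using n by (simp add: L_def algebra_simps flip: exp_of_nat_mult exp_add) (simp add: exp_add exp_diff algebra_simps)
    qed
    also have "\<dots> \<le> exp (- (e / 2 * L))"
    proof -
      \<comment> \<open>\<open>\<nu> \<ge> 8 / e\<close> keeps the factor \<open>exp (2 * r)\<close>
        below \<open>n powr (e / 2)\<close>, half of the gain of \<open>n powr e\<close>.\<close>
      have "real r * 8 \<le> real r * (e * \<nu>)" using e\<nu> by (intro mult_left_mono) auto
      also have "\<dots> \<le> e * (2 * L)" using mult_left_mono[OF F2, of e] e by (simp add: mult_ac)
      finally show ?thesis using r\<nu>(1) by (simp add: algebra_simps)
    qed
    also have "\<dots> \<le> 1/50" using big by (simp add: exp_minus field_simps L_def)
    finally show ?thesis .
  qed
  moreover have "r \<ge> 3" using x3 by (simp add: r_def le_nat_iff le_floor_iff)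
  moreover have "(1 + real r / 2) * \<nu> \<le> (1 - e) * L"
    using r\<nu>(2) \<nu>L by (simp add: algebra_simps)
  moreover have "L \<le> real r * \<nu>" using r\<nu>(1) eL by (simp add: algebra_simps)
  ultimately show ?thesis using F2
    unfolding suitable_clique_size_def L_def \<nu>_def by blast
qed

lemma prob_clique_chromatic_number_ge:
  fixes p e :: real and n r t :: nat
  defines "L \<equiv> ln (real n)"
  assumes n: "n \<ge> 2" and p: "0 < p" "ln p \<le> - 100" and e: "0 < e" "e \<le> 1/100" and t: "8 / e < real t"
    and r: "suitable_clique_size e n p r"
    and L: "L \<ge> 1" "exp (L / 10) \<ge> 400 * L" "exp (5/8 * e * L) \<ge> 3072 * L ^ 5" "exp (e / 16 * L) \<ge> 6 * L\<^sup>2"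
      "400 * L\<^sup>2 \<le> exp (3/10 * L)" "200 * L \<le> exp (L / 300)"
  shows "1 - 5 / real n \<le> measure_pmf.prob (binomial_random_graph n p)
       {E. e / (32 * real t) * (L / p) \<le> real (clique_chromatic_number {1..n} E) \<and>
           real (clique_chromatic_number {1..n} E) \<le> 4 * (L / p)}"
proof -
  let ?P = "rsprob (vertex_pairs {1..n}) p"
  define X where "X E = clique_chromatic_number {1..n} E" for E
  define k where "k = nat \<lfloor>e / (32 * real t) * (L / p)\<rfloor>"
  \<comment> \<open>Chosen so that
    \<open>n * (1 - p) ^ (m - 1) \<le> n * exp (- 2 * L) = 1 / n\<close>.\<close>
  define m where "m = nat \<lceil>2 * L / p\<rceil> + 1"
  define \<nu> where "\<nu> = - ln p"
  have p1: "p < 1" using p ln_ge_zero[of p] by fastforce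
  have \<nu>0: "\<nu> \<ge> 100" using p(2) unfolding \<nu>_def by linarith
  have nL: "real n = exp L" using n by (simp add: L_def)
  have "(1 + 3 / 2) * \<nu> \<le> (1 + real r / 2) * \<nu>"
    using r \<nu>0 by (intro mult_right_mono) (auto simp: suitable_clique_size_def)
  also have "\<dots> \<le> (1 - e) * L" using r by (simp add: suitable_clique_size_def \<nu>_def L_def)
  also have "\<dots> \<le> 1 * L" using e L(1) by (intro mult_right_mono) auto
  finally have \<nu>L: "\<nu> \<le> 2/5 * L" by simp
  have Lp: "1 \<le> L / p" using L(1) p p1 by (simp add: field_simps)
  have m1: "real m \<le> 4 * (L / p)" "2 * L / p \<le> real (m - 1)"
  proof -
    have "0 \<le> 2 * L / p" using L(1) p by simp
    then have "real (nat \<lceil>2 * L / p\<rceil>) \<le> 2 * (L / p) + 1" "2 * L / p \<le> real (nat \<lceil>2 * L / p\<rceil>)" by linarith+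
    then show "real m \<le> 4 * (L / p)" "2 * L / p \<le> real (m - 1)"
      using Lp unfolding m_def by (simp_all only: of_nat_add of_nat_1 diff_add_inverse2)
  qed
  have "real m \<le> real n"
  proof -
    have "real m \<le> 4 * L * exp \<nu>" using m1(1) p by (simp add: \<nu>_def exp_minus divide_inverse)
    also have "\<dots> \<le> exp (L / 10) * exp (2/5 * L)" using L(1,2) \<nu>L by (intro mult_mono) auto
    also have "\<dots> \<le> exp L" using L(1) by (simp flip: exp_add)
    finally show ?thesis by (simp add: nL)
  qed
  then have mn: "m \<le> card {1..n}" by simp
  have "?P {E. \<not> X E \<le> m} \<le> real (card {1..n}) * (1 - p) ^ (m - 1)"
    unfolding X_def clique_chromatic_number_le_iff[OF finite_atLeastAtMost]
    by (rule prob_not_clique_colorable_le) (use mn p p1 in auto)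
  also have "(1 - p) ^ (m - 1) \<le> exp (- p) ^ (m - 1)"
    using p1 exp_ge_add_one_self[of "- p"] by (intro power_mono) auto
  also have "\<dots> = exp (- (p * real (m - 1)))" by (simp add: mult.commute flip: exp_of_nat_mult)
  also have "\<dots> \<le> exp (- (2 * L))" using m1(2) p by (simp add: field_simps)
  also have "real (card {1..n}) * exp (- (2 * L)) = 1 / real n"
    by (simp add: nL flip: exp_add) (simp add: exp_minus inverse_eq_divide)
  finally have up: "?P {E. \<not> X E \<le> m} \<le> 1 / real n" by (simp add: mult_left_mono)
  have "?P {E. X E \<le> k} \<le> 4 / real n"
    unfolding X_def clique_chromatic_number_le_iff[OF finite_atLeastAtMost] k_def
    by (rule prob_few_colors_le[where r = r and \<nu> = \<nu>])
       (use n p e t L r in \<open>auto simp: \<nu>_def L_def suitable_clique_size_def\<close>)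
  then have "?P ({E. X E \<le> k} \<union> {E. \<not> X E \<le> m}) \<le> 4 / real n + 1 / real n"
    using up by (intro order_trans[OF measure_Un_le]) auto
  moreover have "- {E. e / (32 * real t) * (L / p) \<le> real (X E) \<and> real (X E) \<le> 4 * (L / p)}
      \<subseteq> {E. X E \<le> k} \<union> {E. \<not> X E \<le> m}"
  proof
    fix E assume "E \<in> - {E. e / (32 * real t) * (L / p) \<le> real (X E) \<and> real (X E) \<le> 4 * (L / p)}"
    then consider "real (X E) < e / (32 * real t) * (L / p)" | "4 * (L / p) < real (X E)" by fastforce
    then show "E \<in> {E. X E \<le> k} \<union> {E. \<not> X E \<le> m}"
    proof cases
      case 1
      then show ?thesis unfolding k_def by (auto intro: le_nat_floor)
    next
      case 2
      then have "real m < real (X E)" using m1(1) by linarith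
      then show ?thesis by simp
    qed
  qed
  then have "?P (- {E. e / (32 * real t) * (L / p) \<le> real (X E) \<and> real (X E) \<le> 4 * (L / p)})
      \<le> ?P ({E. X E \<le> k} \<union> {E. \<not> X E \<le> m})"
    by (rule measure_pmf.finite_measure_mono) auto
  ultimately have "?P (- {E. e / (32 * real t) * (L / p) \<le> real (X E) \<and> real (X E) \<le> 4 * (L / p)}) \<le> 5 / real n"
    by simp
  moreover have "binomial_random_graph n p = random_subset (vertex_pairs {1..n}) p"
    by (simp add: binomial_random_graph_def random_subset_def)
  ultimately show ?thesis
    using measure_pmf.prob_compl[of "{E. e / (32 * real t) * (L / p) \<le> real (X E) \<and> real (X E) \<le> 4 * (L / p)}"
        "random_subset (vertex_pairs {1..n}) p"]
    by (simp add: X_def Compl_eq_Diff_UNIV)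
qed

lemma eventually_suitable_clique_size:
  fixes p :: "nat \<Rightarrow> real"
  assumes p: "\<forall>n\<ge>1. 0 < p n \<and> p n < 1" and e: "0 < e" "e \<le> 1/100" "e \<le> \<epsilon>"
    and "(\<lambda>n. real n powr (-2/5 + \<epsilon>)) \<in> o(p) \<and> p \<in> o(\<lambda>n. real n powr (-1/3)) \<or>
     (\<lambda>n. real n powr (-1/3 + \<epsilon>)) \<in> o(p) \<and> p \<in> o(\<lambda>n. 1)"
  shows "\<forall>\<^sub>F n in sequentially. \<exists>r. suitable_clique_size e n (p n) r \<and> ln (p n) \<le> - 100"
  using assms(5)
proof (elim disjE conjE)
  assume lb: "(\<lambda>n. real n powr (-2/5 + \<epsilon>)) \<in> o(p)" and ub: "p \<in> o(\<lambda>n. real n powr (-1/3))"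
  have "\<forall>\<^sub>F n in sequentially. 300 \<le> ln (real n)" by real_asymp
  moreover have "\<forall>\<^sub>F n in sequentially. norm (p n) \<le> 1/40 * norm (real n powr (-1/3))"
    by (rule landau_o.smallD[OF ub]) simp
  moreover note landau_o.smallD[OF lb zero_less_one]
  ultimately show ?thesis
  proof (eventually_elim)
    case (elim n)
    have "ln (real n) > 0" using elim(1) by simp
    then have n: "n \<ge> 2" by (cases "n = 0"; cases "n = 1") auto
    have pn: "0 < p n" "p n < 1" using p n by auto
    have "real n powr (-2/5 + e) \<le> real n powr (-2/5 + \<epsilon>)" using n e by (intro powr_mono) auto
    also have "\<dots> \<le> p n" using elim(3) pn by simp
    finally have 1: "real n powr (-2/5 + e) \<le> p n" .
    have 2: "p n \<le> 1/40 * real n powr (-1/3)" using elim(2) pn by simp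
    have s: "suitable_clique_size e n (p n) 3"
      by (rule suitable_clique_size_sparse) (use n pn 1 2 e in auto)
    \<comment> \<open>\<open>suitable_clique_size\<close> for size 3 contains
      \<open>ln n \<le> 3 * - ln p\<close>; hence the threshold 300 for \<open>ln n\<close>.\<close>
    then have "ln (p n) \<le> - 100" using elim(1) by (simp add: suitable_clique_size_def)
    with s show ?case by blast
  qed
next
  assume lb: "(\<lambda>n. real n powr (-1/3 + \<epsilon>)) \<in> o(p)" and ub: "p \<in> o(\<lambda>n. 1)"
  have "\<forall>\<^sub>F n in sequentially. 50 \<le> exp (e / 2 * ln (real n))" using e by real_asymp
  moreover have "\<forall>\<^sub>F n in sequentially. norm (p n) \<le> exp (- (8 / e)) * norm (1 :: real)"
    by (rule landau_o.smallD[OF ub]) simp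
  moreover note landau_o.smallD[OF lb zero_less_one] eventually_ge_at_top[of 2]
  ultimately show ?thesis
  proof (eventually_elim)
    case (elim n)
    have pn: "0 < p n" "p n < 1" using p elim(4) by auto
    have "real n powr (-1/3 + e) \<le> real n powr (-1/3 + \<epsilon>)" using elim(4) e by (intro powr_mono) auto
    also have "\<dots> \<le> p n" using elim(3) pn by simp
    finally have 1: "real n powr (-1/3 + e) \<le> p n" .
    have "ln (p n) \<le> ln (exp (- (8 / e)))" using elim(2) pn by (intro ln_mono) auto
    then have 2: "ln (p n) \<le> - (8 / e)" by simp
    have "800 \<le> 8 / e" using e by (simp add: field_simps)
    with 2 have "ln (p n) \<le> - 100" by linarith
    moreover have "\<exists>r. suitable_clique_size e n (p n) r"
      by (rule ex_suitable_clique_size_dense) (use elim pn 1 2 e in auto)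
    ultimately show ?case by blast
  qed
qed

theorem theorem1p1:
  fixes \<epsilon> :: real
  assumes "\<epsilon> > 0"
  shows "\<exists>c>0. \<exists>C>0. \<forall>p :: nat \<Rightarrow> real.
    (\<forall>n\<ge>1. 0 < p n \<and> p n < 1) \<and>
    ((\<lambda>n. real n powr (-2/5 + \<epsilon>)) \<in> o(p) \<and> p \<in> o(\<lambda>n. real n powr (-1/3)) \<or>
     (\<lambda>n. real n powr (-1/3 + \<epsilon>)) \<in> o(p) \<and> p \<in> o(\<lambda>n. 1)) \<longrightarrow>
    (\<lambda>n. measure_pmf.prob (binomial_random_graph n (p n))
       {E. c * (ln (real n) / p n) \<le> real (clique_chromatic_number {1..n} E) \<and>
           real (clique_chromatic_number {1..n} E) \<le> C * (ln (real n) / p n)})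
      \<longlonglongrightarrow> 1"
proof -
  \<comment> \<open>A smaller exponent only weakens the assumed lower bound on \<open>p\<close>, so
    the numerical margins may rely on \<open>e \<le> 1/100\<close>. Both \<open>e\<close> and
    \<open>t\<close> are fixed before \<open>p\<close>.\<close>
  define e where "e = min \<epsilon> (1/100)"
  have e: "0 < e" "e \<le> 1/100" "e \<le> \<epsilon>" using assms by (auto simp: e_def)
  obtain t :: nat where t: "8 / e < real t" using reals_Archimedean2 by blast
  have t0: "0 < real t" using t e by (meson divide_pos_pos less_trans zero_less_numeral)
  show ?thesis
  proof (rule exI, rule conjI)
    show "0 < e / (32 * real t)" using e t0 by simp
    show "\<exists>C>0. \<forall>p :: nat \<Rightarrow> real.
      (\<forall>n\<ge>1. 0 < p n \<and> p n < 1) \<and>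
      ((\<lambda>n. real n powr (-2/5 + \<epsilon>)) \<in> o(p) \<and> p \<in> o(\<lambda>n. real n powr (-1/3)) \<or>
       (\<lambda>n. real n powr (-1/3 + \<epsilon>)) \<in> o(p) \<and> p \<in> o(\<lambda>n. 1)) \<longrightarrow>
      (\<lambda>n. measure_pmf.prob (binomial_random_graph n (p n))
         {E. e / (32 * real t) * (ln (real n) / p n) \<le> real (clique_chromatic_number {1..n} E) \<and>
             real (clique_chromatic_number {1..n} E) \<le> C * (ln (real n) / p n)})
        \<longlonglongrightarrow> 1"
    proof (rule exI[of _ 4], intro conjI allI impI)
      fix p :: "nat \<Rightarrow> real"
      assume asm: "(\<forall>n\<ge>1. 0 < p n \<and> p n < 1) \<and>
        ((\<lambda>n. real n powr (-2/5 + \<epsilon>)) \<in> o(p) \<and> p \<in> o(\<lambda>n. real n powr (-1/3)) \<or>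
         (\<lambda>n. real n powr (-1/3 + \<epsilon>)) \<in> o(p) \<and> p \<in> o(\<lambda>n. 1))"
      let ?f = "\<lambda>n. measure_pmf.prob (binomial_random_graph n (p n))
         {E. e / (32 * real t) * (ln (real n) / p n) \<le> real (clique_chromatic_number {1..n} E) \<and>
             real (clique_chromatic_number {1..n} E) \<le> 4 * (ln (real n) / p n)}"
      have "\<forall>\<^sub>F n in sequentially. \<exists>r. suitable_clique_size e n (p n) r \<and> ln (p n) \<le> - 100"
        using asm by (intro eventually_suitable_clique_size[OF _ e]) auto
      moreover have "\<forall>\<^sub>F n in sequentially. ln (real n) \<ge> 1"
        "\<forall>\<^sub>F n in sequentially. exp (ln (real n) / 10) \<ge> 400 * ln (real n)"
        "\<forall>\<^sub>F n in sequentially. exp (5/8 * e * ln (real n)) \<ge> 3072 * ln (real n) ^ 5"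
        "\<forall>\<^sub>F n in sequentially. exp (e / 16 * ln (real n)) \<ge> 6 * (ln (real n))\<^sup>2"
        "\<forall>\<^sub>F n in sequentially. 400 * (ln (real n))\<^sup>2 \<le> exp (3/10 * ln (real n))"
        "\<forall>\<^sub>F n in sequentially. 200 * ln (real n) \<le> exp (ln (real n) / 300)"
        using e(1) by real_asymp+
      ultimately have ev: "\<forall>\<^sub>F n in sequentially. 1 - 5 / real n \<le> ?f n"
        using eventually_ge_at_top[of 2]
      proof eventually_elim
        case (elim n)
        then obtain r where r: "suitable_clique_size e n (p n) r" "ln (p n) \<le> - 100" by blast
        show ?case
          by (rule prob_clique_chromatic_number_ge[OF _ _ r(2) e(1,2) t r(1)]) (use elim asm in auto)
      qed
      show "?f \<longlonglongrightarrow> 1"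
      proof (rule tendsto_sandwich[OF ev, where h = "\<lambda>_. 1"])
        show "\<forall>\<^sub>F n in sequentially. ?f n \<le> 1" by simp
        show "(\<lambda>n. 1 - 5 / real n) \<longlonglongrightarrow> 1" by real_asymp
      qed simp
    qed simp
  qed
qed

end
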